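(* Suppose $X$ is a symmetric space on $[0,1]$ such that $\mathrm{Sym}(X)\ne\mathcal{M}(X)$. Then for every positive measurable function $w\in\mathcal{M}(X)\setminus\mathrm{Sym}(X)$ satisfying $L_\infty\subset X(w)\subset L_1$, the Rademacher functions span $\ell_2$ in $X(w)$ but $X(w)\not\supset G$.
   Context: All functions are (classes of) real measurable, a.e. finite functions on $[0,1]$; $m$ is Lebesgue measure; $L_p=L_p[0,1]$. The decreasing rearrangement $x^*$ of $x$ is the right-continuous inverse of $n_x(\tau)=m\{t:|x(t)|>\tau\}$; $x,y$ are equimeasurable if $n_x=n_y$ on $(0,\infty)$. The Köthe dual $E'$ of a Banach function lattice $E$ is the space of all $y$ with $\int_0^1|xy|\,dt<\infty$ for all $x\in E$, with norm $\|y\|_{E'}=\sup\{\int_0^1 xy\,dt:\|x\|_E\le1\}$; $E''=(E')'$. A symmetric space $X$ is a (nonzero) Banach space of such functions such that $y^*\le x^*$, $x\in X$ imply $y\in X$ and $\|y\|_X\le\|x\|_X$. Then $L_\infty\subset X\subset L_1$ continuously. Standing assumption: the natural inclusion of $X$ into $X''$ is isometric, i.e. $\|x\|_X=\|x\|_{X''}$ for $x\in X$. Weighted space: $X(w)=\{f: fw\in X\}$ with $\|f\|_{X(w)}=\|fw\|_X$. $\mathrm{Exp}\,L^2$ is the Orlicz space $L_{N_2}$ on $[0,1]$ (Luxemburg norm), where $N_2$ is an Orlicz function equivalent to $\exp(t^2)-1$. $G$ is the closure of $L_\infty$ in $\mathrm{Exp}\,L^2$. Rademacher functions: $r_k(t)=\mathrm{sign}\,\sin(2^k\pi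 t)$, $t\in[0,1]$, $k\ge1$. "The Rademacher functions span $\ell_2$ in $E$" means that there are constants $c,C>0$ with $c\|(a_k)\|_{\ell_2}\le\|\sum_{k=1}^\infty a_kr_k\|_E\le C\|(a_k)\|_{\ell_2}$ for all $(a_k)\in\ell_2$. Rademacher multiplicator space $\mathcal{M}(X)$: all measurable $f:[0,1]\to\mathbb{R}$ such that $f\cdot\sum_{k=1}^\infty a_kr_k\in X$ for every Rademacher sum $\sum_{k=1}^\infty a_kr_k\in X$, with norm $\|f\|_{\mathcal{M}(X)}=\sup\{\|f\sum a_kr_k\|_X:\|\sum a_kr_k\|_X\le1\}$. Symmetric kernel $\mathrm{Sym}(X)$: all $f\in\mathcal{M}(X)$ such that every $g$ equimeasurable with $f$ also belongs to $\mathcal{M}(X)$. *)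

theory Defs
  imports "HOL-Analysis.Analysis"
begin

text \<open>
  Classes of a.e. finite measurable functions on \<open>[0,1]\<close> are represented by total functions of type
  \<open>real \<Rightarrow> real\<close>, of which only the values on \<open>[0,1]\<close>, up to null sets, are relevant.
\<close>

abbreviation I01 :: "real measure" where
  "I01 \<equiv> lebesgue_on {0..1}"

record fun_space =
  carrier :: "(real \<Rightarrow> real) set"
  nrm :: "(real \<Rightarrow> real) \<Rightarrow> real"

definition L_infty :: "(real \<Rightarrow> real) set" where
  "L_infty = {f \<in> borel_measurable I01. \<exists>C. AE t in I01. \<bar>f t\<bar> \<le> C}"

definition L_one :: "(real \<Rightarrow> real) set" where
  "L_one = {f. integrable I01 f}"

definition distr_fun :: "(real \<Rightarrow> real) \<Rightarrow> real \<Rightarrow> real" where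
  "distr_fun x \<tau> = measure I01 {t \<in> {0..1}. \<bar>x t\<bar> > \<tau>}"

text \<open>The value at \<open>s = 0\<close>, which would be infinite for unbounded \<open>x\<close>, is never used.\<close>

definition decr_rearr :: "(real \<Rightarrow> real) \<Rightarrow> real \<Rightarrow> real" where
  "decr_rearr x s = Inf {\<tau>. 0 \<le> \<tau> \<and> distr_fun x \<tau> \<le> s}"

definition equimeasurable :: "(real \<Rightarrow> real) \<Rightarrow> (real \<Rightarrow> real) \<Rightarrow> bool" where
  "equimeasurable x y \<longleftrightarrow> (\<forall>\<tau>>0. distr_fun x \<tau> = distr_fun y \<tau>)"

definition banach_function_space :: "fun_space \<Rightarrow> bool" where
  "banach_function_space E \<longleftrightarrow>
     carrier E \<subseteq> borel_measurable I01 \<and>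
     (\<lambda>t. 0) \<in> carrier E \<and>
     (\<forall>x\<in>carrier E. \<forall>y\<in>carrier E. (\<lambda>t. x t + y t) \<in> carrier E) \<and>
     (\<forall>c. \<forall>x\<in>carrier E. (\<lambda>t. c * x t) \<in> carrier E) \<and>
     (\<forall>x\<in>carrier E. nrm E x \<ge> 0) \<and>
     (\<forall>x\<in>carrier E. nrm E x = 0 \<longleftrightarrow> (AE t in I01. x t = 0)) \<and>
     (\<forall>x\<in>carrier E. \<forall>y\<in>carrier E. nrm E (\<lambda>t. x t + y t) \<le> nrm E x + nrm E y) \<and>
     (\<forall>c. \<forall>x\<in>carrier E. nrm E (\<lambda>t. c * x t) = \<bar>c\<bar> * nrm E x) \<and>
     (\<forall>u. (\<forall>n::nat. u n \<in> carrier E) \<and>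
          (\<forall>e>0. \<exists>N. \<forall>m\<ge>N. \<forall>n\<ge>N. nrm E (\<lambda>t. u m t - u n t) < e) \<longrightarrow>
          (\<exists>x\<in>carrier E. (\<lambda>n. nrm E (\<lambda>t. u n t - x t)) \<longlonglongrightarrow> 0))"

text \<open>
  Invariance of the carrier and of the norm under a.e. equality is contained in the last
  condition, since a.e. equal functions have the same decreasing rearrangement.
\<close>

definition symmetric_space :: "fun_space \<Rightarrow> bool" where
  "symmetric_space X \<longleftrightarrow>
     banach_function_space X \<and>
     (\<exists>x\<in>carrier X. \<not> (AE t in I01. x t = 0)) \<and>
     (\<forall>x\<in>carrier X. \<forall>y\<in>borel_measurable I01.
        (\<forall>s\<in>{0<..<1}. decr_rearr y s \<le> decr_rearr x s) \<longrightarrow>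
        y \<in> carrier X \<and> nrm X y \<le> nrm X x)"

text \<open>
  For a Banach function lattice the set under the supremum is bounded above whenever \<open>y\<close> lies in
  the carrier, so the real supremum is the intended one.
\<close>

definition kothe_dual :: "fun_space \<Rightarrow> fun_space" where
  "kothe_dual E =
     \<lparr>carrier = {y \<in> borel_measurable I01. \<forall>x\<in>carrier E. integrable I01 (\<lambda>t. \<bar>x t * y t\<bar>)},
      nrm = (\<lambda>y. Sup {LINT t|I01. x t * y t | x. x \<in> carrier E \<and> nrm E x \<le> 1})\<rparr>"

text \<open>The set inclusion of \<open>X\<close> in its second Koethe dual is automatic.\<close>

definition isometric_in_bidual :: "fun_space \<Rightarrow> bool" where
  "isometric_in_bidual X \<longleftrightarrow> (\<forall>x\<in>carrier X. nrm X x = nrm (kothe_dual (kothe_dual X)) x)"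

definition weighted :: "fun_space \<Rightarrow> (real \<Rightarrow> real) \<Rightarrow> fun_space" where
  "weighted X w =
     \<lparr>carrier = {f \<in> borel_measurable I01. (\<lambda>t. f t * w t) \<in> carrier X},
      nrm = (\<lambda>f. nrm X (\<lambda>t. f t * w t))\<rparr>"

definition orlicz_function :: "(real \<Rightarrow> real) \<Rightarrow> bool" where
  "orlicz_function N \<longleftrightarrow>
     convex_on {0..} N \<and> continuous_on {0..} N \<and> mono_on {0..} N \<and> N 0 = 0 \<and>
     filterlim N at_top at_top"

text \<open>Equivalence at infinity, which is what determines an Orlicz space over \<open>[0,1]\<close>.\<close>

definition orlicz_equivalent :: "(real \<Rightarrow> real) \<Rightarrow> (real \<Rightarrow> real) \<Rightarrow> bool" where
  "orlicz_equivalent M N \<longleftrightarrow>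
     (\<exists>C>0. \<exists>t0\<ge>0. \<forall>t\<ge>t0. N (t / C) \<le> M t \<and> M t \<le> N (C * t))"

definition orlicz_space :: "(real \<Rightarrow> real) \<Rightarrow> fun_space" where
  "orlicz_space N =
     \<lparr>carrier = {f \<in> borel_measurable I01.
        \<exists>\<rho>>0. (\<integral>\<^sup>+ t. ennreal (N (\<bar>f t\<bar> / \<rho>)) \<partial>I01) < \<infinity>},
      nrm = (\<lambda>f. Inf {\<rho>. 0 < \<rho> \<and> (\<integral>\<^sup>+ t. ennreal (N (\<bar>f t\<bar> / \<rho>)) \<partial>I01) \<le> 1})\<rparr>"

definition closure_L_infty :: "fun_space \<Rightarrow> (real \<Rightarrow> real) set" where
  "closure_L_infty E =
     {f \<in> carrier E. \<forall>e>0. \<exists>g\<in>L_infty \<inter> carrier E. nrm E (\<lambda>t. f t - g t) < e}"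

definition rademacher :: "nat \<Rightarrow> real \<Rightarrow> real" where
  "rademacher k t = sgn (sin (2 ^ k * pi * t))"

text \<open>
  The functions \<open>r_k\<close> are used for \<open>k \<ge> 1\<close> only, so the coefficient \<open>a k\<close> belongs to
  \<open>rademacher (Suc k)\<close>.
\<close>

definition rademacher_sum :: "(nat \<Rightarrow> real) \<Rightarrow> real \<Rightarrow> real" where
  "rademacher_sum a t = (\<Sum>k. a k * rademacher (Suc k) t)"

definition rademacher_convergent :: "(nat \<Rightarrow> real) \<Rightarrow> bool" where
  "rademacher_convergent a \<longleftrightarrow> (AE t in I01. summable (\<lambda>k. a k * rademacher (Suc k) t))"

definition ell2 :: "(nat \<Rightarrow> real) set" where
  "ell2 = {a. summable (\<lambda>k. (a k)\<^sup>2)}"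

definition ell2_norm :: "(nat \<Rightarrow> real) \<Rightarrow> real" where
  "ell2_norm a = sqrt (\<Sum>k. (a k)\<^sup>2)"

definition rademacher_span_ell2 :: "fun_space \<Rightarrow> bool" where
  "rademacher_span_ell2 E \<longleftrightarrow>
     (\<exists>c>0. \<exists>C>0. \<forall>a\<in>ell2.
        rademacher_convergent a \<and> rademacher_sum a \<in> carrier E \<and>
        c * ell2_norm a \<le> nrm E (rademacher_sum a) \<and>
        nrm E (rademacher_sum a) \<le> C * ell2_norm a)"

definition multiplicator :: "fun_space \<Rightarrow> (real \<Rightarrow> real) set" where
  "multiplicator X =
     {f \<in> borel_measurable I01.
        \<forall>a. rademacher_convergent a \<and> rademacher_sum a \<in> carrier X \<longrightarrow>
            (\<lambda>t. f t * rademacher_sum a t) \<in> carrier X}"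

definition sym_kernel :: "fun_space \<Rightarrow> (real \<Rightarrow> real) set" where
  "sym_kernel X =
     {f \<in> multiplicator X.
        \<forall>g\<in>borel_measurable I01. equimeasurable f g \<longrightarrow> g \<in> multiplicator X}"

end

theory Submission
  imports Defs
begin

text \<open>
  Nested balls and the completeness of \<open>X\<close> give a constant \<open>K\<close> with \<open>\<parallel>w R\<parallel> \<le> K \<parallel>R\<parallel>\<close> for all
  Rademacher polynomials \<open>R\<close>. Since \<open>w\<close> is not in the symmetric kernel, it is unbounded, so
  \<open>D = {w > 6 K}\<close> has positive measure and multiplication by its indicator has norm at most \<open>1/6\<close> on
  Rademacher polynomials. Moving \<open>R\<close> to far indices makes it nearly independent of \<open>D\<close>, while the
  Hoffmann-Jorgensen inequality \<open>m{|R| > 3 t} \<le> 4 m{|R| > t}\<^sup>2\<close> shows that cutting the distribution of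
  \<open>R\<close> by the factor \<open>m(D)/2\<close> costs only a factor \<open>3\<close> in size, up to a bounded part. Hence
  \<open>\<parallel>R\<parallel> \<le> C \<parallel>a\<parallel>\<close> in terms of the \<open>\<ell>\<^sub>2\<close> norm of the coefficients, which gives the upper estimate in \<open>X(w)\<close>;
  the lower one is Khinchine's \<open>L\<^sub>1\<close> inequality combined with \<open>X(w) \<subseteq> L\<^sub>1\<close>.

  If \<open>G \<subseteq> X(w)\<close> and \<open>v\<close> is equimeasurable with \<open>w\<close>, move a Rademacher sum \<open>R\<close> from the dyadic level sets
  of \<open>|v|\<close> to those of \<open>|w|\<close> without changing its distribution there. The result lies in \<open>G\<close>, and its
  product with \<open>w\<close> dominates \<open>v R\<close> up to a factor \<open>2\<close>. So \<open>v\<close> is a multiplicator for every such \<open>v\<close>,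
  contradicting \<open>w \<notin> Sym(X)\<close>.
\<close>

section \<open>Sums over random signs\<close>

text \<open>The estimate \<open>||R|| <= C ||a||\<close> closes by absorption. If \<open>h\<close>
  is a far shift of \<open>R\<close> restricted to \<open>D\<close>, then
  \<open>||h|| <= ||R|| / 6\<close>, while in distribution \<open>|R| <= 3 (r + |h|)\<close>; hence
  \<open>||R|| <= 3 r ||1|| + ||R|| / 2\<close>. The 6 is twice the 3 of Hoffmann-Jorgensen. The
  shift is free: it changes neither the distribution of \<open>R\<close> nor the l2 norm of its
  coefficients. The nested balls need \<open>||w u|| > c\<close> to be an open condition on
  \<open>u\<close>; this is where the isometry of X with its second dual enters, through norming
  functionals. The closure G, and not only Exp L^2, is reached because an l2 sum has Gaussian tails
  of every rate: removing finitely many bounded terms makes the remaining variance as small as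
  desired. Probability is encoded as \<open>sign_mean \<phi> as s\<close>, the mean of
  \<open>\<phi>\<close> at \<open>s\<close> plus a randomly signed sum of \<open>as\<close>. Its
  recursion on the first sign matches the halving of [0,1], so inequalities are proved by induction
  on lists and then transferred to Rademacher polynomials.\<close>

fun sign_mean :: "(real \<Rightarrow> real) \<Rightarrow> real list \<Rightarrow> real \<Rightarrow> real" where
  "sign_mean \<phi> [] s = \<phi> s"
| "sign_mean \<phi> (a # as) s = (sign_mean \<phi> as (s + a) + sign_mean \<phi> as (s - a)) / 2"

definition sign_tail :: "real \<Rightarrow> real list \<Rightarrow> real \<Rightarrow> real" where
  "sign_tail t = sign_mean (\<lambda>x. if \<bar>x\<bar> > t then 1 else 0)"

text \<open>The probability that some partial sum, the start \<open>s\<close> included, exceeds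
  \<open>t\<close> in absolute value; the walk is stopped at its first exit.\<close>

fun sign_max_tail :: "real \<Rightarrow> real list \<Rightarrow> real \<Rightarrow> real" where
  "sign_max_tail t [] s = (if \<bar>s\<bar> > t then 1 else 0)"
| "sign_max_tail t (a # as) s =
     (if \<bar>s\<bar> > t then 1 else (sign_max_tail t as (s + a) + sign_max_tail t as (s - a)) / 2)"

lemma sign_tail_simps [simp]:
  "sign_tail t [] s = (if \<bar>s\<bar> > t then 1 else 0)"
  "sign_tail t (a # as) s = (sign_tail t as (s + a) + sign_tail t as (s - a)) / 2"
  by (simp_all add: sign_tail_def)

lemma sign_mean_mono: "(\<And>x. \<phi> x \<le> \<psi> x) \<Longrightarrow> sign_mean \<phi> as s \<le> sign_mean \<psi> as s"
  by (induction as arbitrary: s) (auto intro!: divide_right_mono add_mono)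

lemma sign_mean_linear:
  "sign_mean (\<lambda>x. b * \<phi> x + c * \<psi> x) as s = b * sign_mean \<phi> as s + c * sign_mean \<psi> as s"
  by (induction as arbitrary: s) (auto simp: field_simps)

lemma sign_tail_nonneg: "0 \<le> sign_tail t as s"
  by (induction as arbitrary: s) auto

lemma sign_tail_uminus: "sign_tail t as (- s) = sign_tail t as s"
proof (induction as arbitrary: s)
  case (Cons a as)
  have "- s + a = - (s - a)" "- s - a = - (s + a)" by auto
  then show ?case by (simp only: sign_tail_simps Cons.IH) simp
qed auto

text \<open>A point \<open>x\<close> is the midpoint of \<open>x + s\<close> and
  \<open>x - s\<close>, so one of the two is at least as large in absolute value; this is averaged
  over the signs.\<close>

lemma sign_tail_le_add: "sign_tail t as u \<le> sign_tail t as (u + s) + sign_tail t as (u - s)"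
proof (induction as arbitrary: u)
  case (Cons a as)
  show ?case using Cons[of "u + a"] Cons[of "u - a"] by (simp add: algebra_simps add_divide_distrib)
qed auto

lemma sign_tail_centre: "sign_tail t as 0 \<le> 2 * sign_tail t as s"
  using sign_tail_le_add[of t as 0 s] sign_tail_uminus[of t as s] by simp

text \<open>Every value of the prefix \<open>bs\<close> merely moves the starting point of
  \<open>as\<close>, and \<open>sign_tail_centre\<close> holds at every starting point.\<close>

lemma sign_tail_suffix: "sign_tail t as 0 \<le> 2 * sign_tail t (bs @ as) s"
proof (induction bs arbitrary: s)
  case Nil
  show ?case by (simp add: sign_tail_centre)
next
  case (Cons b bs)
  show ?case using Cons[of "s + b"] Cons[of "s - b"] by simp
qed

lemma sign_tail_ge_half:
  assumes "\<bar>s\<bar> > t"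
  shows "1 \<le> 2 * sign_tail t as s"
proof -
  \<comment> \<open>Reversing all signs reflects the sum about \<open>s\<close>, so the paired
    starting points \<open>s + u\<close> and \<open>s - u\<close> are carried through the
    induction.\<close>
  have "1 \<le> sign_tail t as (s + u) + sign_tail t as (s - u)" for u
  proof (induction as arbitrary: u)
    case Nil
    show ?case using assms by (auto simp: abs_if split: if_splits)
  next
    case (Cons a as)
    show ?case using Cons[of "u + a"] Cons[of "u - a"] by (simp add: algebra_simps add_divide_distrib)
  qed
  from this[of 0] show ?thesis by simp
qed

text \<open>From the first exit on, the remaining signs are symmetric, so by
  \<open>sign_tail_ge_half\<close> the final sum is beyond \<open>t\<close> with conditional
  probability at least 1/2.\<close>

lemma Levy_sign_inequality: "sign_max_tail t as s \<le> 2 * sign_tail t as s"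
proof (induction as arbitrary: s)
  case (Cons a as)
  show ?case
    using Cons[of "s + a"] Cons[of "s - a"] sign_tail_ge_half[of t s "a # as"] by auto
qed auto

text \<open>A step has size at most \<open>t\<close>, so the walk is within \<open>2 t\<close> at
  its first exit from \<open>[-t, t]\<close>. To end beyond \<open>3 t\<close>, the remaining steps
  must then sum to more than \<open>t\<close>, which has probability at most
  \<open>q\<close>.\<close>

lemma sign_tail_le_first_exit:
  assumes "\<bar>s\<bar> \<le> t" "\<forall>a\<in>set as. \<bar>a\<bar> \<le> t"
    and "\<And>bs cs. as = bs @ cs \<Longrightarrow> sign_tail t cs 0 \<le> q"
  shows "sign_tail (3 * t) as s \<le> q * sign_max_tail t as s"
  using assms
proof (induction as arbitrary: s)
  case (Cons a as)
  have q: "0 \<le> q"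
    using Cons.prems(3)[of "a # as" "[]"] sign_tail_nonneg[of t "[]" 0] by (auto split: if_splits)
  have as: "sign_tail t as 0 \<le> q" using Cons.prems(3)[of "[a]" as] by simp
  have IH: "sign_tail (3 * t) as u \<le> q * sign_max_tail t as u" if "\<bar>u\<bar> \<le> t" for u
  proof (rule Cons.IH[OF that])
    show "\<forall>a\<in>set as. \<bar>a\<bar> \<le> t" using Cons.prems(2) by simp
    show "sign_tail t cs 0 \<le> q" if "as = bs @ cs" for bs cs
      using Cons.prems(3)[of "a # bs" cs] that by simp
  qed
  \<comment> \<open>The same signs are used from both starting points: the final values differ by at
    most \<open>2 t\<close>.\<close>
  have big: "sign_tail (3 * t) as u \<le> sign_tail t as v" if "\<bar>u - v\<bar> \<le> 2 * t" for u v
    using that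
  proof (induction as arbitrary: u v)
    case Nil
    then show ?case by auto
  next
    case (Cons b as)
    show ?case using Cons.IH[of "u + b" "v + b"] Cons.IH[of "u - b" "v - b"] Cons.prems by simp
  qed
  have step: "sign_tail (3 * t) as u \<le> q * sign_max_tail t as u" if "\<bar>u\<bar> \<le> 2 * t" for u
  proof (cases "\<bar>u\<bar> \<le> t")
    case False
    then have "sign_max_tail t as u = 1" by (cases as) auto
    then show ?thesis using big[of u 0] that as by simp
  qed (rule IH)
  have "\<bar>s + a\<bar> \<le> 2 * t" "\<bar>s - a\<bar> \<le> 2 * t" using Cons.prems(1,2) by auto
  from step[OF this(1)] step[OF this(2)] Cons.prems(1) show ?case by (simp add: algebra_simps)
qed auto

text \<open>Both factors of the first-exit estimate are at most twice the tail at \<open>t\<close>: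
  the suffix tails by \<open>sign_tail_suffix\<close>, the exit probability by Levy. Hence the
  4.\<close>

lemma Hoffmann_Jorgensen_sign:
  assumes "\<forall>a\<in>set as. \<bar>a\<bar> \<le> t" "0 \<le> t"
  shows "sign_tail (3 * t) as 0 \<le> 4 * (sign_tail t as 0)\<^sup>2"
proof -
  have "sign_tail (3 * t) as 0 \<le> (2 * sign_tail t as 0) * sign_max_tail t as 0"
    using assms by (intro sign_tail_le_first_exit) (auto intro: sign_tail_suffix)
  also have "\<dots> \<le> (2 * sign_tail t as 0) * (2 * sign_tail t as 0)"
    by (intro mult_left_mono Levy_sign_inequality) (simp add: sign_tail_nonneg)
  finally show ?thesis by (simp add: power2_eq_square)
qed

section \<open>Moments and exponential tails of sign sums\<close>

lemma sign_mean_square: "sign_mean (\<lambda>x. x\<^sup>2) as s = s\<^sup>2 + (\<Sum>a\<leftarrow>as. a\<^sup>2)"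
  by (induction as arbitrary: s) (auto simp: power2_eq_square algebra_simps)

lemma sign_mean_fourth: "sign_mean (\<lambda>x. x ^ 4) as 0 \<le> 3 * (\<Sum>a\<leftarrow>as. a\<^sup>2)\<^sup>2"
proof -
  \<comment> \<open>For a general start the exact mean is the right-hand side minus twice the sum of
    the fourth powers; dropping that term keeps the induction closed.\<close>
  have "sign_mean (\<lambda>x. x ^ 4) as s \<le> s ^ 4 + 6 * s\<^sup>2 * (\<Sum>a\<leftarrow>as. a\<^sup>2) + 3 * (\<Sum>a\<leftarrow>as. a\<^sup>2)\<^sup>2" for s
  proof (induction as arbitrary: s)
    case (Cons a as)
    define S where "S = (\<Sum>a\<leftarrow>as. a\<^sup>2)"
    have "sign_mean (\<lambda>x. x ^ 4) (a # as) s \<le>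
      ((s + a) ^ 4 + 6 * (s + a)\<^sup>2 * S + 3 * S\<^sup>2 + ((s - a) ^ 4 + 6 * (s - a)\<^sup>2 * S + 3 * S\<^sup>2)) / 2"
      using Cons[of "s + a"] Cons[of "s - a"] by (simp add: S_def)
    also have "\<dots> = s ^ 4 + 6 * s\<^sup>2 * (a\<^sup>2 + S) + 3 * (a\<^sup>2 + S)\<^sup>2 - 2 * a ^ 4"
      by (simp add: field_simps power2_eq_square power4_eq_xxxx)
    also have "\<dots> \<le> s ^ 4 + 6 * s\<^sup>2 * (a\<^sup>2 + S) + 3 * (a\<^sup>2 + S)\<^sup>2"
      by simp
    finally show ?case unfolding S_def by (simp only: list.map sum_list.Cons)
  qed auto
  from this[of 0] show ?thesis by simp
qed

lemma cosh_le_exp_square: "cosh (x :: real) \<le> exp (x\<^sup>2 / 2)"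
proof -
  have *: "cosh x \<le> exp (x\<^sup>2 / 2)" if x: "0 \<le> x" for x :: real
  proof -
    \<comment> \<open>The derivative of \<open>ln (cosh x)\<close> is \<open>tanh x\<close>, so
      everything reduces to \<open>tanh y \<le> y\<close>.\<close>
    define f where "f = (\<lambda>x::real. x\<^sup>2 / 2 - ln (cosh x))"
    have deriv: "(f has_real_derivative (y - tanh y)) (at y)" for y
      unfolding f_def by (auto intro!: derivative_eq_intros simp: tanh_def cosh_real_pos)
    have "tanh y \<le> y" if "0 \<le> y" for y :: real
    proof -
      have "((\<lambda>y. y - tanh y) has_real_derivative (tanh z)\<^sup>2) (at z)" for z :: real
        by (auto intro!: derivative_eq_intros)
      then have "0 - tanh 0 \<le> y - tanh y"
        by (intro DERIV_nonneg_imp_nondecreasing[OF that]) (meson zero_le_power2)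
      then show ?thesis by simp
    qed
    then have "f 0 \<le> f x"
      by (intro DERIV_nonneg_imp_nondecreasing[OF x]) (use deriv in force)
    then have "ln (cosh x) \<le> x\<^sup>2 / 2" by (simp add: f_def)
    then show ?thesis by (metis cosh_real_pos exp_le_cancel_iff exp_ln)
  qed
  show ?thesis using *[of x] *[of "- x"] by (cases "0 \<le> x") auto
qed

lemma sign_mean_exp: "sign_mean (\<lambda>x. exp (c * x)) as s \<le> exp (c * s + c\<^sup>2 * (\<Sum>a\<leftarrow>as. a\<^sup>2) / 2)"
proof (induction as arbitrary: s)
  case (Cons a as)
  define S where "S = (\<Sum>a\<leftarrow>as. a\<^sup>2)"
  have "sign_mean (\<lambda>x. exp (c * x)) (a # as) s \<le>
      (exp (c * (s + a) + c\<^sup>2 * S / 2) + exp (c * (s - a) + c\<^sup>2 * S / 2)) / 2"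
    using Cons[of "s + a"] Cons[of "s - a"] by (simp add: S_def)
  also have "\<dots> = exp (c * s + c\<^sup>2 * S / 2) * cosh (c * a)"
  proof -
    have "c * (s + a) + c\<^sup>2 * S / 2 = (c * s + c\<^sup>2 * S / 2) + c * a"
      "c * (s - a) + c\<^sup>2 * S / 2 = (c * s + c\<^sup>2 * S / 2) + - (c * a)"
      by (simp_all add: algebra_simps)
    then show ?thesis
      by (simp only: exp_add cosh_def) (simp add: distrib_left add_divide_distrib)
  qed
  also have "\<dots> \<le> exp (c * s + c\<^sup>2 * S / 2) * exp ((c * a)\<^sup>2 / 2)"
    by (intro mult_left_mono cosh_le_exp_square) auto
  also have "\<dots> = exp (c * s + c\<^sup>2 * (a\<^sup>2 + S) / 2)"
    by (simp add: exp_add[symmetric] power_mult_distrib algebra_simps add_divide_distrib)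
  finally show ?case by (simp add: S_def)
qed auto

lemma sign_tail_Chebyshev:
  assumes "0 < t"
  shows "sign_tail t as 0 \<le> (\<Sum>a\<leftarrow>as. a\<^sup>2) / t\<^sup>2"
proof -
  have "(if \<bar>x\<bar> > t then 1 else 0) \<le> 1 / t\<^sup>2 * x\<^sup>2 + 0 * x" for x
  proof (cases "\<bar>x\<bar> > t")
    case True
    then have "t\<^sup>2 \<le> x\<^sup>2" using assms by (metis abs_le_square_iff abs_of_pos less_imp_le)
    then show ?thesis using assms True by simp
  qed simp
  then have "sign_tail t as 0 \<le> sign_mean (\<lambda>x. 1 / t\<^sup>2 * x\<^sup>2 + 0 * x) as 0"
    unfolding sign_tail_def by (rule sign_mean_mono)
  then show ?thesis by (simp only: sign_mean_linear sign_mean_square) simp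
qed

lemma sign_tail_subgaussian:
  assumes t: "0 \<le> t" and v: "0 < v" "(\<Sum>a\<leftarrow>as. a\<^sup>2) \<le> v"
  shows "sign_tail t as 0 \<le> 2 * exp (- (t\<^sup>2 / (2 * v)))"
proof -
  \<comment> \<open>The minimiser of the Chernoff exponent \<open>c^2 v / 2 - c t\<close>, whose
    minimum is \<open>- t^2 / (2 v)\<close>.\<close>
  define c where "c = t / v"
  have c: "0 \<le> c" using t v by (simp add: c_def)
  have "(if \<bar>x\<bar> > t then 1 else 0) \<le> exp (- (c * t)) * exp (c * x) + exp (- (c * t)) * exp (- c * x)"
    for x
  proof (cases "\<bar>x\<bar> > t")
    case True
    have "c * t \<le> c * \<bar>x\<bar>" using True c by (simp add: mult_left_mono)
    then have "1 \<le> exp (- (c * t)) * exp (c * \<bar>x\<bar>)" by (simp add: exp_add[symmetric])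
    also have "\<dots> \<le> exp (- (c * t)) * exp (c * x) + exp (- (c * t)) * exp (- c * x)"
      by (cases "0 \<le> x") auto
    finally show ?thesis using True by simp
  qed (simp add: add_nonneg_nonneg)
  then have "sign_tail t as 0 \<le>
      sign_mean (\<lambda>x. exp (- (c * t)) * exp (c * x) + exp (- (c * t)) * exp (- c * x)) as 0"
    unfolding sign_tail_def by (rule sign_mean_mono)
  also have "\<dots> \<le> exp (- (c * t)) * exp (c\<^sup>2 * v / 2) + exp (- (c * t)) * exp (c\<^sup>2 * v / 2)"
  proof -
    have "sign_mean (\<lambda>x. exp (d * x)) as 0 \<le> exp (c\<^sup>2 * v / 2)" if "d\<^sup>2 = c\<^sup>2" for d
    proof -
      have "exp (d * 0 + d\<^sup>2 * (\<Sum>a\<leftarrow>as. a\<^sup>2) / 2) \<le> exp (c\<^sup>2 * v / 2)"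
        using that v by (simp add: mult_left_mono)
      then show ?thesis using sign_mean_exp[of d as 0] by linarith
    qed
    from this[of c] this[of "- c"] show ?thesis
      unfolding sign_mean_linear by (intro add_mono mult_left_mono) auto
  qed
  also have "\<dots> = 2 * exp (- (t\<^sup>2 / (2 * v)))"
    using v by (simp add: c_def exp_add[symmetric] field_simps power2_eq_square)
  finally show ?thesis .
qed

section \<open>Rademacher polynomials on the unit interval\<close>

lemma borel_measurable_I01: "f \<in> borel_measurable borel \<Longrightarrow> f \<in> borel_measurable I01"
  by (intro measurable_restrict_space1 measurable_completion) simp

lemma space_I01 [simp]: "space I01 = {0..1}"
  by simp

lemma finite_measure_I01 [simp]: "finite_measure I01"
  by (rule finite_measure_lebesgue_on) simp

lemma measure_I01_space [simp]: "measure I01 {0..1} = 1"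
  by (simp add: measure_restrict_space)

text \<open>The induction step of the integral formulas for Rademacher polynomials: split by the
  first binary digit. The hypotheses concern the open interval, since Rademacher functions vanish at
  dyadic points and the identities with signs can fail at the ends.\<close>

lemma has_bochner_integral_halves:
  fixes f :: "real \<Rightarrow> real"
  assumes F: "has_bochner_integral I01 F A" "\<And>s. s \<in> {0<..<1} \<Longrightarrow> f (s / 2) = F s"
    and G: "has_bochner_integral I01 G B" "\<And>s. s \<in> {0<..<1} \<Longrightarrow> f ((s + 1) / 2) = G s"
  shows "has_bochner_integral I01 f ((A + B) / 2)"
proof -
  have F': "has_bochner_integral lebesgue (\<lambda>s. indicator {0..1} s *\<^sub>R F s) A"
    and G': "has_bochner_integral lebesgue (\<lambda>s. indicator {0..1} s *\<^sub>R G s) B"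
    using F(1) G(1) by (simp_all add: has_bochner_integral_restrict_space)
  have ind: "indicator {0..1} (0 + 2 * u) = (indicator {0..1/2} u :: real)"
      "indicator {0..1} (- 1 + 2 * u) = (indicator {1/2..1} u :: real)" for u :: real
    by (auto simp: indicator_def)
  have "has_bochner_integral lebesgue (\<lambda>u. indicator {0..1/2} u *\<^sub>R F (2 * u)) (A / 2)"
    using iffD1[OF has_bochner_integral_lebesgue_real_affine_iff F', of 2 0] by (simp only: ind) simp
  moreover have "has_bochner_integral lebesgue (\<lambda>u. indicator {1/2..1} u *\<^sub>R G (2 * u - 1)) (B / 2)"
    using iffD1[OF has_bochner_integral_lebesgue_real_affine_iff G', of 2 "-1"] by (simp only: ind) simp
  ultimately have "has_bochner_integral lebesgue
      (\<lambda>u. indicator {0..1/2} u *\<^sub>R F (2 * u) + indicator {1/2..1} u *\<^sub>R G (2 * u - 1)) (A / 2 + B / 2)"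
    by (rule has_bochner_integral_add)
  also have "?this \<longleftrightarrow> has_bochner_integral lebesgue (\<lambda>s. indicator {0..1} s *\<^sub>R f s) (A / 2 + B / 2)"
  proof (rule has_bochner_integral_discrete_difference[of "{0, 1/2, 1}"])
    fix x :: real assume "x \<notin> {0, 1/2, 1}"
    then consider "x < 0" | "0 < x" "x < 1/2" | "1/2 < x" "x < 1" | "1 < x" by force
    then show "indicator {0..1/2} x *\<^sub>R F (2 * x) + indicator {1/2..1} x *\<^sub>R G (2 * x - 1) =
        indicator {0..1} x *\<^sub>R f x"
      using F(2)[of "2 * x"] G(2)[of "2 * x - 1"] by cases (auto simp: indicator_def)
  qed auto
  finally show ?thesis by (simp add: has_bochner_integral_restrict_space add_divide_distrib)
qed

lemma rademacher_add: "rademacher (m + k) t = rademacher k (2 ^ m * t)"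
  by (simp add: rademacher_def power_add mult_ac)

lemma rademacher_periodic: "rademacher (Suc k) (t + real j) = rademacher (Suc k) t"
proof -
  define N where "N = 2 ^ k * j"
  have "2 ^ Suc k * pi * (t + real j) = 2 ^ Suc k * pi * t + 2 * real N * pi"
    by (simp add: algebra_simps N_def)
  moreover have "sin (x + 2 * real N * pi) = sin x" for x
    by (simp add: sin_add sin_2npi cos_2npi)
  ultimately show ?thesis by (simp add: rademacher_def)
qed

lemma rademacher_1_left: "s \<in> {0<..<1} \<Longrightarrow> rademacher (Suc 0) (s / 2) = 1"
  by (simp add: rademacher_def sin_gt_zero)

lemma rademacher_1_right: "s \<in> {0<..<1} \<Longrightarrow> rademacher (Suc 0) ((s + 1) / 2) = - 1"
  by (simp add: rademacher_def algebra_simps add_divide_distrib sin_gt_zero)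

lemma rademacher_abs_le_1: "\<bar>rademacher k t\<bar> \<le> 1"
  by (simp add: rademacher_def abs_sgn_eq)

lemma rademacher_measurable [measurable]: "rademacher k \<in> borel_measurable borel"
  unfolding rademacher_def by measurable

definition rad_poly :: "(nat \<Rightarrow> real) \<Rightarrow> nat \<Rightarrow> real \<Rightarrow> real" where
  "rad_poly a n t = (\<Sum>k<n. a k * rademacher (Suc k) t)"

lemma rad_poly_measurable [measurable]: "rad_poly a n \<in> borel_measurable borel"
  unfolding rad_poly_def by measurable

lemma rad_poly_periodic: "rad_poly a n (t + real j) = rad_poly a n t"
  by (simp add: rad_poly_def rademacher_periodic)

lemma rad_poly_shift: "rad_poly a n (2 ^ m * t) = (\<Sum>k<n. a k * rademacher (Suc (m + k)) t)"
  by (simp add: rad_poly_def rademacher_add[symmetric])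

lemma rad_poly_Suc_left: "rad_poly a (Suc n) t = a 0 * rademacher (Suc 0) t + rad_poly (\<lambda>k. a (Suc k)) n (2 * t)"
  using rad_poly_shift[of "\<lambda>k. a (Suc k)" n 1 t] unfolding rad_poly_def
  by (subst sum.lessThan_Suc_shift) simp

lemma rad_poly_halves:
  assumes "s \<in> {0<..<1}"
  shows "rad_poly a (Suc n) (s / 2) = a 0 + rad_poly (\<lambda>k. a (Suc k)) n s"
    and "rad_poly a (Suc n) ((s + 1) / 2) = - a 0 + rad_poly (\<lambda>k. a (Suc k)) n s"
proof -
  have "2 * ((s + 1) / 2) = s + real 1" by simp
  then show "rad_poly a (Suc n) ((s + 1) / 2) = - a 0 + rad_poly (\<lambda>k. a (Suc k)) n s"
    using assms unfolding rad_poly_Suc_left by (simp only: rad_poly_periodic rademacher_1_right)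
qed (use assms in \<open>simp_all add: rad_poly_Suc_left rademacher_1_left\<close>)

text \<open>A 1-periodic function of \<open>2 ^ n * t\<close> is independent of the first
  \<open>n\<close> Rademacher functions: halving the interval removes one sign and one factor 2.
  Taking \<open>g = 1\<close> gives the law of a polynomial, taking \<open>\<phi> = 1\<close> the
  invariance under dilation.\<close>

lemma integral_rad_poly_times_periodic:
  fixes g :: "real \<Rightarrow> real"
  assumes per: "\<And>t j. g (t + real j) = g t" and g: "has_bochner_integral I01 g G"
  shows "has_bochner_integral I01 (\<lambda>t. \<phi> (s + rad_poly a n t) * g (2 ^ n * t))
           (sign_mean \<phi> (map a [0..<n]) s * G)"
proof (induction n arbitrary: a s)
  case 0
  have "has_bochner_integral I01 (\<lambda>t. \<phi> s * g t) (\<phi> s * G)"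
    using g by (rule has_bochner_integral_mult_right)
  then show ?case by (simp add: rad_poly_def)
next
  case (Suc n)
  let ?b = "\<lambda>k. a (Suc k)"
  have "has_bochner_integral I01 (\<lambda>t. \<phi> (s + rad_poly a (Suc n) t) * g (2 ^ Suc n * t))
     ((sign_mean \<phi> (map ?b [0..<n]) (s + a 0) * G + sign_mean \<phi> (map ?b [0..<n]) (s - a 0) * G) / 2)"
  proof (rule has_bochner_integral_halves[OF Suc.IH _ Suc.IH])
    fix u :: real assume u: "u \<in> {0<..<1}"
    show "\<phi> (s + rad_poly a (Suc n) (u / 2)) * g (2 ^ Suc n * (u / 2)) =
        \<phi> (s + a 0 + rad_poly ?b n u) * g (2 ^ n * u)"
      by (simp add: rad_poly_halves[OF u] add_ac)
    have "g (2 ^ Suc n * ((u + 1) / 2)) = g (2 ^ n * u)"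
      using per[of "2 ^ n * u" "2 ^ n"] by (simp add: distrib_left add_divide_distrib mult.assoc)
    then show "\<phi> (s + rad_poly a (Suc n) ((u + 1) / 2)) * g (2 ^ Suc n * ((u + 1) / 2)) =
        \<phi> (s - a 0 + rad_poly ?b n u) * g (2 ^ n * u)"
      by (simp only: rad_poly_halves[OF u]) (simp add: algebra_simps)
  qed
  then show ?case by (simp only: map_upt_Suc sign_mean.simps) (simp add: algebra_simps add_divide_distrib)
qed

lemma has_bochner_integral_I01_const: "has_bochner_integral I01 (\<lambda>_. c :: real) c"
proof -
  interpret finite_measure I01 by simp
  show ?thesis by (simp add: has_bochner_integral_iff)
qed

lemma integral_rad_poly:
  "has_bochner_integral I01 (\<lambda>t. \<phi> (rad_poly a n t)) (sign_mean \<phi> (map a [0..<n]) 0)"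
  using integral_rad_poly_times_periodic[of "\<lambda>_. 1" 1 \<phi> 0 a n] has_bochner_integral_I01_const[of 1]
  by simp

lemma sign_mean_const: "sign_mean (\<lambda>_. c) as s = c"
  by (induction as arbitrary: s) auto

lemma integral_periodic_dilate:
  fixes g :: "real \<Rightarrow> real"
  assumes "\<And>t j. g (t + real j) = g t" "has_bochner_integral I01 g G"
  shows "has_bochner_integral I01 (\<lambda>t. g (2 ^ n * t)) G"
  using integral_rad_poly_times_periodic[OF assms, of "\<lambda>_. 1" 0 "\<lambda>_. 0" n]
  by (simp add: sign_mean_const)

lemma integral_rad_poly_max:
  "has_bochner_integral I01 (\<lambda>t. if \<exists>j\<le>n. \<bar>s + rad_poly a j t\<bar> > \<tau> then 1 else 0)
     (sign_max_tail \<tau> (map a [0..<n]) s)"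
proof (induction n arbitrary: a s)
  case 0
  show ?case using has_bochner_integral_I01_const by (simp add: rad_poly_def)
next
  case (Suc n)
  let ?b = "\<lambda>k. a (Suc k)"
  have split: "(\<exists>j\<le>Suc n. P j) \<longleftrightarrow> P 0 \<or> (\<exists>j\<le>n. P (Suc j))" for P :: "nat \<Rightarrow> bool"
    by (metis Suc_le_mono le0 not0_implies_Suc)
  show ?case
  proof (cases "\<bar>s\<bar> > \<tau>")
    case True
    then have "\<exists>j\<le>Suc n. \<bar>s + rad_poly a j t\<bar> > \<tau>" for t
      by (intro exI[of _ 0]) (simp add: rad_poly_def)
    then show ?thesis
      using True has_bochner_integral_I01_const[of 1] by (simp only: map_upt_Suc) simp
  next
    case False
    have *: "(\<exists>j\<le>Suc n. \<bar>s + rad_poly a j t\<bar> > \<tau>) \<longleftrightarrow> (\<exists>j\<le>n. \<bar>s + rad_poly a (Suc j) t\<bar> > \<tau>)" for t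
      unfolding split using False by (simp add: rad_poly_def)
    have "has_bochner_integral I01 (\<lambda>t. if \<exists>j\<le>Suc n. \<bar>s + rad_poly a j t\<bar> > \<tau> then 1 else 0)
      ((sign_max_tail \<tau> (map ?b [0..<n]) (s + a 0) + sign_max_tail \<tau> (map ?b [0..<n]) (s - a 0)) / 2)"
      unfolding * by (rule has_bochner_integral_halves[OF Suc.IH _ Suc.IH])
        (simp_all only: rad_poly_halves, simp_all add: algebra_simps)
    then show ?thesis using False by (simp only: map_upt_Suc) simp
  qed
qed

lemma measure_eq_has_bochner_integral:
  assumes "has_bochner_integral I01 (\<lambda>t. if P t then 1 else 0 :: real) p"
  shows "{t \<in> {0..1}. P t} \<in> sets I01" and "measure I01 {t \<in> {0..1}. P t} = p"
proof -
  have [measurable]: "(\<lambda>t. if P t then 1 else 0 :: real) \<in> borel_measurable I01"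
    using assms by (simp add: borel_measurable_has_bochner_integral)
  have "{t \<in> space I01. (if P t then 1 else 0 :: real) = 1} \<in> sets I01" by measurable
  also have "{t \<in> space I01. (if P t then 1 else 0 :: real) = 1} = {t \<in> {0..1}. P t}" by auto
  finally show S: "{t \<in> {0..1}. P t} \<in> sets I01" .
  have "{t \<in> {0..1}. P t} \<inter> {0..1} = {t \<in> {0..1}. P t}" by auto
  then have *: "LINT t|I01. indicator {t \<in> {0..1}. P t} t = measure I01 {t \<in> {0..1}. P t}"
    using S by simp
  have "LINT t|I01. (if P t then 1 else 0 :: real) = LINT t|I01. indicator {t \<in> {0..1}. P t} t"
    by (rule Bochner_Integration.integral_cong) (auto simp: indicator_def)
  also have "\<dots> = measure I01 {t \<in> {0..1}. P t}"
    by (rule *)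
  finally show "measure I01 {t \<in> {0..1}. P t} = p"
    using assms by (simp add: has_bochner_integral_iff)
qed

lemma distr_fun_rad_poly: "distr_fun (rad_poly a n) \<tau> = sign_tail \<tau> (map a [0..<n]) 0"
  unfolding distr_fun_def sign_tail_def by (rule measure_eq_has_bochner_integral(2)[OF integral_rad_poly])

lemma distr_fun_rad_poly_dilate:
  "distr_fun (\<lambda>t. rad_poly a n (2 ^ m * t)) \<tau> = sign_tail \<tau> (map a [0..<n]) 0"
  unfolding distr_fun_def sign_tail_def
  by (rule measure_eq_has_bochner_integral(2), 
      rule integral_periodic_dilate[where g = "\<lambda>t. if \<bar>rad_poly a n t\<bar> > \<tau> then 1 else 0"])
    (simp_all only: rad_poly_periodic integral_rad_poly[of "\<lambda>x. if \<bar>x\<bar> > \<tau> then 1 else 0"])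

lemma sum_list_squares_map: "(\<Sum>x\<leftarrow>map a [0..<n]. x\<^sup>2) = (\<Sum>k<n. (a k)\<^sup>2 :: real)"
  by (simp add: comp_def sum_list_sum_nth atLeast0LessThan)

text \<open>Levy's inequality followed by Chebyshev's. The dilation makes it applicable to blocks of
  the series that start at an arbitrary index.\<close>

lemma measure_rad_poly_max_le:
  assumes "0 < \<tau>"
  shows "{t \<in> {0..1}. \<exists>j\<le>n. \<bar>rad_poly a j (2 ^ m * t)\<bar> > \<tau>} \<in> sets I01" (is "?S \<in> _")
    and "measure I01 {t \<in> {0..1}. \<exists>j\<le>n. \<bar>rad_poly a j (2 ^ m * t)\<bar> > \<tau>} \<le> 2 * (\<Sum>k<n. (a k)\<^sup>2) / \<tau>\<^sup>2"
proof -
  have *: "has_bochner_integral I01 (\<lambda>t. if \<exists>j\<le>n. \<bar>rad_poly a j (2 ^ m * t)\<bar> > \<tau> then 1 else 0)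
     (sign_max_tail \<tau> (map a [0..<n]) 0)"
    by (rule integral_periodic_dilate[where g = "\<lambda>t. if \<exists>j\<le>n. \<bar>rad_poly a j t\<bar> > \<tau> then 1 else 0"])
      (use integral_rad_poly_max[where n = n and s = 0 and a = a and \<tau> = \<tau>] in \<open>simp_all only: rad_poly_periodic add_0\<close>)
  show "?S \<in> sets I01" by (rule measure_eq_has_bochner_integral(1)[OF *])
  have "measure I01 ?S = sign_max_tail \<tau> (map a [0..<n]) 0"
    by (rule measure_eq_has_bochner_integral(2)[OF *])
  also have "\<dots> \<le> 2 * sign_tail \<tau> (map a [0..<n]) 0" by (rule Levy_sign_inequality)
  also have "\<dots> \<le> 2 * ((\<Sum>k<n. (a k)\<^sup>2) / \<tau>\<^sup>2)"
    using sign_tail_Chebyshev[OF assms, of "map a [0..<n]"] by (simp only: sum_list_squares_map)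
  finally show "measure I01 ?S \<le> 2 * (\<Sum>k<n. (a k)\<^sup>2) / \<tau>\<^sup>2" by simp
qed

lemma integral_blocks_independent:
  assumes "n \<le> d"
  shows "has_bochner_integral I01 (\<lambda>t. \<phi> (rad_poly a n (2 ^ m * t)) * \<phi> (rad_poly a n (2 ^ (m + d) * t)))
    ((sign_mean \<phi> (map a [0..<n]) 0)\<^sup>2)"
proof -
  let ?p = "sign_mean \<phi> (map a [0..<n]) 0"
  \<comment> \<open>Rewriting \<open>2 ^ d * t\<close> as \<open>2 ^ (d - n) * (2 ^ n * t)\<close>
    makes the far block a periodic function of \<open>2 ^ n * t\<close>.\<close>
  define g where "g = (\<lambda>t. \<phi> (rad_poly a n (2 ^ (d - n) * t)))"
  have per: "rad_poly a n (2 ^ k * (t + real j)) = rad_poly a n (2 ^ k * t)" for k t j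
    using rad_poly_periodic[of a n "2 ^ k * t" "2 ^ k * j"] by (simp add: distrib_left)
  have "has_bochner_integral I01 g ?p"
    unfolding g_def by (rule integral_periodic_dilate[where g = "\<lambda>t. \<phi> (rad_poly a n t)"])
      (simp_all add: rad_poly_periodic integral_rad_poly)
  from integral_rad_poly_times_periodic[OF _ this, of \<phi> 0 a n]
  have "has_bochner_integral I01 (\<lambda>t. \<phi> (rad_poly a n t) * g (2 ^ n * t)) (?p * ?p)"
    by (simp add: g_def per)
  moreover have "g (2 ^ n * t) = \<phi> (rad_poly a n (2 ^ d * t))" for t
    using assms by (simp add: g_def mult.assoc[symmetric] power_add[symmetric])
  ultimately have "has_bochner_integral I01 (\<lambda>t. \<phi> (rad_poly a n t) * \<phi> (rad_poly a n (2 ^ d * t))) (?p * ?p)"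
    by simp
  then have "has_bochner_integral I01
      (\<lambda>t. \<phi> (rad_poly a n (2 ^ m * t)) * \<phi> (rad_poly a n (2 ^ d * (2 ^ m * t)))) (?p * ?p)"
    by (rule integral_periodic_dilate[rotated]) (simp only: per rad_poly_periodic)
  then show ?thesis by (simp add: power_add power2_eq_square mult_ac)
qed

section \<open>Rademacher series with square summable coefficients\<close>

interpretation I01: finite_measure I01 by simp

text \<open>A bound in probability controls the variance \<open>V\<close> because the fourth moment
  is at most \<open>3 V^2\<close>. On \<open>|x| > M\<close> one has
  \<open>x^2 \<le> x^4 / (6 V) + 3 V / 2\<close>; the means contribute at most \<open>V / 2\<close>
  and \<open>V / 4\<close>, so \<open>V \<le> M^2 + 3 V / 4\<close>.\<close>

lemma sign_mean_second_moment_le: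
  assumes "sign_tail M as 0 \<le> 1 / 6"
  shows "(\<Sum>a\<leftarrow>as. a\<^sup>2) \<le> 4 * M\<^sup>2"
proof (cases "(\<Sum>a\<leftarrow>as. a\<^sup>2) = 0")
  case False
  define V where "V = (\<Sum>a\<leftarrow>as. a\<^sup>2)"
  have "0 \<le> V" unfolding V_def by (rule sum_list_nonneg) auto
  then have V: "0 < V" using False by (simp add: V_def)
  let ?i = "\<lambda>x::real. if \<bar>x\<bar> > M then 1 else 0 :: real"
  have "x\<^sup>2 \<le> 1 * M\<^sup>2 + 1 * (1 / (6 * V) * x ^ 4 + 3 * V / 2 * ?i x)" for x
  proof (cases "\<bar>x\<bar> > M")
    case True
    have "0 \<le> (x\<^sup>2 - 3 * V)\<^sup>2 / (6 * V)" using V by simp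
    also have "\<dots> = 1 / (6 * V) * x ^ 4 + 3 * V / 2 - x\<^sup>2"
      using V by (simp add: field_simps power2_eq_square power4_eq_xxxx)
    finally have "x\<^sup>2 \<le> 1 / (6 * V) * x ^ 4 + 3 * V / 2" by simp
    moreover have "0 \<le> M\<^sup>2" by simp
    ultimately show ?thesis
      by (simp only: True if_True mult_1_left mult_1_right)
  next
    case False
    then have "x\<^sup>2 \<le> M\<^sup>2" by (simp add: abs_le_square_iff[symmetric])
    then show ?thesis using False V by (simp add: add_increasing2)
  qed
  then have "sign_mean (\<lambda>x. x\<^sup>2) as 0 \<le>
      sign_mean (\<lambda>x. 1 * M\<^sup>2 + 1 * (1 / (6 * V) * x ^ 4 + 3 * V / 2 * ?i x)) as 0"
    by (rule sign_mean_mono)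
  also have "\<dots> = M\<^sup>2 + 1 / (6 * V) * sign_mean (\<lambda>x. x ^ 4) as 0 + 3 * V / 2 * sign_tail M as 0"
    unfolding sign_mean_linear sign_mean_const sign_tail_def by simp
  also have "\<dots> \<le> M\<^sup>2 + 1 / (6 * V) * (3 * V\<^sup>2) + 3 * V / 2 * (1 / 6)"
    using sign_mean_fourth[of as] assms V unfolding V_def[symmetric]
    by (intro add_mono mult_left_mono) auto
  also have "\<dots> = M\<^sup>2 + 3 / 4 * V" using V by (simp add: field_simps power2_eq_square)
  finally show ?thesis by (simp add: sign_mean_square V_def[symmetric])
qed simp

text \<open>Split at \<open>|x| = 3 r\<close>, with \<open>r\<close> the standard deviation:
  \<open>x^2\<close> is at most \<open>3 r |x|\<close> below and \<open>x^4 / (9 r^2)\<close> above.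
  The second mean is at most \<open>r^2 / 3\<close>, which leaves
  \<open>2 r^2 / 3 \<le> 3 r E|S|\<close>, hence 2/9.\<close>

lemma Khinchine_sign: "2 / 9 * sqrt (\<Sum>a\<leftarrow>as. a\<^sup>2) \<le> sign_mean abs as 0"
proof (cases "(\<Sum>a\<leftarrow>as. a\<^sup>2) = 0")
  case True
  have "sign_mean (\<lambda>_. 0) as 0 \<le> sign_mean abs as 0" by (rule sign_mean_mono) simp
  then show ?thesis using True by (simp add: sign_mean_const)
next
  case False
  define V where "V = (\<Sum>a\<leftarrow>as. a\<^sup>2)"
  define r where "r = sqrt V"
  have "0 \<le> V" unfolding V_def by (rule sum_list_nonneg) auto
  then have r: "0 < r" "V = r\<^sup>2" using False by (simp_all add: V_def r_def)
  have "x\<^sup>2 \<le> 3 * r * \<bar>x\<bar> + 1 / (9 * r\<^sup>2) * x ^ 4" for x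
  proof (cases "\<bar>x\<bar> \<le> 3 * r")
    case True
    then have "\<bar>x\<bar> * \<bar>x\<bar> \<le> 3 * r * \<bar>x\<bar>" by (rule mult_right_mono) simp
    moreover have "0 \<le> 1 / (9 * r\<^sup>2) * x ^ 4" by simp
    ultimately show ?thesis unfolding power2_eq_square[of x] abs_mult_self_eq by linarith
  next
    case False
    then have "(3 * r)\<^sup>2 \<le> x\<^sup>2" using r by (subst abs_le_square_iff[symmetric]) simp
    then have "9 * r\<^sup>2 * x\<^sup>2 \<le> x\<^sup>2 * x\<^sup>2" by (intro mult_right_mono) (auto simp: power_mult_distrib)
    then have "x\<^sup>2 \<le> 1 / (9 * r\<^sup>2) * x ^ 4"
      using r by (simp add: field_simps power4_eq_xxxx power2_eq_square)
    moreover have "0 \<le> 3 * r * \<bar>x\<bar>" using r by simp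
    ultimately show ?thesis by linarith
  qed
  then have "sign_mean (\<lambda>x. x\<^sup>2) as 0 \<le> sign_mean (\<lambda>x. 3 * r * \<bar>x\<bar> + 1 / (9 * r\<^sup>2) * x ^ 4) as 0"
    by (rule sign_mean_mono)
  also have "\<dots> = 3 * r * sign_mean abs as 0 + 1 / (9 * r\<^sup>2) * sign_mean (\<lambda>x. x ^ 4) as 0"
    by (simp only: sign_mean_linear)
  also have "\<dots> \<le> 3 * r * sign_mean abs as 0 + 1 / (9 * r\<^sup>2) * (3 * (r\<^sup>2)\<^sup>2)"
  proof -
    have "sign_mean (\<lambda>x. x ^ 4) as 0 \<le> 3 * (r\<^sup>2)\<^sup>2"
      using sign_mean_fourth[of as] unfolding V_def[symmetric] r(2) .
    then show ?thesis by (intro add_left_mono mult_left_mono) simp_all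
  qed
  also have "\<dots> = 3 * r * sign_mean abs as 0 + r\<^sup>2 / 3"
    using r by (simp add: field_simps power2_eq_square)
  finally have "r\<^sup>2 \<le> 3 * r * sign_mean abs as 0 + r\<^sup>2 / 3"
    unfolding sign_mean_square V_def[symmetric] r(2) by simp
  then have "r * (2 / 9 * r) \<le> r * sign_mean abs as 0" by (simp add: power2_eq_square)
  then show ?thesis using r(1) by (simp add: V_def[symmetric] r_def[symmetric])
qed

lemma Khinchine_rad_poly:
  "integrable I01 (rad_poly a n)" "2 / 9 * sqrt (\<Sum>k<n. (a k)\<^sup>2) \<le> (LINT t|I01. \<bar>rad_poly a n t\<bar>)"
  using integral_rad_poly[of abs a n] integral_rad_poly[of "\<lambda>x. x" a n] Khinchine_sign[of "map a [0..<n]"]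
  unfolding sum_list_squares_map by (simp_all add: has_bochner_integral_iff)

lemma rad_poly_add: "rad_poly a (m + n) t = rad_poly a m t + rad_poly (\<lambda>k. a (m + k)) n (2 ^ m * t)"
  unfolding rad_poly_shift unfolding rad_poly_def
  by (induction n) auto

lemma rad_poly_abs_le: "\<bar>rad_poly a n t\<bar> \<le> (\<Sum>k<n. \<bar>a k\<bar>)"
proof -
  have "\<bar>rad_poly a n t\<bar> \<le> (\<Sum>k<n. \<bar>a k * rademacher (Suc k) t\<bar>)"
    unfolding rad_poly_def by (rule sum_abs)
  also have "\<dots> \<le> (\<Sum>k<n. \<bar>a k\<bar>)"
    by (intro sum_mono) (simp add: abs_mult mult_left_le rademacher_abs_le_1)
  finally show ?thesis .
qed

section \<open>Almost everywhere convergence, square summability and Gaussian tails\<close>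

lemma rademacher_convergent_tendsto:
  assumes "rademacher_convergent a"
  shows "AE t in I01. (\<lambda>n. rad_poly a n t) \<longlonglongrightarrow> rademacher_sum a t"
  using assms unfolding rademacher_convergent_def
  by eventually_elim (simp add: rad_poly_def[abs_def] rademacher_sum_def summable_LIMSEQ)

lemma rademacher_sum_measurable [measurable]: "rademacher_sum a \<in> borel_measurable borel"
  unfolding rademacher_sum_def by measurable

lemma ell2_tail_small:
  assumes "a \<in> ell2" "0 < e"
  obtains m where "\<And>n. (\<Sum>k<n. (a (m + k))\<^sup>2) \<le> e"
proof -
  have s: "summable (\<lambda>k. (a k)\<^sup>2)" using assms by (simp add: ell2_def)
  obtain m where m: "norm (\<Sum>i. (a (i + m))\<^sup>2) < e"
    using suminf_exist_split[OF assms(2) s] by blast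
  have "(\<Sum>k<n. (a (m + k))\<^sup>2) \<le> (\<Sum>i. (a (i + m))\<^sup>2)" for n
    using sum_le_suminf[of "\<lambda>i. (a (i + m))\<^sup>2" "{..<n}"] s
    by (simp add: add.commute summable_iff_shift[of "\<lambda>i. (a i)\<^sup>2"])
  moreover have "(\<Sum>i. (a (i + m))\<^sup>2) < e" using m by simp
  ultimately show ?thesis by (intro that[of m]) (meson order_trans less_imp_le)
qed

text \<open>\<open>U e m\<close> is where the partial sums after \<open>m\<close> move away by more
  than \<open>e\<close>. The maximal inequality bounds its measure by \<open>2 / e^2\<close> times
  the l2 tail, so almost every point lies outside \<open>U e m\<close> for some \<open>m\<close>,
  and the partial sums are Cauchy.\<close>

lemma ell2_rademacher_convergent:
  assumes "a \<in> ell2"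
  shows "rademacher_convergent a"
proof -
  let ?b = "\<lambda>m k. a (m + k)"
  define U where "U = (\<lambda>e m. \<Union>n. {t \<in> {0..1}. \<exists>j\<le>n. \<bar>rad_poly (?b m) j (2 ^ m * t)\<bar> > e})"
  have U: "U e m \<in> sets I01" if "0 < e" for e m
    unfolding U_def using measure_rad_poly_max_le(1)[OF that] by (intro sets.countable_UN) auto
  have null: "(\<Inter>m. U e m) \<in> null_sets I01" if e: "0 < e" for e
  proof -
    have "measure I01 (\<Inter>m. U e m) \<le> d" if d: "0 < d" for d
    proof -
      obtain m where m: "\<And>n. (\<Sum>k<n. (?b m k)\<^sup>2) \<le> d * e\<^sup>2 / 2"
        using ell2_tail_small[OF assms, of "d * e\<^sup>2 / 2"] d e by auto
      have "measure I01 (\<Inter>m. U e m) \<le> measure I01 (U e m)"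
        by (rule I01.finite_measure_mono) (use U[OF e] in auto)
      also have "(\<lambda>n. measure I01 {t \<in> {0..1}. \<exists>j\<le>n. \<bar>rad_poly (?b m) j (2 ^ m * t)\<bar> > e}) \<longlonglongrightarrow> measure I01 (U e m)"
        unfolding U_def
        by (rule I01.finite_Lim_measure_incseq)
          (use measure_rad_poly_max_le(1)[OF e] in \<open>auto simp: incseq_def intro: order_trans\<close>)
      then have "measure I01 (U e m) \<le> d"
      proof (rule LIMSEQ_le_const2, intro exI allI impI)
        fix n
        have "2 * (\<Sum>k<n. (?b m k)\<^sup>2) / e\<^sup>2 \<le> d" using m[of n] e by (simp add: field_simps)
        then show "measure I01 {t \<in> {0..1}. \<exists>j\<le>n. \<bar>rad_poly (?b m) j (2 ^ m * t)\<bar> > e} \<le> d"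
          using measure_rad_poly_max_le(2)[OF e, of n "?b m" m] by linarith
      qed
      finally show ?thesis .
    qed
    then have "measure I01 (\<Inter>m. U e m) \<le> 0" by (rule field_le_epsilon[of _ 0, simplified])
    then have "measure I01 (\<Inter>m. U e m) = 0" using measure_nonneg by (rule antisym)
    then show ?thesis
      using U[OF e] by (auto simp: null_sets_def I01.emeasure_eq_measure)
  qed
  have "AE t in I01. \<forall>p. t \<notin> (\<Inter>m. U (1 / real (Suc p)) m)"
    unfolding AE_all_countable by (intro allI AE_not_in null) simp
  then show ?thesis unfolding rademacher_convergent_def using AE_space
  proof eventually_elim
    case (elim t)
    have True: "t \<in> {0..1}" using elim by simp
    show ?case
    proof -
      have "Cauchy (\<lambda>n. rad_poly a n t)"
      proof (rule metric_CauchyI)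
        fix e :: real assume "0 < e"
        then obtain p where p: "1 / real (Suc p) < e / 2" using nat_approx_posE[of "e / 2"] by auto
        obtain m where m: "t \<notin> U (1 / real (Suc p)) m" using elim by auto
        have close: "\<bar>rad_poly a n t - rad_poly a m t\<bar> \<le> 1 / real (Suc p)" if "m \<le> n" for n
        proof -
          have "\<bar>rad_poly (?b m) (n - m) (2 ^ m * t)\<bar> \<le> 1 / real (Suc p)"
            using m True unfolding U_def by (auto simp: not_less)
          then show ?thesis using rad_poly_add[of a m "n - m" t] that by simp
        qed
        have "dist (rad_poly a n t) (rad_poly a n' t) < e" if "m \<le> n" "m \<le> n'" for n n'
          using close[OF that(1)] close[OF that(2)] p unfolding dist_real_def by linarith
        then show "\<exists>M. \<forall>m\<ge>M. \<forall>n\<ge>M. dist (rad_poly a m t) (rad_poly a n t) < e" by blast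
      qed
      then show ?thesis
        by (simp add: summable_iff_convergent rad_poly_def[abs_def] Cauchy_convergent)
    qed
  qed
qed

text \<open>Off a set of measure at most 1/6 all partial sums are bounded by one constant, which
  \<open>sign_mean_second_moment_le\<close> turns into a bound for the sums of squares. Multipliers
  are tested on a.e. convergent sums, while the Gaussian tails require square summable
  coefficients.\<close>

lemma rademacher_convergent_ell2:
  assumes "rademacher_convergent a"
  shows "a \<in> ell2"
proof -
  define V where "V = (\<lambda>M::nat. {t \<in> space I01. \<exists>n. \<bar>rad_poly a n t\<bar> > real M})"
  have [measurable]: "rad_poly a n \<in> borel_measurable I01" for n
    by (rule borel_measurable_I01) measurable
  have V: "V M \<in> sets I01" for M unfolding V_def by measurable
  have "(\<lambda>M. measure I01 (V M)) \<longlonglongrightarrow> measure I01 (\<Inter>M. V M)"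
  proof (rule I01.finite_Lim_measure_decseq)
    show "decseq V" unfolding decseq_def V_def
    proof safe
      fix M N :: nat and t n assume "M \<le> N" "real N < \<bar>rad_poly a n t\<bar>"
      then show "\<exists>n. real M < \<bar>rad_poly a n t\<bar>" by (intro exI[of _ n]) linarith
    qed
  qed (use V in auto)
  moreover have "measure I01 (\<Inter>M. V M) = 0"
  proof -
    have "AE t in I01. t \<notin> (\<Inter>M. V M)"
      using rademacher_convergent_tendsto[OF assms]
    proof eventually_elim
      case (elim t)
      then have "Bseq (\<lambda>n. rad_poly a n t)" by (intro convergent_imp_Bseq convergentI)
      then obtain K where K: "\<And>n. \<bar>rad_poly a n t\<bar> \<le> K" by (auto simp: Bseq_def)
      obtain M where "K \<le> real M" using real_arch_simple by blast
      have "\<not> real M < \<bar>rad_poly a n t\<bar>" for n using K[of n] \<open>K \<le> real M\<close> by simp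
      then have "t \<notin> V M" unfolding V_def by simp
      then show ?case by blast
    qed
    then have "(\<Inter>M. V M) \<in> null_sets I01" using V by (subst AE_iff_null_sets) auto
    then show ?thesis by (rule measure_eq_0_null_sets)
  qed
  ultimately have "\<forall>\<^sub>F M in sequentially. measure I01 (V M) < 1 / 6"
    by (intro order_tendstoD(2)[where y = 0]) auto
  then obtain M where M: "measure I01 (V M) \<le> 1 / 6"
    by (metis eventually_sequentially order_refl less_imp_le)
  have "(\<Sum>k<n. (a k)\<^sup>2) \<le> 4 * (real M)\<^sup>2" for n
  proof -
    have "sign_tail M (map a [0..<n]) 0 \<le> measure I01 (V M)"
      unfolding distr_fun_rad_poly[symmetric] distr_fun_def
      by (rule I01.finite_measure_mono) (use V in \<open>auto simp: V_def\<close>)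
    then have "sign_tail M (map a [0..<n]) 0 \<le> 1 / 6" using M by linarith
    from sign_mean_second_moment_le[OF this] show ?thesis unfolding sum_list_squares_map .
  qed
  then have "(\<Sum>k\<le>n. (a k)\<^sup>2) \<le> 4 * (real M)\<^sup>2" for n
    unfolding lessThan_Suc_atMost[symmetric] .
  then have "summable (\<lambda>k. (a k)\<^sup>2)" by (intro bounded_imp_summable[where B = "4 * (real M)\<^sup>2"]) auto
  then show ?thesis by (simp add: ell2_def)
qed

lemma distr_fun_measurable:
  fixes f :: "real \<Rightarrow> real"
  shows "f \<in> borel_measurable I01 \<Longrightarrow> {t \<in> {0..1}. \<bar>f t\<bar> > \<tau>} \<in> sets I01"
proof -
  assume [measurable]: "f \<in> borel_measurable I01"
  have "(\<lambda>t. \<bar>f t\<bar>) \<in> borel_measurable I01" by measurable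
  then have "{t \<in> space I01. \<bar>f t\<bar> > \<tau>} \<in> sets I01" by (simp only: borel_measurable_iff_greater)
  then show ?thesis by simp
qed

text \<open>The inequality \<open>|g| > \<tau>\<close> is strict, hence inherited by
  \<open>f n\<close> for all large \<open>n\<close>; the sets where it holds from index
  \<open>N\<close> on increase with \<open>N\<close>.\<close>

lemma distr_fun_limit_le:
  assumes [measurable]: "\<And>n. f n \<in> borel_measurable I01" "g \<in> borel_measurable I01"
    and lim: "AE t in I01. (\<lambda>n. f n t) \<longlonglongrightarrow> g t"
    and le: "\<And>n. n \<ge> m \<Longrightarrow> distr_fun (f n) \<tau> \<le> c"
  shows "distr_fun g \<tau> \<le> c"
proof -
  define B where "B = (\<lambda>N. {t \<in> space I01. \<forall>n\<ge>N. \<bar>f n t\<bar> > \<tau>})"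
  have B: "B N \<in> sets I01" for N unfolding B_def by measurable
  have "(\<lambda>N. measure I01 (B N)) \<longlonglongrightarrow> measure I01 (\<Union>N. B N)"
    by (rule I01.finite_Lim_measure_incseq) (use B in \<open>auto simp: incseq_def B_def\<close>)
  moreover have "measure I01 (B N) \<le> c" for N
  proof -
    have "measure I01 (B N) \<le> distr_fun (f (max m N)) \<tau>" unfolding distr_fun_def
      by (rule I01.finite_measure_mono[OF _ distr_fun_measurable]) (auto simp: B_def)
    then show ?thesis using le[of "max m N"] by simp
  qed
  ultimately have "measure I01 (\<Union>N. B N) \<le> c" by (intro LIMSEQ_le_const2) auto
  moreover have "distr_fun g \<tau> \<le> measure I01 (\<Union>N. B N)" unfolding distr_fun_def
  proof (rule I01.finite_measure_mono_AE)
    show "AE t in I01. t \<in> {t \<in> {0..1}. \<bar>g t\<bar> > \<tau>} \<longrightarrow> t \<in> (\<Union>N. B N)"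
      using lim
    proof (eventually_elim, intro impI)
      fix t assume "(\<lambda>n. f n t) \<longlonglongrightarrow> g t" and t: "t \<in> {t \<in> {0..1}. \<bar>g t\<bar> > \<tau>}"
      then have "(\<lambda>n. \<bar>f n t\<bar>) \<longlonglongrightarrow> \<bar>g t\<bar>" by (intro tendsto_rabs)
      from order_tendstoD(1)[OF this, of \<tau>] t show "t \<in> (\<Union>N. B N)"
        by (auto simp: B_def eventually_sequentially)
    qed
  qed (use B in auto)
  ultimately show ?thesis by linarith
qed

lemma distr_fun_le_1: "distr_fun f \<tau> \<le> 1"
  unfolding distr_fun_def using I01.bounded_measure by simp

lemma distr_fun_nonneg: "0 \<le> distr_fun f \<tau>"
  by (simp add: distr_fun_def)

lemma rademacher_sum_gaussian_tail:
  assumes a: "a \<in> ell2" and l: "0 < l"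
  obtains C where "0 < C" "\<And>\<tau>. 0 \<le> \<tau> \<Longrightarrow> distr_fun (rademacher_sum a) \<tau> \<le> C * exp (- (l * \<tau>\<^sup>2))"
proof -
  \<comment> \<open>The tail block has Gaussian rate \<open>1 / (2 v) = 2 l\<close>. Half of it is
    lost to the shift by \<open>M\<close>, through
    \<open>(\<tau> - M)^2 \<ge> \<tau>^2 / 2 - M^2\<close>.\<close>
  define v where "v = 1 / (4 * l)"
  have v: "0 < v" using l by (simp add: v_def)
  obtain m where m: "\<And>n. (\<Sum>k<n. (a (m + k))\<^sup>2) \<le> v" using ell2_tail_small[OF a v] by blast
  define M where "M = (\<Sum>k<m. \<bar>a k\<bar>)"
  define C where "C = 2 * exp (M\<^sup>2 / (2 * v))"
  have poly: "distr_fun (rad_poly a n) \<tau> \<le> C * exp (- (l * \<tau>\<^sup>2))" if \<tau>: "0 \<le> \<tau>" and n: "m \<le> n" for \<tau> n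
  proof (cases "\<tau> < M")
    case True
    have "l * \<tau>\<^sup>2 \<le> l * M\<^sup>2" using True \<tau> l by (simp add: power_mono)
    also have "\<dots> \<le> M\<^sup>2 / (2 * v)" using l by (simp add: v_def field_simps)
    finally have "1 \<le> exp (M\<^sup>2 / (2 * v)) * exp (- (l * \<tau>\<^sup>2))" by (simp add: exp_add[symmetric])
    then show ?thesis using distr_fun_le_1[of "rad_poly a n" \<tau>] unfolding C_def by linarith
  next
    case False
    let ?b = "\<lambda>k. a (m + k)"
    have "distr_fun (rad_poly a n) \<tau> \<le> distr_fun (\<lambda>t. rad_poly ?b (n - m) (2 ^ m * t)) (\<tau> - M)"
      unfolding distr_fun_def
    proof (rule I01.finite_measure_mono)
      show "{t \<in> {0..1}. \<tau> < \<bar>rad_poly a n t\<bar>} \<subseteq> {t \<in> {0..1}. \<tau> - M < \<bar>rad_poly ?b (n - m) (2 ^ m * t)\<bar>}"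
      proof safe
        fix t assume "\<tau> < \<bar>rad_poly a n t\<bar>"
        then show "\<tau> - M < \<bar>rad_poly ?b (n - m) (2 ^ m * t)\<bar>"
          using rad_poly_add[of a m "n - m" t] rad_poly_abs_le[of a m t] n unfolding M_def by simp
      qed
      show "{t \<in> {0..1}. \<tau> - M < \<bar>rad_poly ?b (n - m) (2 ^ m * t)\<bar>} \<in> sets I01"
        by (intro distr_fun_measurable borel_measurable_I01) measurable
    qed
    also have "\<dots> \<le> 2 * exp (- ((\<tau> - M)\<^sup>2 / (2 * v)))"
      unfolding distr_fun_rad_poly_dilate
    proof (rule sign_tail_subgaussian[OF _ v])
      show "0 \<le> \<tau> - M" using False by simp
      show "(\<Sum>a\<leftarrow>map ?b [0..<n - m]. a\<^sup>2) \<le> v" unfolding sum_list_squares_map by (rule m)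
    qed
    also have "\<dots> \<le> 2 * exp (M\<^sup>2 / (2 * v) - l * \<tau>\<^sup>2)"
    proof -
      have "0 \<le> (\<tau> - 2 * M)\<^sup>2" by simp
      then have "\<tau>\<^sup>2 / 2 - M\<^sup>2 \<le> (\<tau> - M)\<^sup>2" by (simp add: power2_eq_square algebra_simps)
      then have "(\<tau>\<^sup>2 / 2 - M\<^sup>2) / (2 * v) \<le> (\<tau> - M)\<^sup>2 / (2 * v)" using v by (intro divide_right_mono) auto
      moreover have "(\<tau>\<^sup>2 / 2 - M\<^sup>2) / (2 * v) = l * \<tau>\<^sup>2 - M\<^sup>2 / (2 * v)" using l by (simp add: v_def field_simps)
      ultimately show ?thesis by simp
    qed
    also have "\<dots> = C * exp (- (l * \<tau>\<^sup>2))" by (simp add: C_def exp_diff exp_minus field_simps)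
    finally show ?thesis .
  qed
  show ?thesis
  proof
    show "0 < C" by (simp add: C_def)
    fix \<tau> :: real assume \<tau>: "0 \<le> \<tau>"
    show "distr_fun (rademacher_sum a) \<tau> \<le> C * exp (- (l * \<tau>\<^sup>2))"
    proof (rule distr_fun_limit_le)
      show "rad_poly a n \<in> borel_measurable I01" for n by (rule borel_measurable_I01) measurable
      show "rademacher_sum a \<in> borel_measurable I01" by (rule borel_measurable_I01) measurable
      show "AE t in I01. (\<lambda>n. rad_poly a n t) \<longlonglongrightarrow> rademacher_sum a t"
        by (rule rademacher_convergent_tendsto[OF ell2_rademacher_convergent[OF a]])
      show "distr_fun (rad_poly a n) \<tau> \<le> C * exp (- (l * \<tau>\<^sup>2))" if "m \<le> n" for n
        by (rule poly[OF \<tau> that])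
    qed
  qed
qed

section \<open>Rearrangements\<close>

lemma distr_fun_mono_AE:
  fixes x y :: "real \<Rightarrow> real"
  assumes "x \<in> borel_measurable I01" "AE t in I01. \<bar>y t\<bar> \<le> \<bar>x t\<bar>"
  shows "distr_fun y \<tau> \<le> distr_fun x \<tau>"
  unfolding distr_fun_def
proof (rule I01.finite_measure_mono_AE[OF _ distr_fun_measurable[OF assms(1)]])
  show "AE t in I01. t \<in> {t \<in> {0..1}. \<tau> < \<bar>y t\<bar>} \<longrightarrow> t \<in> {t \<in> {0..1}. \<tau> < \<bar>x t\<bar>}"
    using assms(2) by eventually_elim auto
qed

lemma distr_fun_tendsto_0:
  fixes x :: "real \<Rightarrow> real"
  assumes "x \<in> borel_measurable I01"
  shows "(\<lambda>n. distr_fun x (real n)) \<longlonglongrightarrow> 0"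
proof -
  let ?A = "\<lambda>n::nat. {t \<in> {0..1}. \<bar>x t\<bar> > real n}"
  have "(\<lambda>n. measure I01 (?A n)) \<longlonglongrightarrow> measure I01 (\<Inter>n. ?A n)"
    by (rule I01.finite_Lim_measure_decseq) (use distr_fun_measurable[OF assms] in \<open>auto simp: decseq_def\<close>)
  also have "(\<Inter>n. ?A n) = {}"
  proof -
    have "\<exists>n. t \<notin> ?A n" for t
      using real_arch_simple[of "\<bar>x t\<bar>"] by (auto simp: not_less)
    then show ?thesis by blast
  qed
  finally show ?thesis by (simp add: distr_fun_def)
qed

lemma distr_fun_small:
  fixes x :: "real \<Rightarrow> real"
  assumes "x \<in> borel_measurable I01" "0 < s"
  obtains n :: nat where "distr_fun x (real n) < s"
  using order_tendstoD(2)[OF distr_fun_tendsto_0[OF assms(1)] assms(2)]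
  by (auto simp: eventually_sequentially)

text \<open>The axioms of a symmetric space compare rearrangements, while the estimates are made on
  distribution functions. Positivity of \<open>s\<close> keeps the set under the infimum
  nonempty.\<close>

lemma decr_rearr_mono:
  fixes x y :: "real \<Rightarrow> real"
  assumes "x \<in> borel_measurable I01" "\<And>\<tau>. 0 \<le> \<tau> \<Longrightarrow> distr_fun y \<tau> \<le> distr_fun x \<tau>" "0 < s"
  shows "decr_rearr y s \<le> decr_rearr x s"
  unfolding decr_rearr_def
proof (rule cInf_superset_mono)
  obtain n :: nat where "distr_fun x (real n) < s" using distr_fun_small[OF assms(1,3)] .
  then have "real n \<in> {\<tau>. 0 \<le> \<tau> \<and> distr_fun x \<tau> \<le> s}" by simp
  then show "{\<tau>. 0 \<le> \<tau> \<and> distr_fun x \<tau> \<le> s} \<noteq> {}" by blast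
  show "bdd_below {\<tau>. 0 \<le> \<tau> \<and> distr_fun y \<tau> \<le> s}" by (rule bdd_belowI[of _ 0]) auto
  show "{\<tau>. 0 \<le> \<tau> \<and> distr_fun x \<tau> \<le> s} \<subseteq> {\<tau>. 0 \<le> \<tau> \<and> distr_fun y \<tau> \<le> s}"
  proof safe
    fix \<tau> :: real assume "0 \<le> \<tau>" "distr_fun x \<tau> \<le> s"
    then show "distr_fun y \<tau> \<le> s" using assms(2)[of \<tau>] by linarith
  qed
qed

section \<open>Transport of a distribution from one set to another\<close>

lemma measure_I01_interval: "0 \<le> s \<Longrightarrow> s \<le> t \<Longrightarrow> t \<le> 1 \<Longrightarrow> measure I01 {s<..t} = t - s"
  by (subst measure_restrict_space) auto

definition initial_measure :: "real set \<Rightarrow> real \<Rightarrow> real" where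
  "initial_measure A t = measure I01 (A \<inter> {0..t})"

lemma initial_measure_diff:
  assumes A: "A \<in> sets I01" and "0 \<le> s" "s \<le> t" "t \<le> 1"
  shows "initial_measure A s \<le> initial_measure A t" "initial_measure A t \<le> initial_measure A s + (t - s)"
proof -
  have sets: "{0..u} \<in> sets I01" "{u<..v} \<in> sets I01" if "0 \<le> u" "u \<le> 1" "v \<le> 1" for u v :: real
    using that by (auto simp: sets_restrict_space_iff)
  show "initial_measure A s \<le> initial_measure A t" unfolding initial_measure_def
    by (rule I01.finite_measure_mono) (use assms sets in auto)
  have "measure I01 (A \<inter> {0..t}) \<le> measure I01 (A \<inter> {0..s} \<union> {s<..t})"
    by (rule I01.finite_measure_mono) (use assms sets in auto)
  also have "\<dots> \<le> measure I01 (A \<inter> {0..s}) + measure I01 {s<..t}"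
    by (rule measure_Un_le) (use assms sets in auto)
  finally show "initial_measure A t \<le> initial_measure A s + (t - s)"
    using assms by (simp add: initial_measure_def measure_I01_interval)
qed

lemma initial_measure_continuous:
  assumes A: "A \<in> sets I01"
  shows "continuous_on {0..1} (initial_measure A)"
proof (rule continuous_on_iff[THEN iffD2], intro ballI allI impI)
  fix x e :: real assume x: "x \<in> {0..1}" and e: "0 < e"
  have "dist (initial_measure A y) (initial_measure A x) < e" if "y \<in> {0..1}" "dist y x < e" for y
    using initial_measure_diff[OF A, of x y] initial_measure_diff[OF A, of y x] x that
    unfolding dist_real_def by (cases "x \<le> y") auto
  then show "\<exists>d>0. \<forall>x'\<in>{0..1}. dist x' x < d \<longrightarrow> dist (initial_measure A x') (initial_measure A x) < e"
    using e by blast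
qed

lemma initial_measure_measurable [measurable]:
  "A \<in> sets I01 \<Longrightarrow> initial_measure A \<in> borel_measurable I01"
  by (rule continuous_imp_measurable_on_sets_lebesgue[OF initial_measure_continuous]) auto

lemma measure_initial_segment:
  assumes A: "A \<in> sets I01" and c: "0 \<le> c" "c \<le> measure I01 A"
  shows "measure I01 {t \<in> A. initial_measure A t < c} = c"
proof -
  have AI: "A \<subseteq> {0..1}" using sets.sets_into_space[OF A] by simp
  let ?F = "initial_measure A"
  have "?F 0 \<le> measure I01 {0}" unfolding initial_measure_def
    by (rule I01.finite_measure_mono) (auto simp: sets_restrict_space_iff)
  also have "\<dots> = 0" by (subst measure_restrict_space) auto
  finally have F0: "?F 0 \<le> c" using c by simp
  have F1: "c \<le> ?F 1" using c AI by (simp add: initial_measure_def Int_absorb2)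
  \<comment> \<open>\<open>initial_measure A\<close> may be constant on an interval; the least point
    \<open>t1\<close> of its level set at height \<open>c\<close> makes the part of \<open>A\<close>
    with smaller value exactly the part of \<open>A\<close> below \<open>t1\<close>.\<close>
  define S where "S = {t \<in> {0..1}. ?F t = c}"
  obtain t0 where "0 \<le> t0" "t0 \<le> 1" "?F t0 = c"
    using IVT'[OF F0 F1 zero_le_one initial_measure_continuous[OF A]] by blast
  then have "S \<noteq> {}" by (auto simp: S_def)
  moreover have "compact S"
  proof -
    have "closed S" unfolding S_def
      by (rule continuous_closed_preimage_constant[OF initial_measure_continuous[OF A]]) simp
    moreover have "bounded S" by (rule bounded_subset[OF bounded_closed_interval[of 0 1]]) (auto simp: S_def)
    ultimately show ?thesis by (simp add: compact_eq_bounded_closed)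
  qed
  ultimately have "\<exists>t1\<in>S. \<forall>t\<in>S. t1 \<le> t" by (intro compact_attains_inf)
  then obtain t1 where t1: "t1 \<in> S" "\<And>t. t \<in> S \<Longrightarrow> t1 \<le> t" by blast
  have eq: "{t \<in> A. ?F t < c} = A \<inter> {0..t1} - {t1}"
  proof (intro set_eqI iffI)
    fix t assume "t \<in> {t \<in> A. ?F t < c}"
    then show "t \<in> A \<inter> {0..t1} - {t1}"
      using initial_measure_diff(1)[OF A, of t1 t] t1(1) AI unfolding S_def by (cases "t \<le> t1") auto
  next
    fix t assume t: "t \<in> A \<inter> {0..t1} - {t1}"
    then have "?F t \<le> c" using initial_measure_diff(1)[OF A, of t t1] t1(1) by (auto simp: S_def)
    moreover have "?F t \<noteq> c" using t1(2)[of t] t t1(1) by (auto simp: S_def)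
    ultimately show "t \<in> {t \<in> A. ?F t < c}" using t by simp
  qed
  have "measure I01 (A \<inter> {0..t1} - {t1}) = measure I01 (A \<inter> {0..t1})"
  proof (rule measure_Diff_null_set)
    show "{t1} \<in> null_sets I01"
      using t1(1) by (auto simp: S_def null_sets_def sets_restrict_space_iff emeasure_restrict_space)
    show "A \<inter> {0..t1} \<in> sets I01" using t1(1) A by (auto simp: S_def sets_restrict_space_iff)
  qed
  also have "\<dots> = c" using t1(1) by (simp add: S_def initial_measure_def)
  finally show ?thesis unfolding eq .
qed

text \<open>The increasing map \<open>t \<mapsto> m(A \<inter> [0,t])\<close> pushes Lebesgue measure on \<open>A\<close> to Lebesgue measure on
  \<open>[0, m(A)]\<close>; composing it with the decreasing rearrangement of \<open>R\<close> on \<open>B\<close> transports \<open>R\<close> to \<open>A\<close>.\<close>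

lemma transport_distribution:
  fixes R :: "real \<Rightarrow> real"
  assumes A: "A \<in> sets I01" and B: "B \<in> sets I01" and le: "measure I01 B \<le> measure I01 A"
    and R[measurable]: "R \<in> borel_measurable I01"
  obtains g where "g \<in> borel_measurable I01" "\<And>t. 0 \<le> g t"
    "\<And>\<tau>. 0 \<le> \<tau> \<Longrightarrow> measure I01 {t \<in> A. g t > \<tau>} = measure I01 {t \<in> B. \<bar>R t\<bar> > \<tau>}"
proof -
  let ?F = "initial_measure A"
  define n where "n \<tau> = measure I01 {t \<in> B. \<bar>R t\<bar> > \<tau>}" for \<tau>
  have BI: "B \<subseteq> {0..1}" and AI: "A \<subseteq> {0..1}" using sets.sets_into_space[OF B] sets.sets_into_space[OF A] by auto
  have S: "{t \<in> B. \<bar>R t\<bar> > \<tau>} \<in> sets I01" for \<tau>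
  proof -
    have "{t \<in> B. \<bar>R t\<bar> > \<tau>} = B \<inter> {t \<in> {0..1}. \<bar>R t\<bar> > \<tau>}" using BI by auto
    then show ?thesis using B distr_fun_measurable[OF R] by simp
  qed
  have n_anti: "n \<tau>' \<le> n \<tau>" if "\<tau> \<le> \<tau>'" for \<tau> \<tau>' unfolding n_def
    by (rule I01.finite_measure_mono) (use S that in auto)
  have n_le: "n \<tau> \<le> measure I01 A" for \<tau>
  proof -
    have "n \<tau> \<le> measure I01 B" unfolding n_def by (rule I01.finite_measure_mono) (use B in auto)
    then show ?thesis using le by simp
  qed
  \<comment> \<open>Right continuity of \<open>n\<close> makes the infimum in the definition of
    \<open>g\<close> attained, which yields the exact equivalence \<open>g_iff\<close>.\<close>
  have n_right: "(\<lambda>k. n (\<tau> + 1 / real (Suc k))) \<longlonglongrightarrow> n \<tau>" for \<tau>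
  proof -
    let ?S = "\<lambda>k. {t \<in> B. \<bar>R t\<bar> > \<tau> + 1 / real (Suc k)}"
    have "incseq ?S"
    proof (rule incseq_SucI, safe)
      fix k t assume "\<bar>R t\<bar> > \<tau> + 1 / real (Suc k)"
      moreover have "1 / real (Suc (Suc k)) \<le> 1 / real (Suc k)" by (simp add: frac_le)
      ultimately show "\<bar>R t\<bar> > \<tau> + 1 / real (Suc (Suc k))" by linarith
    qed
    then have "(\<lambda>k. measure I01 (?S k)) \<longlonglongrightarrow> measure I01 (\<Union>k. ?S k)"
      by (intro I01.finite_Lim_measure_incseq) (use S in auto)
    also have "(\<Union>k. ?S k) = {t \<in> B. \<bar>R t\<bar> > \<tau>}"
    proof (intro set_eqI iffI)
      fix t assume "t \<in> (\<Union>k. ?S k)"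
      then obtain k where k: "t \<in> B" "\<bar>R t\<bar> > \<tau> + 1 / real (Suc k)" by auto
      have "0 < 1 / real (Suc k)" by simp
      then have "\<tau> < \<bar>R t\<bar>" using k(2) by linarith
      then show "t \<in> {t \<in> B. \<bar>R t\<bar> > \<tau>}" using k(1) by simp
    next
      fix t assume t: "t \<in> {t \<in> B. \<bar>R t\<bar> > \<tau>}"
      then obtain k where "1 / real (Suc k) < \<bar>R t\<bar> - \<tau>" using nat_approx_posE[of "\<bar>R t\<bar> - \<tau>"] by auto
      then show "t \<in> (\<Union>k. ?S k)" using t by (auto intro!: exI[of _ k])
    qed
    finally show ?thesis unfolding n_def .
  qed
  have n_small: "\<exists>\<tau>\<ge>0. n \<tau> \<le> s" if "0 < s" for s
  proof -
    obtain k :: nat where k: "distr_fun R (real k) < s" using distr_fun_small[OF R \<open>0 < s\<close>] .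
    have "n (real k) \<le> distr_fun R (real k)" unfolding n_def distr_fun_def
      by (rule I01.finite_measure_mono[OF _ distr_fun_measurable[OF R]]) (use BI in auto)
    then show ?thesis using k by (intro exI[of _ "real k"]) auto
  qed
  \<comment> \<open>Where \<open>?F t = 0\<close> the set under the infimum is empty if
    \<open>R\<close> is essentially unbounded on \<open>B\<close>. That part of \<open>A\<close> is
    null and gets the value 0.\<close>
  define g where "g t = (if ?F t = 0 then 0 else Inf {\<tau>. 0 \<le> \<tau> \<and> n \<tau> \<le> ?F t})" for t
  have F_nonneg: "0 \<le> ?F t" for t by (simp add: initial_measure_def)
  have g_iff: "g t > \<tau> \<longleftrightarrow> ?F t < n \<tau> \<and> ?F t \<noteq> 0" if \<tau>: "0 \<le> \<tau>" for t \<tau>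
  proof (cases "?F t = 0")
    case False
    then have F: "0 < ?F t" using F_nonneg[of t] by simp
    let ?T = "{\<tau>. 0 \<le> \<tau> \<and> n \<tau> \<le> ?F t}"
    have T: "?T \<noteq> {}" "bdd_below ?T" using n_small[OF F] by (auto intro: bdd_belowI[of _ 0])
    have "n \<tau> \<le> ?F t" if "Inf ?T \<le> \<tau>"
    proof -
      have "n (\<tau> + 1 / real (Suc k)) \<le> ?F t" for k
      proof -
        have "Inf ?T < \<tau> + 1 / real (Suc k)" using that by (simp add: add_strict_increasing2 less_add_same_cancel1 order_le_less_trans)
        then obtain \<tau>' where "\<tau>' \<in> ?T" "\<tau>' < \<tau> + 1 / real (Suc k)" using cInf_lessD[OF T(1)] by blast
        then show ?thesis using n_anti[of \<tau>' "\<tau> + 1 / real (Suc k)"] by auto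
      qed
      then show ?thesis by (intro LIMSEQ_le_const2[OF n_right]) auto
    qed
    moreover have "Inf ?T \<le> \<tau>" if "n \<tau> \<le> ?F t" using that \<tau> by (intro cInf_lower T(2)) auto
    ultimately show ?thesis using False by (auto simp: g_def not_le[symmetric])
  qed (use \<tau> in \<open>simp add: g_def\<close>)
  have g_nonneg: "0 \<le> g t" for t
  proof (cases "?F t = 0")
    case False
    then have F: "0 < ?F t" using F_nonneg[of t] by simp
    then have "0 \<le> Inf {\<tau>. 0 \<le> \<tau> \<and> n \<tau> \<le> ?F t}" using n_small[OF F] by (intro cInf_greatest) auto
    then show ?thesis by (simp add: g_def)
  qed (simp add: g_def)
  have [measurable]: "?F \<in> borel_measurable I01" by (rule initial_measure_measurable[OF A])
  have g_meas: "g \<in> borel_measurable I01"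
    unfolding borel_measurable_iff_greater
  proof
    fix \<tau> :: real
    show "{t \<in> space I01. \<tau> < g t} \<in> sets I01"
    proof (cases "0 \<le> \<tau>")
      case True
      show ?thesis unfolding g_iff[OF True] by measurable
    next
      case False
      then have "{t \<in> space I01. \<tau> < g t} = space I01" using g_nonneg by (auto intro: less_le_trans[of _ 0])
      then show ?thesis by (simp only: sets.top)
    qed
  qed
  have null: "{t \<in> A. ?F t = 0} \<in> null_sets I01"
  proof -
    have sets: "{t \<in> A. P (?F t)} \<in> sets I01" if "{t \<in> space I01. P (?F t)} \<in> sets I01" for P
    proof -
      have "{t \<in> A. P (?F t)} = A \<inter> {t \<in> space I01. P (?F t)}" using AI by auto
      then show ?thesis using that A by simp
    qed
    have m: "{t \<in> A. ?F t = 0} \<in> sets I01" by (rule sets) measurable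
    have "measure I01 {t \<in> A. ?F t = 0} \<le> e" if e: "0 < e" for e
    proof (cases "e \<le> measure I01 A")
      case True
      have "measure I01 {t \<in> A. ?F t = 0} \<le> measure I01 {t \<in> A. ?F t < e}"
      proof (rule I01.finite_measure_mono)
        show "{t \<in> A. ?F t < e} \<in> sets I01" by (rule sets) measurable
      qed (use e in auto)
      then show ?thesis using measure_initial_segment[OF A _ True] e by simp
    next
      case False
      have "measure I01 {t \<in> A. ?F t = 0} \<le> measure I01 A"
        by (rule I01.finite_measure_mono) (use A in auto)
      then show ?thesis using False by simp
    qed
    then have "measure I01 {t \<in> A. ?F t = 0} \<le> 0" by (rule field_le_epsilon[of _ 0, simplified])
    then show ?thesis using m by (auto simp: null_sets_def I01.emeasure_eq_measure intro: antisym)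
  qed
  show ?thesis
  proof (rule that[OF g_meas g_nonneg])
    fix \<tau> :: real assume \<tau>: "0 \<le> \<tau>"
    have "{t \<in> A. g t > \<tau>} = {t \<in> A. ?F t < n \<tau>} - {t \<in> A. ?F t = 0}" using g_iff[OF \<tau>] by auto
    moreover have "{t \<in> A. ?F t < n \<tau>} \<in> sets I01"
    proof -
      have "{t \<in> A. ?F t < n \<tau>} = A \<inter> {t \<in> space I01. ?F t < n \<tau>}" using AI by auto
      moreover have "{t \<in> space I01. ?F t < n \<tau>} \<in> sets I01" by measurable
      ultimately show ?thesis using A by simp
    qed
    ultimately have "measure I01 {t \<in> A. g t > \<tau>} = measure I01 {t \<in> A. ?F t < n \<tau>}"
      using null by (simp add: measure_Diff_null_set)
    also have "\<dots> = n \<tau>"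
      by (rule measure_initial_segment[OF A _ n_le]) (simp add: n_def)
    finally show "measure I01 {t \<in> A. g t > \<tau>} = measure I01 {t \<in> B. \<bar>R t\<bar> > \<tau>}" by (simp add: n_def)
  qed
qed

text \<open>The number of \<open>n\<close> with \<open>|f t| > n\<close> is the ceiling of
  \<open>|f t|\<close>, which lies between \<open>|f t|\<close> and \<open>|f t| + 1\<close>. Thus
  integrability can be read off the distribution function.\<close>

lemma nn_integral_le_suminf_distr:
  fixes f :: "real \<Rightarrow> real"
  assumes [measurable]: "f \<in> borel_measurable I01"
  shows "(\<integral>\<^sup>+ t. ennreal \<bar>f t\<bar> \<partial>I01) \<le> (\<Sum>n. ennreal (distr_fun f (real n)))"
    and "(\<Sum>n. ennreal (distr_fun f (real n))) \<le> (\<integral>\<^sup>+ t. ennreal \<bar>f t\<bar> \<partial>I01) + 1"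
proof -
  let ?S = "\<lambda>n::nat. {t \<in> {0..1}. \<bar>f t\<bar> > real n}"
  let ?h = "\<lambda>t. \<Sum>n. (indicator (?S n) t :: ennreal)"
  have S: "?S n \<in> sets I01" for n by (rule distr_fun_measurable) measurable
  have "(\<integral>\<^sup>+ t. ?h t \<partial>I01) = (\<Sum>n. \<integral>\<^sup>+ t. indicator (?S n) t \<partial>I01)"
    by (rule nn_integral_suminf) (use S in auto)
  also have "\<dots> = (\<Sum>n. ennreal (distr_fun f (real n)))"
    using S by (simp add: I01.emeasure_eq_measure distr_fun_def)
  finally have int: "(\<integral>\<^sup>+ t. ?h t \<partial>I01) = (\<Sum>n. ennreal (distr_fun f (real n)))" .
  have h: "?h t = ennreal (real (nat \<lceil>\<bar>f t\<bar>\<rceil>))" if "t \<in> {0..1}" for t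
  proof -
    let ?N = "nat \<lceil>\<bar>f t\<bar>\<rceil>"
    have "real n < \<bar>f t\<bar> \<longleftrightarrow> n < ?N" for n
      by (metis less_ceiling_iff of_int_of_nat_eq zless_nat_eq_int_zless)
    then have "indicator (?S n) t = (if n \<in> {..<?N} then 1 else 0 :: ennreal)" for n
      using that by (simp add: indicator_def)
    then have "?h t = (\<Sum>n. if n \<in> {..<?N} then 1 else 0)" by simp
    also have "\<dots> = (\<Sum>n<?N. 1)" by (rule sums_unique[OF sums_If_finite_set, symmetric]) simp
    finally show ?thesis by (simp add: ennreal_of_nat_eq_real_of_nat)
  qed
  have "(\<integral>\<^sup>+ t. ennreal \<bar>f t\<bar> \<partial>I01) \<le> (\<integral>\<^sup>+ t. ?h t \<partial>I01)"
  proof (rule nn_integral_mono)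
    fix t assume "t \<in> space I01"
    then have "?h t = ennreal (real (nat \<lceil>\<bar>f t\<bar>\<rceil>))" by (intro h) simp
    then show "ennreal \<bar>f t\<bar> \<le> ?h t" by (simp only:) (intro ennreal_leI real_nat_ceiling_ge)
  qed
  then show "(\<integral>\<^sup>+ t. ennreal \<bar>f t\<bar> \<partial>I01) \<le> (\<Sum>n. ennreal (distr_fun f (real n)))"
    by (simp only: int)
  have "(\<integral>\<^sup>+ t. ?h t \<partial>I01) \<le> (\<integral>\<^sup>+ t. ennreal \<bar>f t\<bar> + 1 \<partial>I01)"
  proof (rule nn_integral_mono)
    fix t assume "t \<in> space I01"
    then have "?h t = ennreal (real (nat \<lceil>\<bar>f t\<bar>\<rceil>))" by (intro h) simp
    also have "\<dots> \<le> ennreal (\<bar>f t\<bar> + 1)" by (intro ennreal_leI) linarith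
    finally show "?h t \<le> ennreal \<bar>f t\<bar> + 1" by simp
  qed
  also have "\<dots> = (\<integral>\<^sup>+ t. ennreal \<bar>f t\<bar> \<partial>I01) + 1"
    by (subst nn_integral_add) (auto simp: emeasure_restrict_space)
  finally show "(\<Sum>n. ennreal (distr_fun f (real n))) \<le> (\<integral>\<^sup>+ t. ennreal \<bar>f t\<bar> \<partial>I01) + 1"
    by (simp only: int)
qed

lemma integrable_distr_le:
  fixes f g :: "real \<Rightarrow> real"
  assumes f[measurable]: "f \<in> borel_measurable I01" and g: "integrable I01 g"
    and le: "\<And>\<tau>. 0 \<le> \<tau> \<Longrightarrow> distr_fun f \<tau> \<le> distr_fun g \<tau>"
  shows "integrable I01 f"
proof (rule integrableI_bounded)
  have "(\<integral>\<^sup>+ t. ennreal \<bar>f t\<bar> \<partial>I01) \<le> (\<Sum>n. ennreal (distr_fun f (real n)))"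
    by (rule nn_integral_le_suminf_distr(1)) measurable
  also have "\<dots> \<le> (\<Sum>n. ennreal (distr_fun g (real n)))"
    by (intro suminf_le ennreal_leI le) auto
  also have "\<dots> \<le> (\<integral>\<^sup>+ t. ennreal \<bar>g t\<bar> \<partial>I01) + 1"
    using g by (intro nn_integral_le_suminf_distr(2)) auto
  also have "\<dots> < \<infinity>" using g unfolding integrable_iff_bounded by (simp add: ennreal_add_less_top)
  finally show "(\<integral>\<^sup>+ t. ennreal (norm (f t)) \<partial>I01) < \<infinity>" by simp
qed measurable

section \<open>Symmetric spaces\<close>

lemma distr_fun_mult_const:
  assumes "0 < c"
  shows "distr_fun (\<lambda>t. c * f t) (c * \<tau>) = distr_fun f \<tau>"
  using assms by (simp add: distr_fun_def abs_mult)

locale symmetric_function_space =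
  fixes X :: fun_space
  assumes symmetric: "symmetric_space X"
begin

lemma banach_function_space_axioms:
  "carrier X \<subseteq> borel_measurable I01"
  "(\<lambda>t. 0) \<in> carrier X"
  "\<forall>x\<in>carrier X. \<forall>y\<in>carrier X. (\<lambda>t. x t + y t) \<in> carrier X"
  "\<forall>c. \<forall>x\<in>carrier X. (\<lambda>t. c * x t) \<in> carrier X"
  "\<forall>x\<in>carrier X. nrm X x \<ge> 0"
  "\<forall>x\<in>carrier X. nrm X x = 0 \<longleftrightarrow> (AE t in I01. x t = 0)"
  "\<forall>x\<in>carrier X. \<forall>y\<in>carrier X. nrm X (\<lambda>t. x t + y t) \<le> nrm X x + nrm X y"
  "\<forall>c. \<forall>x\<in>carrier X. nrm X (\<lambda>t. c * x t) = \<bar>c\<bar> * nrm X x"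
  "\<forall>u. (\<forall>n::nat. u n \<in> carrier X) \<and>
        (\<forall>e>0. \<exists>N. \<forall>m\<ge>N. \<forall>n\<ge>N. nrm X (\<lambda>t. u m t - u n t) < e) \<longrightarrow>
        (\<exists>x\<in>carrier X. (\<lambda>n. nrm X (\<lambda>t. u n t - x t)) \<longlonglongrightarrow> 0)"
  using symmetric unfolding symmetric_space_def banach_function_space_def by - (elim conjE, assumption)+

lemma carrier_nontrivial: "\<exists>x\<in>carrier X. \<not> (AE t in I01. x t = 0)"
  using symmetric unfolding symmetric_space_def by (elim conjE)

lemma carrier_rearrangement_invariant:
  "\<forall>x\<in>carrier X. \<forall>y\<in>borel_measurable I01.
      (\<forall>s\<in>{0<..<1}. decr_rearr y s \<le> decr_rearr x s) \<longrightarrow> y \<in> carrier X \<and> nrm X y \<le> nrm X x"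
  using symmetric unfolding symmetric_space_def by (elim conjE)

lemma carrier_measurable: "x \<in> carrier X \<Longrightarrow> x \<in> borel_measurable I01"
  using banach_function_space_axioms(1) by (rule subsetD)

lemma carrier_add: "x \<in> carrier X \<Longrightarrow> y \<in> carrier X \<Longrightarrow> (\<lambda>t. x t + y t) \<in> carrier X"
  by (rule banach_function_space_axioms(3)[rule_format])

lemma carrier_scale: "x \<in> carrier X \<Longrightarrow> (\<lambda>t. c * x t) \<in> carrier X"
  by (rule banach_function_space_axioms(4)[rule_format])

lemma carrier_zero: "(\<lambda>t. 0) \<in> carrier X"
  by (rule banach_function_space_axioms(2))

lemma norm_nonneg: "x \<in> carrier X \<Longrightarrow> 0 \<le> nrm X x"
  by (rule banach_function_space_axioms(5)[rule_format])

lemma norm_eq_0_iff: "x \<in> carrier X \<Longrightarrow> nrm X x = 0 \<longleftrightarrow> (AE t in I01. x t = 0)"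
  by (rule banach_function_space_axioms(6)[rule_format])

lemma norm_add: "x \<in> carrier X \<Longrightarrow> y \<in> carrier X \<Longrightarrow> nrm X (\<lambda>t. x t + y t) \<le> nrm X x + nrm X y"
  by (rule banach_function_space_axioms(7)[rule_format])

lemma norm_scale: "x \<in> carrier X \<Longrightarrow> nrm X (\<lambda>t. c * x t) = \<bar>c\<bar> * nrm X x"
  by (rule banach_function_space_axioms(8)[rule_format])

lemma norm_complete:
  assumes "\<And>n::nat. u n \<in> carrier X"
    and "\<And>e. 0 < e \<Longrightarrow> \<exists>N. \<forall>m\<ge>N. \<forall>n\<ge>N. nrm X (\<lambda>t. u m t - u n t) < e"
  obtains x where "x \<in> carrier X" "(\<lambda>n. nrm X (\<lambda>t. u n t - x t)) \<longlonglongrightarrow> 0"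
proof -
  have "\<exists>x\<in>carrier X. (\<lambda>n. nrm X (\<lambda>t. u n t - x t)) \<longlonglongrightarrow> 0"
    by (rule banach_function_space_axioms(9)[THEN spec, THEN mp]) (intro conjI allI impI assms)
  then show ?thesis using that by (elim bexE)
qed

lemma carrier_distr_fun_le:
  assumes x: "x \<in> carrier X" and y: "y \<in> borel_measurable I01"
    and le: "\<And>\<tau>. 0 \<le> \<tau> \<Longrightarrow> distr_fun y \<tau> \<le> distr_fun x \<tau>"
  shows "y \<in> carrier X" "nrm X y \<le> nrm X x"
proof -
  have "\<forall>s\<in>{0<..<1}. decr_rearr y s \<le> decr_rearr x s"
    using decr_rearr_mono[OF carrier_measurable[OF x] le] by simp
  with carrier_rearrangement_invariant x y have "y \<in> carrier X \<and> nrm X y \<le> nrm X x" by simp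
  then show "y \<in> carrier X" "nrm X y \<le> nrm X x" by simp_all
qed

lemma carrier_AE_le:
  assumes "x \<in> carrier X" "y \<in> borel_measurable I01" "AE t in I01. \<bar>y t\<bar> \<le> \<bar>x t\<bar>"
  shows "y \<in> carrier X" "nrm X y \<le> nrm X x"
  by (rule carrier_distr_fun_le[OF assms(1,2) distr_fun_mono_AE[OF carrier_measurable[OF assms(1)] assms(3)]])+

lemma carrier_AE_eq:
  assumes x: "x \<in> carrier X" and y: "y \<in> borel_measurable I01" and eq: "AE t in I01. y t = x t"
  shows "y \<in> carrier X" "nrm X y = nrm X x"
proof -
  have le: "AE t in I01. \<bar>y t\<bar> \<le> \<bar>x t\<bar>" "AE t in I01. \<bar>x t\<bar> \<le> \<bar>y t\<bar>"
    using eq by (eventually_elim, simp)+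
  show y: "y \<in> carrier X" by (rule carrier_AE_le(1)[OF x y le(1)])
  show "nrm X y = nrm X x"
    using carrier_AE_le(2)[OF x carrier_measurable[OF y] le(1)]
      carrier_AE_le(2)[OF y carrier_measurable[OF x] le(2)] by simp
qed

lemma carrier_abs:
  assumes "x \<in> carrier X"
  shows "(\<lambda>t. \<bar>x t\<bar>) \<in> carrier X" "nrm X (\<lambda>t. \<bar>x t\<bar>) = nrm X x"
proof -
  have m[measurable]: "x \<in> borel_measurable I01" by (rule carrier_measurable[OF assms])
  show *: "(\<lambda>t. \<bar>x t\<bar>) \<in> carrier X" by (rule carrier_AE_le(1)[OF assms]) simp_all
  have "nrm X (\<lambda>t. \<bar>x t\<bar>) \<le> nrm X x" by (rule carrier_AE_le(2)[OF assms]) simp_all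
  moreover have "nrm X x \<le> nrm X (\<lambda>t. \<bar>x t\<bar>)" by (rule carrier_AE_le(2)[OF *]) simp_all
  ultimately show "nrm X (\<lambda>t. \<bar>x t\<bar>) = nrm X x" by simp
qed

lemma carrier_diff: "x \<in> carrier X \<Longrightarrow> y \<in> carrier X \<Longrightarrow> (\<lambda>t. x t - y t) \<in> carrier X"
  using carrier_add[OF _ carrier_scale[of y "-1"], of x] by simp

lemma norm_diff: "x \<in> carrier X \<Longrightarrow> y \<in> carrier X \<Longrightarrow> nrm X (\<lambda>t. x t - y t) \<le> nrm X x + nrm X y"
  using norm_add[OF _ carrier_scale[of y "-1"], of x] norm_scale[of y "-1"] by simp

lemma norm_triangle:
  assumes "x \<in> carrier X" "y \<in> carrier X" "z \<in> carrier X"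
  shows "nrm X (\<lambda>t. x t - z t) \<le> nrm X (\<lambda>t. x t - y t) + nrm X (\<lambda>t. y t - z t)"
  using norm_add[OF carrier_diff[OF assms(1,2)] carrier_diff[OF assms(2,3)]] by simp

lemma norm_diff_commute:
  assumes "x \<in> carrier X" "y \<in> carrier X"
  shows "nrm X (\<lambda>t. x t - y t) = nrm X (\<lambda>t. y t - x t)"
  using norm_scale[OF carrier_diff[OF assms], of "-1"] by simp

lemma norm_le_add_diff:
  assumes "x \<in> carrier X" "y \<in> carrier X"
  shows "nrm X x \<le> nrm X y + nrm X (\<lambda>t. x t - y t)"
  using norm_add[OF assms(2) carrier_diff[OF assms]] by simp

lemma norm_tendsto:
  assumes u: "\<And>n::nat. u n \<in> carrier X" and x: "x \<in> carrier X"
    and lim: "(\<lambda>n. nrm X (\<lambda>t. u n t - x t)) \<longlonglongrightarrow> 0"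
  shows "(\<lambda>n. nrm X (u n)) \<longlonglongrightarrow> nrm X x"
proof (rule LIM_zero_cancel, rule Lim_null_comparison[OF _ lim], rule always_eventually, rule allI)
  fix n
  show "norm (nrm X (u n) - nrm X x) \<le> nrm X (\<lambda>t. u n t - x t)"
    using norm_le_add_diff[OF u x, of n] norm_le_add_diff[OF x u, of n] norm_diff_commute[OF u x, of n] by simp
qed

lemma geometric_complete:
  assumes u: "\<And>n::nat. u n \<in> carrier X"
    and step: "\<And>n. nrm X (\<lambda>t. u (Suc n) t - u n t) \<le> (1 / 2) ^ n"
  obtains x where "x \<in> carrier X" "(\<lambda>n. nrm X (\<lambda>t. u n t - x t)) \<longlonglongrightarrow> 0"
proof (rule norm_complete[OF u])
  have far: "nrm X (\<lambda>t. u (m + k) t - u m t) \<le> 2 * (1 / 2) ^ m - 2 * (1 / 2) ^ (m + k)" for m k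
  proof (induction k)
    case 0
    then show ?case using norm_eq_0_iff[OF carrier_zero] by simp
  next
    case (Suc k)
    then show ?case using norm_triangle[OF u u u, of "m + Suc k" m "m + k"] step[of "m + k"] by simp
  qed
  fix e :: real assume "0 < e"
  moreover have "(\<lambda>n. 4 * (1 / 2 :: real) ^ n) \<longlonglongrightarrow> 4 * 0"
    by (intro tendsto_mult tendsto_const LIMSEQ_power_zero) simp
  ultimately obtain N where N: "4 * (1 / 2 :: real) ^ N < e"
    by (metis (no_types, lifting) eventually_sequentially mult_zero_right order_refl order_tendstoD(2))
  have near: "nrm X (\<lambda>t. u m t - u N t) \<le> 2 * (1 / 2) ^ N" if "N \<le> m" for m
  proof -
    have "nrm X (\<lambda>t. u (N + (m - N)) t - u N t) \<le> 2 * (1 / 2) ^ N"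
      using far[of N "m - N"] by (rule order_trans) simp
    then show ?thesis using that by simp
  qed
  have "nrm X (\<lambda>t. u m t - u n t) < e" if "N \<le> m" "N \<le> n" for m n
    using norm_triangle[OF u u u, of m n N] near[OF that(1)] near[OF that(2)] norm_diff_commute[OF u u, of N n] N
    by simp
  then show "\<exists>N. \<forall>m\<ge>N. \<forall>n\<ge>N. nrm X (\<lambda>t. u m t - u n t) < e" by blast
qed (rule that)

text \<open>A positive functional that is finite on the whole lattice is bounded: otherwise sum a rapidly
  decreasing sequence of positive elements on which it is large.\<close>

lemma integral_functional_bounded:
  assumes y[measurable]: "y \<in> borel_measurable I01"
    and int: "\<And>x. x \<in> carrier X \<Longrightarrow> integrable I01 (\<lambda>t. x t * y t)"
  obtains C where "0 < C" "\<And>x. x \<in> carrier X \<Longrightarrow> (LINT t|I01. \<bar>x t * y t\<bar>) \<le> C * nrm X x"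
proof (rule ccontr)
  assume neg: "\<not> thesis"
  \<comment> \<open>Failure of the constant \<open>4 ^ n\<close> is split by scaling into norm
    \<open>(1 / 2) ^ n\<close> and an integral above \<open>2 ^ n\<close>.\<close>
  have "\<exists>z. z \<in> carrier X \<and> (\<forall>t. 0 \<le> z t) \<and> nrm X z \<le> (1 / 2) ^ n \<and> 2 ^ n < (LINT t|I01. \<bar>z t * y t\<bar>)" for n :: nat
  proof -
    have "\<not> (\<forall>x\<in>carrier X. (LINT t|I01. \<bar>x t * y t\<bar>) \<le> 4 ^ n * nrm X x)"
    proof
      assume "\<forall>x\<in>carrier X. (LINT t|I01. \<bar>x t * y t\<bar>) \<le> 4 ^ n * nrm X x"
      then have thesis by (intro that[of "4 ^ n"]) simp_all
      with neg show False ..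
    qed
    then obtain x where x: "x \<in> carrier X" "4 ^ n * nrm X x < (LINT t|I01. \<bar>x t * y t\<bar>)" by (auto simp: not_le)
    have "nrm X x \<noteq> 0"
    proof
      assume "nrm X x = 0"
      then have "AE t in I01. x t = 0" using norm_eq_0_iff[OF x(1)] by simp
      then have "AE t in I01. \<bar>x t * y t\<bar> = 0" by eventually_elim simp
      then have "(LINT t|I01. \<bar>x t * y t\<bar>) = 0" by (rule integral_eq_zero_AE)
      then show False using x(2) \<open>nrm X x = 0\<close> by simp
    qed
    then have pos: "0 < nrm X x" using norm_nonneg[OF x(1)] by simp
    define c where "c = (1 / 2) ^ n / nrm X x"
    have c: "0 < c" using pos by (simp add: c_def)
    let ?z = "\<lambda>t. c * \<bar>x t\<bar>"
    have "nrm X ?z = c * nrm X x"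
      using norm_scale[OF carrier_abs(1)[OF x(1)], of c] carrier_abs(2)[OF x(1)] c by simp
    then have "nrm X ?z \<le> (1 / 2) ^ n" using pos by (simp add: c_def)
    moreover have "2 ^ n < (LINT t|I01. \<bar>?z t * y t\<bar>)"
    proof -
      have "(2::real) ^ n = c * (4 ^ n * nrm X x)"
        using pos by (simp add: c_def power_divide power_mult_distrib[symmetric] field_simps)
      also have "\<dots> < c * (LINT t|I01. \<bar>x t * y t\<bar>)" using x(2) c by simp
      also have "\<dots> = (LINT t|I01. c * \<bar>x t * y t\<bar>)" by simp
      also have "\<dots> = (LINT t|I01. \<bar>?z t * y t\<bar>)" using c by (simp add: abs_mult mult.assoc)
      finally show ?thesis .
    qed
    ultimately show ?thesis using carrier_scale[OF carrier_abs(1)[OF x(1)], of c] c by (intro exI[of _ ?z]) simp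
  qed
  then obtain z where z: "\<And>n. z n \<in> carrier X" "\<And>n t. 0 \<le> z n t" "\<And>n. nrm X (z n) \<le> (1 / 2) ^ n"
    "\<And>n::nat. 2 ^ n < (LINT t|I01. \<bar>z n t * y t\<bar>)" by metis
  define u where "u n t = (\<Sum>k<n. z k t)" for n t
  have u_Suc: "u (Suc n) = (\<lambda>t. u n t + z n t)" for n by (simp add: u_def fun_eq_iff)
  have u0: "u 0 = (\<lambda>t. 0)" by (simp add: u_def fun_eq_iff)
  have u: "u n \<in> carrier X" for n
    by (induction n) (simp_all only: u0 u_Suc carrier_zero carrier_add z(1))
  obtain x where x: "x \<in> carrier X" "(\<lambda>n. nrm X (\<lambda>t. u n t - x t)) \<longlonglongrightarrow> 0"
  proof (rule geometric_complete[OF u])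
    show "nrm X (\<lambda>t. u (Suc n) t - u n t) \<le> (1 / 2) ^ n" for n using z(3)[of n] by (simp add: u_Suc)
  qed
  have [measurable]: "x \<in> borel_measurable I01" "z n \<in> borel_measurable I01" for n
    using carrier_measurable x(1) z(1) by blast+
  have large: "2 ^ n < (LINT t|I01. \<bar>x t * y t\<bar>)" for n :: nat
  proof -
    \<comment> \<open>\<open>x\<close> dominates \<open>z n\<close> almost everywhere: the positive
      part of \<open>z n - x\<close> is at most \<open>|u N - x|\<close> for every
      \<open>N > n\<close>, and the norm of the latter tends to 0.\<close>
    let ?p = "\<lambda>t. max (z n t - x t) 0"
    have bound: "?p \<in> carrier X \<and> nrm X ?p \<le> nrm X (\<lambda>t. u N t - x t)" if N: "n < N" for N
    proof -
      have "z n t \<le> u N t" for t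
        unfolding u_def by (rule member_le_sum) (use z(2) N in auto)
      then have "\<bar>?p t\<bar> \<le> \<bar>u N t - x t\<bar>" for t by (smt (verit))
      then have "AE t in I01. \<bar>?p t\<bar> \<le> \<bar>u N t - x t\<bar>" by simp
      moreover have "?p \<in> borel_measurable I01" by measurable
      ultimately show ?thesis using carrier_AE_le[OF carrier_diff[OF u x(1)]] by simp
    qed
    have "nrm X ?p \<le> 0"
      by (rule LIMSEQ_le_const[OF x(2)]) (use bound in \<open>auto intro!: exI[of _ "Suc n"]\<close>)
    then have "nrm X ?p = 0" using norm_nonneg[of ?p] bound[of "Suc n"] by simp
    then have "AE t in I01. ?p t = 0" using norm_eq_0_iff[of ?p] bound[of "Suc n"] by simp
    then have le: "AE t in I01. \<bar>z n t * y t\<bar> \<le> \<bar>x t * y t\<bar>"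
    proof eventually_elim
      case (elim t)
      then have "z n t \<le> x t" by (simp add: max_def split: if_splits)
      then have "\<bar>z n t\<bar> \<le> \<bar>x t\<bar>" using z(2)[of n t] by simp
      then show ?case by (simp add: abs_mult mult_right_mono)
    qed
    have "(LINT t|I01. \<bar>z n t * y t\<bar>) \<le> (LINT t|I01. \<bar>x t * y t\<bar>)"
      by (rule integral_mono_AE[OF _ _ le]) (use int[OF x(1)] int[OF z(1)[of n]] in auto)
    then show ?thesis using z(4)[of n] by simp
  qed
  obtain n :: nat where "(LINT t|I01. \<bar>x t * y t\<bar>) < 2 ^ n"
    using real_arch_pow[of 2 "LINT t|I01. \<bar>x t * y t\<bar>"] by auto
  with large[of n] show False by simp
qed

end

section \<open>Koethe duality and the embedding into \<open>L_1\<close>\<close>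

locale isometric_symmetric_space = symmetric_function_space +
  assumes isometric: "isometric_in_bidual X"
begin

lemma zero_in_unit_ball_dual: "(\<lambda>t. 0) \<in> carrier (kothe_dual X)" "nrm (kothe_dual X) (\<lambda>t. 0) = 0"
proof -
  have "{LINT t|I01. x t * 0 |x. x \<in> carrier X \<and> nrm X x \<le> 1} = {0}"
    using carrier_zero norm_eq_0_iff[OF carrier_zero] by auto
  then show "(\<lambda>t. 0) \<in> carrier (kothe_dual X)" "nrm (kothe_dual X) (\<lambda>t. 0) = 0"
    by (simp_all add: kothe_dual_def)
qed

lemma dual_integrable:
  assumes "y \<in> carrier (kothe_dual X)" "x \<in> carrier X"
  shows "integrable I01 (\<lambda>t. x t * y t)"
proof -
  have [measurable]: "y \<in> borel_measurable I01" "x \<in> borel_measurable I01"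
    using assms carrier_measurable by (auto simp: kothe_dual_def)
  have "integrable I01 (\<lambda>t. \<bar>x t * y t\<bar>)" using assms by (simp add: kothe_dual_def)
  then show ?thesis by (rule Bochner_Integration.integrable_bound) auto
qed

lemma norming_functional:
  assumes x: "x \<in> carrier X" and c: "c < nrm X x"
  obtains y where "y \<in> carrier (kothe_dual X)" "nrm (kothe_dual X) y \<le> 1" "c < (LINT t|I01. x t * y t)"
proof -
  let ?S = "{LINT t|I01. y t * x t | y. y \<in> carrier (kothe_dual X) \<and> nrm (kothe_dual X) y \<le> 1}"
  have "nrm X x = Sup ?S"
    using isometric x unfolding isometric_in_bidual_def by (simp add: kothe_dual_def[of "kothe_dual X"])
  then have c: "c < Sup ?S" using c by simp
  have ne: "?S \<noteq> {}" using zero_in_unit_ball_dual by fastforce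
  have "\<exists>s\<in>?S. c < s"
  \<comment> \<open>For an unbounded set the real supremum says nothing, but then some member
    exceeds \<open>c\<close> anyway.\<close>
  proof (cases "bdd_above ?S")
    case True
    then show ?thesis using less_cSup_iff[OF ne True] c by simp
  next
    case False
    then show ?thesis unfolding bdd_above_def by (meson not_le)
  qed
  then obtain y where "y \<in> carrier (kothe_dual X)" "nrm (kothe_dual X) y \<le> 1" "c < (LINT t|I01. y t * x t)"
    by auto
  then show ?thesis by (intro that) (simp_all add: mult.commute)
qed

text \<open>The real supremum in the dual norm controls its members only if they are bounded above,
  which \<open>integral_functional_bounded\<close> guarantees; a rescaling to the unit ball does the
  rest.\<close>

lemma dual_ball_bound:
  assumes y: "y \<in> carrier (kothe_dual X)" "nrm (kothe_dual X) y \<le> 1"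
    and x: "x \<in> carrier X"
  shows "(LINT t|I01. x t * y t) \<le> nrm X x"
proof -
  have ym: "y \<in> borel_measurable I01" using y by (simp add: kothe_dual_def)
  obtain C where C: "0 < C" "\<And>x. x \<in> carrier X \<Longrightarrow> (LINT t|I01. \<bar>x t * y t\<bar>) \<le> C * nrm X x"
    using integral_functional_bounded[OF ym dual_integrable[OF y(1)]] by blast
  have ball: "(LINT t|I01. u t * y t) \<le> 1" if u: "u \<in> carrier X" "nrm X u \<le> 1" for u
  proof -
    let ?S = "{LINT t|I01. x t * y t | x. x \<in> carrier X \<and> nrm X x \<le> 1}"
    have "s \<le> C" if s: "s \<in> ?S" for s
    proof -
      obtain v where v: "v \<in> carrier X" "nrm X v \<le> 1" "s = (LINT t|I01. v t * y t)" using s by blast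
      have "s \<le> (LINT t|I01. \<bar>v t * y t\<bar>)" unfolding v(3)
        by (rule integral_mono) (use dual_integrable[OF y(1) v(1)] in auto)
      also have "\<dots> \<le> C * nrm X v" by (rule C(2)[OF v(1)])
      also have "\<dots> \<le> C" using C(1) v(2) by simp
      finally show ?thesis .
    qed
    then have "bdd_above ?S" by (rule bdd_aboveI)
    then have "(LINT t|I01. u t * y t) \<le> Sup ?S" by (intro cSup_upper) (use u in auto)
    also have "\<dots> \<le> 1" using y(2) by (simp add: kothe_dual_def)
    finally show ?thesis .
  qed
  show ?thesis
  proof (cases "nrm X x = 0")
    case True
    then have "AE t in I01. x t = 0" using norm_eq_0_iff[OF x] by simp
    then have "AE t in I01. x t * y t = 0" by eventually_elim simp
    then show ?thesis using True by (simp add: integral_eq_zero_AE)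
  next
    case False
    then have pos: "0 < nrm X x" using norm_nonneg[OF x] by simp
    let ?c = "1 / nrm X x"
    have "nrm X (\<lambda>t. ?c * x t) \<le> 1" using norm_scale[OF x, of ?c] pos by simp
    from ball[OF carrier_scale[OF x] this] have "(LINT t|I01. ?c * (x t * y t)) \<le> 1" by (simp add: mult.assoc)
    then show ?thesis using pos by (simp add: field_simps)
  qed
qed

text \<open>A nonzero element of the dual is bounded below on a set of positive measure, and by symmetry the
  large values of any element can be transported into that set.\<close>

lemma carrier_integrable:
  assumes x: "x \<in> carrier X"
  shows "integrable I01 x"
proof -
  have xm[measurable]: "x \<in> borel_measurable I01" by (rule carrier_measurable[OF x])
  obtain x0 where x0: "x0 \<in> carrier X" "\<not> (AE t in I01. x0 t = 0)" using carrier_nontrivial by (elim bexE)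
  then have "0 < nrm X x0" using norm_eq_0_iff[OF x0(1)] norm_nonneg[OF x0(1)] by simp
  from norming_functional[OF x0(1) this] obtain y
    where y: "y \<in> carrier (kothe_dual X)" "0 < (LINT t|I01. x0 t * y t)" by blast
  have ym[measurable]: "y \<in> borel_measurable I01" using y by (simp add: kothe_dual_def)
  have "\<exists>d>0. 0 < distr_fun y d"
  proof (rule ccontr)
    assume "\<not> (\<exists>d>0. 0 < distr_fun y d)"
    then have zero: "distr_fun y d = 0" if "0 < d" for d
    proof -
      have "\<not> 0 < distr_fun y d" using \<open>\<not> (\<exists>d>0. 0 < distr_fun y d)\<close> that by blast
      then show ?thesis using distr_fun_nonneg[of y d] by linarith
    qed
    have "{t \<in> {0..1}. \<bar>y t\<bar> > d} \<in> null_sets I01" if "0 < d" for d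
      using zero[OF that] distr_fun_measurable[OF ym] by (simp add: null_sets_def I01.emeasure_eq_measure distr_fun_def)
    then have "AE t in I01. \<forall>k. t \<notin> {t \<in> {0..1}. \<bar>y t\<bar> > 1 / real (Suc k)}"
      unfolding AE_all_countable by (intro allI AE_not_in) simp
    then have "AE t in I01. x0 t * y t = 0" using AE_space
    proof eventually_elim
      case (elim t)
      have "\<not> 0 < \<bar>y t\<bar>"
      proof
        assume "0 < \<bar>y t\<bar>"
        then obtain k where "1 / real (Suc k) < \<bar>y t\<bar>" using nat_approx_posE by blast
        then show False using elim by simp
      qed
      then show ?case by simp
    qed
    then show False using y(2) by (simp add: integral_eq_zero_AE)
  qed
  then obtain d where d: "0 < d" "0 < distr_fun y d" by blast
  define E where "E = {t \<in> {0..1}. \<bar>y t\<bar> > d}"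
  have E: "E \<in> sets I01" unfolding E_def by (rule distr_fun_measurable[OF ym])
  \<comment> \<open>\<open>k\<close> makes the set where \<open>|x| > k\<close> no larger than
    \<open>E\<close>. This part of \<open>x\<close> can be moved into \<open>E\<close>, where
    integrability against \<open>y\<close> implies integrability; the rest of \<open>x\<close> is
    bounded by \<open>k\<close>.\<close>
  obtain k :: nat where k: "distr_fun x (real k) < distr_fun y d" using distr_fun_small[OF xm d(2)] .
  define B where "B = {t \<in> {0..1}. \<bar>x t\<bar> > real k}"
  have B: "B \<in> sets I01" unfolding B_def by (rule distr_fun_measurable[OF xm])
  have "measure I01 B \<le> measure I01 E" using k by (simp add: B_def E_def distr_fun_def)
  from transport_distribution[OF E B this xm] obtain g where g: "g \<in> borel_measurable I01" "\<And>t. 0 \<le> g t"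
    "\<And>\<tau>. 0 \<le> \<tau> \<Longrightarrow> measure I01 {t \<in> E. g t > \<tau>} = measure I01 {t \<in> B. \<bar>x t\<bar> > \<tau>}" by blast
  note [measurable] = g(1) E B
  define h where "h t = indicator E t * g t" for t
  have hm[measurable]: "h \<in> borel_measurable I01" unfolding h_def by measurable
  have dh: "distr_fun h \<tau> = measure I01 {t \<in> B. \<bar>x t\<bar> > \<tau>}" if "0 \<le> \<tau>" for \<tau>
  proof -
    have "{t \<in> {0..1}. \<bar>h t\<bar> > \<tau>} = {t \<in> E. g t > \<tau>}"
      using g(2) that by (auto simp: h_def E_def indicator_def split: if_splits)
    then show ?thesis using g(3)[OF that] by (simp add: distr_fun_def)
  qed
  have h: "h \<in> carrier X"
  proof (rule carrier_distr_fun_le(1)[OF x hm])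
    fix \<tau> :: real assume \<tau>: "0 \<le> \<tau>"
    show "distr_fun h \<tau> \<le> distr_fun x \<tau>" unfolding dh[OF \<tau>] unfolding distr_fun_def
      by (rule I01.finite_measure_mono[OF _ distr_fun_measurable[OF xm]]) (auto simp: B_def)
  qed
  have "integrable I01 (\<lambda>t. (1 / d) * (h t * y t))" using dual_integrable[OF y(1) h] by simp
  then have "integrable I01 h"
  proof (rule Bochner_Integration.integrable_bound)
    show "AE t in I01. norm (h t) \<le> norm (1 / d * (h t * y t))"
    proof (rule AE_I2)
      fix t
      show "norm (h t) \<le> norm (1 / d * (h t * y t))"
      proof (cases "t \<in> E")
        case True
        then have "\<bar>h t\<bar> * d \<le> \<bar>h t\<bar> * \<bar>y t\<bar>" by (intro mult_left_mono) (auto simp: E_def)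
        then show ?thesis using d(1) by (simp add: abs_mult field_simps)
      qed (simp add: h_def)
    qed
  qed measurable
  then have "integrable I01 (\<lambda>t. indicator B t * x t)"
  proof (rule integrable_distr_le[rotated])
    fix \<tau> :: real assume \<tau>: "0 \<le> \<tau>"
    have "{t \<in> {0..1}. \<bar>indicator B t * x t\<bar> > \<tau>} = {t \<in> B. \<bar>x t\<bar> > \<tau>}"
      using \<tau> by (auto simp: B_def indicator_def split: if_splits)
    then show "distr_fun (\<lambda>t. indicator B t * x t) \<tau> \<le> distr_fun h \<tau>"
      using dh[OF \<tau>] by (simp add: distr_fun_def)
  qed measurable
  moreover have "integrable I01 (\<lambda>t. real k)" by simp
  ultimately have "integrable I01 (\<lambda>t. \<bar>indicator B t * x t\<bar> + real k)" by simp
  then show ?thesis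
  proof (rule Bochner_Integration.integrable_bound)
    show "AE t in I01. norm (x t) \<le> norm (\<bar>indicator B t * x t\<bar> + real k)"
      using AE_space by eventually_elim (auto simp: B_def indicator_def)
  qed measurable
qed

lemma L1_embedding:
  obtains C where "0 < C" "\<And>x. x \<in> carrier X \<Longrightarrow> (LINT t|I01. \<bar>x t\<bar>) \<le> C * nrm X x"
  using integral_functional_bounded[of "\<lambda>_. 1"] carrier_integrable by auto

text \<open>The two limits are compared in \<open>L_1\<close>: \<open>L1_embedding\<close> turns
  norm convergence into \<open>L_1\<close> convergence, and a subsequence then converges almost
  everywhere.\<close>

lemma norm_limit_AE_eq:
  assumes u: "\<And>n::nat. u n \<in> carrier X" and x: "x \<in> carrier X"
    and lim: "(\<lambda>n. nrm X (\<lambda>t. u n t - x t)) \<longlonglongrightarrow> 0"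
    and z: "AE t in I01. (\<lambda>n. u n t) \<longlonglongrightarrow> z t"
  shows "AE t in I01. z t = x t"
proof -
  obtain C where C: "0 < C" "\<And>x. x \<in> carrier X \<Longrightarrow> (LINT t|I01. \<bar>x t\<bar>) \<le> C * nrm X x"
    using L1_embedding by blast
  have "(\<lambda>n. LINT t|I01. norm (u n t - x t)) \<longlonglongrightarrow> 0"
  proof (rule Lim_null_comparison)
    show "\<forall>\<^sub>F n in sequentially. norm (LINT t|I01. norm (u n t - x t)) \<le> C * nrm X (\<lambda>t. u n t - x t)"
    proof (intro always_eventually allI)
      fix n
      have "0 \<le> (LINT t|I01. \<bar>u n t - x t\<bar>)" by simp
      then show "norm (LINT t|I01. norm (u n t - x t)) \<le> C * nrm X (\<lambda>t. u n t - x t)"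
        using C(2)[OF carrier_diff[OF u x], of n] by simp
    qed
    show "(\<lambda>n. C * nrm X (\<lambda>t. u n t - x t)) \<longlonglongrightarrow> 0"
      using tendsto_mult_left[OF lim, of C] by simp
  qed
  then obtain r where r: "strict_mono r" "AE t in I01. (\<lambda>n. u (r n) t - x t) \<longlonglongrightarrow> 0"
    using tendsto_L1_AE_subseq[of I01 "\<lambda>n t. u n t - x t"] carrier_integrable[OF carrier_diff[OF u x]] by auto
  show ?thesis using r(2) z
  proof eventually_elim
    case (elim t)
    have "(\<lambda>n. u (r n) t) \<longlonglongrightarrow> z t"
      using LIMSEQ_subseq_LIMSEQ[OF elim(2) r(1)] by (simp add: comp_def)
    moreover have "(\<lambda>n. u (r n) t) \<longlonglongrightarrow> x t" using elim(1) by (simp add: LIM_zero_iff)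
    ultimately show ?case by (rule LIMSEQ_unique)
  qed
qed

end

section \<open>Decorrelation of blocks\<close>

lemma rad_poly_I01 [measurable]: "rad_poly a n \<in> borel_measurable I01"
  by (rule borel_measurable_I01) measurable

lemma rad_poly_scale: "rad_poly (\<lambda>k. c * a k) n t = c * rad_poly a n t"
  by (simp add: rad_poly_def sum_distrib_left mult.assoc)

lemma rad_poly_plus: "rad_poly (\<lambda>k. a k + b k) n t = rad_poly a n t + rad_poly b n t"
  by (simp add: rad_poly_def sum.distrib distrib_right)

lemma rad_poly_cong: "(\<And>k. k < n \<Longrightarrow> a k = b k) \<Longrightarrow> rad_poly a n t = rad_poly b n t"
  by (simp add: rad_poly_def)

lemma rad_poly_support: "n \<le> m \<Longrightarrow> (\<And>k. n \<le> k \<Longrightarrow> a k = 0) \<Longrightarrow> rad_poly a m t = rad_poly a n t"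
  unfolding rad_poly_def by (rule sum.mono_neutral_right) auto

lemma rad_poly_delay:
  "rad_poly (\<lambda>k. if k < m then 0 else a (k - m)) (m + n) t = rad_poly a n (2 ^ m * t)"
proof -
  have "rad_poly (\<lambda>k. if k < m then 0 else a (k - m)) m t = 0" by (simp add: rad_poly_def)
  then show ?thesis by (simp add: rad_poly_add)
qed

text \<open>A bounded function of a block of \<open>n\<close> Rademacher functions decorrelates from a fixed set when the block
  is moved far out: the centred translates are orthogonal, so only boundedly many of them can have a
  substantial correlation with the set.\<close>

lemma finite_correlated_blocks:
  fixes Q :: "real set"
  assumes D: "D \<in> sets I01" and \<delta>: "0 < measure I01 D"
  shows "finite {i. measure I01 {t \<in> D. rad_poly a n (2 ^ (n * i) * t) \<in> Q} <
           measure I01 D / 2 * sign_mean (indicator Q) (map a [0..<n]) 0}" (is "finite ?bad")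
proof -
  define \<delta> where "\<delta> = measure I01 D"
  define p where "p = sign_mean (indicator Q) (map a [0..<n]) (0 :: real)"
  define f where "f i t = (indicator Q (rad_poly a n (2 ^ (n * i) * t)) :: real)" for i t
  have p01: "0 \<le> p" "p \<le> 1"
    using sign_mean_mono[of "\<lambda>_. 0" "indicator Q" "map a [0..<n]" 0]
      sign_mean_mono[of "indicator Q" "\<lambda>_. 1" "map a [0..<n]" 0]
    by (simp_all add: p_def sign_mean_const indicator_def)
  have f_int: "has_bochner_integral I01 (f i) p" for i
    unfolding f_def[abs_def] p_def
    by (rule integral_periodic_dilate[where g = "\<lambda>t. indicator Q (rad_poly a n t)"])
      (simp_all add: rad_poly_periodic integral_rad_poly)
  have f_sq: "f i t * f i t = f i t" for i t by (simp add: f_def indicator_def)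
  have ff_int: "has_bochner_integral I01 (\<lambda>t. f i t * f j t) (if i = j then p else p\<^sup>2)" for i j
  proof -
    have *: "has_bochner_integral I01 (\<lambda>t. f i t * f j t) (p\<^sup>2)" if "i < j" for i j
    proof -
      have "n * i + n * (j - i) = n * j" using that by (simp add: distrib_left[symmetric])
      moreover have "n \<le> n * (j - i)" using that by (cases "j - i") auto
      ultimately show ?thesis
        using integral_blocks_independent[of n "n * (j - i)" "indicator Q" a "n * i"]
        by (simp add: f_def p_def)
    qed
    show ?thesis
    proof (cases "i = j")
      case True
      then show ?thesis using f_int by (simp add: f_sq)
    next
      case False
      then show ?thesis using *[of i j] *[of j i] by (cases "i < j") (simp_all add: mult.commute)
    qed
  qed
  have cov: "has_bochner_integral I01 (\<lambda>t. (f i t - p) * (f j t - p)) (if i = j then p - p\<^sup>2 else 0)" for i j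
  proof -
    have "has_bochner_integral I01 (\<lambda>t. f i t * f j t - p * f i t - p * f j t + p\<^sup>2)
        ((if i = j then p else p\<^sup>2) - p * p - p * p + p\<^sup>2)"
      by (intro has_bochner_integral_add has_bochner_integral_diff has_bochner_integral_mult_right
          ff_int f_int has_bochner_integral_I01_const)
    moreover have "(if i = j then p else p\<^sup>2) - p * p - p * p + p\<^sup>2 = (if i = j then p - p\<^sup>2 else 0)"
      by (simp add: power2_eq_square)
    moreover have "f i t * f j t - p * f i t - p * f j t + p\<^sup>2 = (f i t - p) * (f j t - p)" for t
      by (simp add: power2_eq_square algebra_simps)
    ultimately show ?thesis by simp
  qed
  have fm[measurable]: "f i \<in> borel_measurable I01" for i
    using f_int by (simp add: borel_measurable_has_bochner_integral)
  have fD: "has_bochner_integral I01 (\<lambda>t. indicator D t * f i t)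
      (measure I01 {t \<in> D. rad_poly a n (2 ^ (n * i) * t) \<in> Q})" for i
  proof -
    have eq: "indicator D t * f i t = indicator {t \<in> D. rad_poly a n (2 ^ (n * i) * t) \<in> Q} t" for t
      by (simp add: f_def indicator_def)
    have "{t \<in> space I01. f i t = 1} \<in> sets I01" by measurable
    then have "D \<inter> {t \<in> space I01. f i t = 1} \<in> sets I01" using D by simp
    also have "D \<inter> {t \<in> space I01. f i t = 1} = {t \<in> D. rad_poly a n (2 ^ (n * i) * t) \<in> Q}"
      using sets.sets_into_space[OF D] by (auto simp: f_def indicator_def split: if_splits)
    finally show ?thesis
      unfolding eq by (intro has_bochner_integral_real_indicator) (auto simp: I01.emeasure_eq_measure)
  qed
  have card: "finite J \<and> real (card J) \<le> 4 / (\<delta>\<^sup>2 * p)" if J: "J \<subseteq> ?bad" "finite J" for J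
  proof (cases "J = {}")
    case True
    then show ?thesis using p01 by simp
  next
    case False
    have bad: "measure I01 {t \<in> D. rad_poly a n (2 ^ (n * i) * t) \<in> Q} < \<delta> / 2 * p" if "i \<in> J" for i
      using J(1) that by (auto simp: \<delta>_def p_def)
    have \<delta>0: "0 < \<delta>" using \<delta> by (simp add: \<delta>_def)
    have "p \<noteq> 0"
    proof
      assume "p = 0"
      then show False using False bad by (metis all_not_in_conv measure_nonneg mult_zero_right not_less)
    qed
    then have p: "0 < p" using p01 by simp
    define N where "N = real (card J)"
    let ?g = "\<lambda>t. \<Sum>i\<in>J. f i t - p"
    have "has_bochner_integral I01 (\<lambda>t. \<Sum>i\<in>J. \<Sum>j\<in>J. (f i t - p) * (f j t - p))
        (\<Sum>i\<in>J. \<Sum>j\<in>J. if i = j then p - p\<^sup>2 else 0)"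
      by (intro has_bochner_integral_sum cov)
    then have g2: "has_bochner_integral I01 (\<lambda>t. (?g t)\<^sup>2) (N * (p - p\<^sup>2))"
      using J(2) by (simp add: power2_eq_square sum_product N_def)
    have "has_bochner_integral I01 (\<lambda>t. \<Sum>i\<in>J. indicator D t * f i t - p * indicator D t)
        (\<Sum>i\<in>J. measure I01 {t \<in> D. rad_poly a n (2 ^ (n * i) * t) \<in> Q} - p * \<delta>)"
      unfolding \<delta>_def
      by (intro has_bochner_integral_sum has_bochner_integral_diff has_bochner_integral_mult_right fD
          has_bochner_integral_real_indicator D) (auto simp: I01.emeasure_eq_measure)
    then have gD: "has_bochner_integral I01 (\<lambda>t. indicator D t * ?g t)
        (\<Sum>i\<in>J. measure I01 {t \<in> D. rad_poly a n (2 ^ (n * i) * t) \<in> Q} - p * \<delta>)"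
      by (simp add: sum_distrib_left right_diff_distrib mult.commute)
    have low: "(\<Sum>i\<in>J. measure I01 {t \<in> D. rad_poly a n (2 ^ (n * i) * t) \<in> Q} - p * \<delta>) \<le> - (N * \<delta> * p / 2)"
    proof -
      have "(\<Sum>i\<in>J. measure I01 {t \<in> D. rad_poly a n (2 ^ (n * i) * t) \<in> Q} - p * \<delta>) \<le> (\<Sum>i\<in>J. - (\<delta> * p / 2))"
        by (rule sum_mono) (use bad in \<open>force simp: field_simps\<close>)
      then show ?thesis by (simp add: N_def)
    qed
    \<comment> \<open>Young's inequality in place of Cauchy-Schwarz, weighted so that the quadratic
      term absorbs half of \<open>N * \<delta> * p / 2\<close>. What remains is
      \<open>N * \<delta> * p / 4 \<le> 1 / \<delta>\<close>.\<close>
    have "(LINT t|I01. - (indicator D t * ?g t)) \<le> (LINT t|I01. \<delta> / 4 * (?g t)\<^sup>2 + 1 / \<delta>)"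
    proof (rule integral_mono)
      show "integrable I01 (\<lambda>t. - (indicator D t * ?g t))"
        using gD by (intro integrable_minus) (simp add: has_bochner_integral_iff)
      show "integrable I01 (\<lambda>t. \<delta> / 4 * (?g t)\<^sup>2 + 1 / \<delta>)"
        using g2 by (simp add: has_bochner_integral_iff)
      fix t
      have "0 \<le> (\<delta> / 2 * ?g t + 1)\<^sup>2 / \<delta>" using \<delta>0 by simp
      also have "\<dots> = \<delta> / 4 * (?g t)\<^sup>2 + ?g t + 1 / \<delta>"
        using \<delta>0 by (simp add: field_simps power2_eq_square)
      finally have "- ?g t \<le> \<delta> / 4 * (?g t)\<^sup>2 + 1 / \<delta>" by linarith
      moreover have "0 \<le> \<delta> / 4 * (?g t)\<^sup>2 + 1 / \<delta>" using \<delta>0 by simp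
      ultimately show "- (indicator D t * ?g t) \<le> \<delta> / 4 * (?g t)\<^sup>2 + 1 / \<delta>" by (simp add: indicator_def)
    qed
    also have "\<dots> = \<delta> / 4 * (N * (p - p\<^sup>2)) + 1 / \<delta>"
      using g2 has_bochner_integral_I01_const[of "1 / \<delta>"] by (simp add: has_bochner_integral_iff)
    also have "\<dots> \<le> \<delta> / 4 * (N * p) + 1 / \<delta>"
      using \<delta>0 by (intro add_mono mult_left_mono) (auto simp: N_def)
    finally have "- (LINT t|I01. indicator D t * ?g t) \<le> \<delta> / 4 * (N * p) + 1 / \<delta>" by simp
    then have "N * \<delta> * p / 2 \<le> \<delta> / 4 * (N * p) + 1 / \<delta>"
      using low has_bochner_integral_integral_eq[OF gD] by linarith
    then have "N * \<delta> * p / 4 \<le> 1 / \<delta>" by simp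
    then have "N \<le> 4 / (\<delta>\<^sup>2 * p)" using \<delta>0 p by (simp add: field_simps power2_eq_square)
    then show ?thesis using J(2) by (simp add: N_def)
  qed
  show ?thesis
  proof (rule ccontr)
    assume "infinite ?bad"
    then obtain J where J: "J \<subseteq> ?bad" "finite J" "card J = Suc (nat \<lceil>4 / (\<delta>\<^sup>2 * p)\<rceil>)"
      using infinite_arbitrarily_large by blast
    have "real (card J) \<le> 4 / (\<delta>\<^sup>2 * p)" using card[OF J(1,2)] by simp
    also have "\<dots> < real (card J)" unfolding J(3) by linarith
    finally show False by simp
  qed
qed

lemma finite_range_rad_poly: "finite (range (rad_poly a n))"
proof -
  have "range (rad_poly a n) \<subseteq> (\<lambda>e. \<Sum>k<n. a k * e k) ` ({..<n} \<rightarrow>\<^sub>E {-1, 0, 1})"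
  proof safe
    fix t
    let ?e = "restrict (\<lambda>k. rademacher (Suc k) t) {..<n}"
    have "?e \<in> {..<n} \<rightarrow>\<^sub>E {-1, 0, 1}" by (auto simp: rademacher_def sgn_if)
    moreover have "rad_poly a n t = (\<Sum>k<n. a k * ?e k)" by (simp add: rad_poly_def)
    ultimately show "rad_poly a n t \<in> (\<lambda>e. \<Sum>k<n. a k * e k) ` ({..<n} \<rightarrow>\<^sub>E {-1, 0, 1})" by blast
  qed
  then show ?thesis by (rule finite_subset) (auto intro!: finite_imageI finite_PiE)
qed

text \<open>A polynomial takes finitely many values, so only finitely many sets \<open>Q\<close> of
  values arise. One shift outside all their finite exceptional sets serves every
  \<open>\<tau>\<close> at once.\<close>

lemma rad_poly_mixing:
  assumes D: "D \<in> sets I01" "0 < measure I01 D"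
  obtains m where "\<And>\<tau>. measure I01 D / 2 * distr_fun (rad_poly a n) \<tau> \<le>
    measure I01 {t \<in> D. \<bar>rad_poly a n (2 ^ m * t)\<bar> > \<tau>}"
proof -
  let ?V = "range (rad_poly a n)"
  have "finite (\<Union>Q\<in>Pow ?V. {i. measure I01 {t \<in> D. rad_poly a n (2 ^ (n * i) * t) \<in> Q} <
           measure I01 D / 2 * sign_mean (indicator Q) (map a [0..<n]) 0})"
    by (intro finite_UN_I finite_correlated_blocks D) (simp add: finite_range_rad_poly)
  then obtain i where i: "i \<notin> (\<Union>Q\<in>Pow ?V. {i. measure I01 {t \<in> D. rad_poly a n (2 ^ (n * i) * t) \<in> Q} <
           measure I01 D / 2 * sign_mean (indicator Q) (map a [0..<n]) 0})"
    using ex_new_if_finite[OF infinite_UNIV_nat] by blast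
  show ?thesis
  proof (rule that[of "n * i"])
    fix \<tau>
    define Q where "Q = {v \<in> ?V. \<bar>v\<bar> > \<tau>}"
    have Q: "rad_poly a n t \<in> Q \<longleftrightarrow> \<bar>rad_poly a n t\<bar> > \<tau>" for t by (simp add: Q_def)
    have "Q \<in> Pow ?V" by (auto simp: Q_def)
    then have "measure I01 D / 2 * sign_mean (indicator Q) (map a [0..<n]) 0 \<le>
        measure I01 {t \<in> D. rad_poly a n (2 ^ (n * i) * t) \<in> Q}"
      using i by (auto simp: not_less)
    moreover have "sign_mean (indicator Q) (map a [0..<n]) 0 = distr_fun (rad_poly a n) \<tau>"
    proof -
      have "indicator Q (rad_poly a n t) = (if \<bar>rad_poly a n t\<bar> > \<tau> then 1 else 0 :: real)" for t
        by (simp add: indicator_def Q)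
      then show ?thesis unfolding distr_fun_def
        using integral_rad_poly[of "indicator Q" a n]
        by (intro measure_eq_has_bochner_integral(2)[symmetric]) (simp only:)
    qed
    ultimately show "measure I01 D / 2 * distr_fun (rad_poly a n) \<tau> \<le>
        measure I01 {t \<in> D. \<bar>rad_poly a n (2 ^ (n * i) * t)\<bar> > \<tau>}"
      by (simp add: Q)
  qed
qed

section \<open>Unbounded multipliers\<close>

text \<open>\<open>w_unbounded\<close> is meant for every \<open>K\<close>. \<open>w_mem\<close> is
  what the inclusion of \<open>L_infty\<close> in the weighted space says for the constant function
  1.\<close>

locale unbounded_multiplier = isometric_symmetric_space +
  fixes w :: "real \<Rightarrow> real"
  assumes multiplier: "w \<in> multiplicator X"
    and w_pos: "AE t in I01. w t > 0"
    and w_mem: "w \<in> carrier X"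
    and w_unbounded: "0 < distr_fun w K"
begin

lemma w_measurable [measurable]: "w \<in> borel_measurable I01"
  by (rule carrier_measurable[OF w_mem])

lemma bounded_multiple_mem:
  assumes x: "x \<in> carrier X" and f[measurable]: "f \<in> borel_measurable I01" and M: "\<And>t. \<bar>f t\<bar> \<le> M"
  shows "(\<lambda>t. f t * x t) \<in> carrier X" "nrm X (\<lambda>t. f t * x t) \<le> M * nrm X x"
proof -
  have M0: "0 \<le> M" using M[of 0] by linarith
  have [measurable]: "x \<in> borel_measurable I01" by (rule carrier_measurable[OF x])
  have m: "(\<lambda>t. f t * x t) \<in> borel_measurable I01" by measurable
  have "AE t in I01. \<bar>f t * x t\<bar> \<le> \<bar>M * x t\<bar>"
    using M M0 by (intro AE_I2) (simp add: abs_mult mult_right_mono)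
  from carrier_AE_le[OF carrier_scale[OF x] m this] show
    "(\<lambda>t. f t * x t) \<in> carrier X" "nrm X (\<lambda>t. f t * x t) \<le> M * nrm X x"
    using norm_scale[OF x, of M] M0 by simp_all
qed

text \<open>\<open>w\<close> exceeds some \<open>1 / c\<close> on more than half of the interval, so
  \<open>c w\<close> dominates in distribution the indicator of every set of measure at most 1/2.
  Two such indicators add up to 1.\<close>

lemma one_mem: "(\<lambda>t. 1) \<in> carrier X"
proof -
  let ?A = "\<lambda>k. {t \<in> {0..1}. \<bar>w t\<bar> > 1 / real (Suc k)}"
  have A: "?A k \<in> sets I01" for k by (rule distr_fun_measurable[OF w_measurable])
  have "incseq ?A"
  proof (rule incseq_SucI, safe)
    fix k t assume "1 / real (Suc k) < \<bar>w t\<bar>"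
    moreover have "1 / real (Suc (Suc k)) \<le> 1 / real (Suc k)" by (simp add: frac_le)
    ultimately show "1 / real (Suc (Suc k)) < \<bar>w t\<bar>" by linarith
  qed
  then have lim: "(\<lambda>k. measure I01 (?A k)) \<longlonglongrightarrow> measure I01 (\<Union>k. ?A k)"
    by (intro I01.finite_Lim_measure_incseq) (use A in blast)
  have "measure I01 {0..1} \<le> measure I01 (\<Union>k. ?A k)"
  proof (rule I01.finite_measure_mono_AE)
    show "AE t in I01. t \<in> {0..1} \<longrightarrow> t \<in> (\<Union>k. ?A k)" using w_pos
    proof eventually_elim
      case (elim t)
      then obtain k where "1 / real (Suc k) < w t" using nat_approx_posE by blast
      then have "1 / real (Suc k) < \<bar>w t\<bar>" by linarith
      then show ?case by blast
    qed
  qed (use A in blast)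
  then have "1 / 2 < measure I01 (\<Union>k. ?A k)" by simp
  from order_tendstoD(1)[OF lim this] obtain k where k: "1 / 2 < measure I01 (?A k)"
    by (auto simp: eventually_sequentially)
  define c where "c = real (Suc k)"
  have c: "0 < c" "1 / 2 < distr_fun w (1 / c)" using k by (simp_all add: c_def distr_fun_def)
  have half: "(indicator S :: real \<Rightarrow> real) \<in> carrier X" if S: "S \<in> sets I01" "measure I01 S \<le> 1 / 2" for S
  proof (rule carrier_distr_fun_le(1)[OF carrier_scale[OF w_mem, of c]])
    show "(indicator S :: real \<Rightarrow> real) \<in> borel_measurable I01" using S(1) by measurable
    fix \<tau> :: real assume \<tau>: "0 \<le> \<tau>"
    show "distr_fun (indicator S) \<tau> \<le> distr_fun (\<lambda>t. c * w t) \<tau>"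
    proof (cases "\<tau> < 1")
      case False
      then have "{t \<in> {0..1}. \<bar>indicator S t :: real\<bar> > \<tau>} = {}" by (auto simp: indicator_def)
      then have "distr_fun (indicator S) \<tau> = 0" unfolding distr_fun_def by (simp only: measure_empty)
      then show ?thesis using distr_fun_nonneg[of "\<lambda>t. c * w t"] by simp
    next
      case True
      have "distr_fun (indicator S) \<tau> \<le> measure I01 S" unfolding distr_fun_def
        by (rule I01.finite_measure_mono) (use \<tau> S in \<open>auto simp: indicator_def split: if_splits\<close>)
      also have "\<dots> \<le> distr_fun w (1 / c)" using S c by simp
      also have "\<dots> = distr_fun (\<lambda>t. c * w t) 1" using distr_fun_mult_const[OF c(1), of w "1 / c"] c(1) by simp
      also have "\<dots> \<le> distr_fun (\<lambda>t. c * w t) \<tau>" unfolding distr_fun_def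
        by (rule I01.finite_measure_mono[OF _ distr_fun_measurable]) (use True in auto)
      finally show ?thesis .
    qed
  qed
  have "(\<lambda>t. indicator {0..1/2} t + indicator {1/2<..1} t :: real) \<in> carrier X"
    by (intro carrier_add half) (auto simp: sets_restrict_space_iff measure_I01_interval measure_restrict_space)
  then show ?thesis
    by (rule carrier_AE_eq(1)) (use AE_space in \<open>auto simp: indicator_def elim!: eventually_mono\<close>)
qed

lemma bounded_mem:
  assumes "f \<in> borel_measurable I01" "\<And>t. \<bar>f t\<bar> \<le> M"
  shows "f \<in> carrier X" "nrm X f \<le> M * nrm X (\<lambda>t. 1)"
  using bounded_multiple_mem[OF one_mem assms] by simp_all

lemma rad_poly_mem: "rad_poly a n \<in> carrier X"
  by (rule bounded_mem(1)[OF rad_poly_I01 rad_poly_abs_le])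

lemma multiple_rad_poly_mem: "(\<lambda>t. w t * rad_poly a n t) \<in> carrier X"
  using bounded_multiple_mem(1)[OF w_mem rad_poly_I01 rad_poly_abs_le] by (simp add: mult.commute)

lemma coefficient_bound:
  obtains B where "0 < B" "\<And>a n. sqrt (\<Sum>k<n. (a k)\<^sup>2) \<le> B * nrm X (rad_poly a n)"
proof -
  obtain C where C: "0 < C" "\<And>x. x \<in> carrier X \<Longrightarrow> (LINT t|I01. \<bar>x t\<bar>) \<le> C * nrm X x"
    using L1_embedding by blast
  show ?thesis
  proof (rule that[of "9 / 2 * C"])
    fix a n
    have "2 / 9 * sqrt (\<Sum>k<n. (a k)\<^sup>2) \<le> C * nrm X (rad_poly a n)"
      using Khinchine_rad_poly(2)[where a = a and n = n] C(2)[OF rad_poly_mem, of a n] by linarith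
    then show "sqrt (\<Sum>k<n. (a k)\<^sup>2) \<le> 9 / 2 * C * nrm X (rad_poly a n)" by simp
  qed (use C in simp)
qed

text \<open>Lower semicontinuity: a norming functional, truncated where its product with \<open>w\<close> is large, is
  continuous for the norm of \<open>X\<close> before multiplication by \<open>w\<close>.\<close>

lemma multiple_norm_open:
  assumes u0: "u0 \<in> carrier X" "(\<lambda>t. w t * u0 t) \<in> carrier X" and c: "c < nrm X (\<lambda>t. w t * u0 t)"
  obtains \<eta> where "0 < \<eta>"
    "\<And>u. u \<in> carrier X \<Longrightarrow> (\<lambda>t. w t * u t) \<in> carrier X \<Longrightarrow> nrm X (\<lambda>t. u t - u0 t) \<le> \<eta> \<Longrightarrow>
      c < nrm X (\<lambda>t. w t * u t)"
proof -
  obtain C where C: "0 < C" "\<And>x. x \<in> carrier X \<Longrightarrow> (LINT t|I01. \<bar>x t\<bar>) \<le> C * nrm X x"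
    using L1_embedding by blast
  obtain y where y: "y \<in> carrier (kothe_dual X)" "nrm (kothe_dual X) y \<le> 1"
    and cy: "c < (LINT t|I01. w t * u0 t * y t)"
    using norming_functional[OF u0(2) c] by blast
  have ym[measurable]: "y \<in> borel_measurable I01" using y by (simp add: kothe_dual_def)
  have u0m[measurable]: "u0 \<in> borel_measurable I01" by (rule carrier_measurable[OF u0(1)])
  \<comment> \<open>The cut-off makes \<open>T n * w * y\<close> bounded by \<open>n\<close>, so
    that pairing \<open>u\<close> with it is continuous in \<open>L_1\<close>, hence in X.\<close>
  define T where "T n t = (if \<bar>w t * y t\<bar> \<le> real n then 1 else 0 :: real)" for n t
  have Tm[measurable]: "T n \<in> borel_measurable I01" for n unfolding T_def by measurable
  have T1: "\<bar>T n t\<bar> \<le> 1" for n t by (simp add: T_def)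
  have "(\<lambda>n. LINT t|I01. T n t * (w t * u0 t) * y t) \<longlonglongrightarrow> (LINT t|I01. w t * u0 t * y t)"
  proof (rule integral_dominated_convergence)
    have "integrable I01 (\<lambda>t. w t * u0 t * y t)" by (rule dual_integrable[OF y(1) u0(2)])
    then show "integrable I01 (\<lambda>t. \<bar>w t * u0 t * y t\<bar>)" by simp
    show "AE t in I01. (\<lambda>n. T n t * (w t * u0 t) * y t) \<longlonglongrightarrow> w t * u0 t * y t"
    proof (rule AE_I2)
      fix t
      obtain N where N: "\<bar>w t * y t\<bar> \<le> real N" using real_arch_simple by blast
      have "T n t * (w t * u0 t) * y t = w t * u0 t * y t" if "N \<le> n" for n
        using N that by (simp add: T_def)
      then show "(\<lambda>n. T n t * (w t * u0 t) * y t) \<longlonglongrightarrow> w t * u0 t * y t"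
        by (intro tendsto_eventually) (auto simp: eventually_sequentially)
    qed
    show "AE t in I01. norm (T n t * (w t * u0 t) * y t) \<le> \<bar>w t * u0 t * y t\<bar>" for n
      by (simp add: T_def)
  qed measurable
  from order_tendstoD(1)[OF this cy] obtain n where n: "c < (LINT t|I01. T n t * (w t * u0 t) * y t)"
    by (auto simp: eventually_sequentially)
  define \<gamma> where "\<gamma> = (LINT t|I01. T n t * (w t * u0 t) * y t) - c"
  \<comment> \<open>Within this radius the pairing changes by at most \<open>\<gamma> / 2\<close>;
    \<open>real n + 1\<close> instead of \<open>real n\<close> avoids a zero denominator.\<close>
  define \<eta> where "\<eta> = \<gamma> / (2 * (real n + 1) * C)"
  have \<gamma>: "0 < \<gamma>" using n by (simp add: \<gamma>_def)
  show ?thesis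
  proof (rule that[of \<eta>])
    show "0 < \<eta>" using \<gamma> C(1) by (simp add: \<eta>_def)
    fix u assume u: "u \<in> carrier X" "(\<lambda>t. w t * u t) \<in> carrier X" "nrm X (\<lambda>t. u t - u0 t) \<le> \<eta>"
    have [measurable]: "u \<in> borel_measurable I01" by (rule carrier_measurable[OF u(1)])
    have Tu: "(\<lambda>t. T n t * (w t * v t)) \<in> carrier X" "nrm X (\<lambda>t. T n t * (w t * v t)) \<le> nrm X (\<lambda>t. w t * v t)"
      if "(\<lambda>t. w t * v t) \<in> carrier X" for v
      using bounded_multiple_mem[OF that Tm T1] by simp_all
    have intT: "integrable I01 (\<lambda>t. T n t * (w t * v t) * y t)" if "(\<lambda>t. w t * v t) \<in> carrier X" for v
      by (rule dual_integrable[OF y(1) Tu(1)[OF that]])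
    have "(LINT t|I01. T n t * (w t * u0 t) * y t) - (LINT t|I01. T n t * (w t * u t) * y t) =
        (LINT t|I01. T n t * (w t * u0 t) * y t - T n t * (w t * u t) * y t)"
      by (intro Bochner_Integration.integral_diff[symmetric] intT u0(2) u(2))
    also have "\<dots> \<le> (LINT t|I01. real n * \<bar>u t - u0 t\<bar>)"
    proof (rule integral_mono)
      show "integrable I01 (\<lambda>t. T n t * (w t * u0 t) * y t - T n t * (w t * u t) * y t)"
        by (intro Bochner_Integration.integrable_diff intT u0(2) u(2))
      show "integrable I01 (\<lambda>t. real n * \<bar>u t - u0 t\<bar>)"
        using carrier_integrable[OF carrier_diff[OF u(1) u0(1)]] by simp
      fix t
      have eq: "T n t * (w t * u0 t) * y t - T n t * (w t * u t) * y t = T n t * (w t * y t) * (u0 t - u t)"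
        by (simp add: algebra_simps)
      have "\<bar>T n t * (w t * y t)\<bar> \<le> real n" by (simp add: T_def)
      then have "\<bar>T n t * (w t * y t)\<bar> * \<bar>u0 t - u t\<bar> \<le> real n * \<bar>u0 t - u t\<bar>" by (intro mult_right_mono) auto
      then show "T n t * (w t * u0 t) * y t - T n t * (w t * u t) * y t \<le> real n * \<bar>u t - u0 t\<bar>"
        unfolding eq by (simp add: abs_mult[symmetric] abs_minus_commute)
    qed
    also have "\<dots> = real n * (LINT t|I01. \<bar>u t - u0 t\<bar>)" by simp
    also have "\<dots> \<le> real n * (C * \<eta>)"
    proof (intro mult_left_mono)
      have "C * nrm X (\<lambda>t. u t - u0 t) \<le> C * \<eta>" using u(3) C(1) by simp
      then show "(LINT t|I01. \<bar>u t - u0 t\<bar>) \<le> C * \<eta>"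
        using C(2)[OF carrier_diff[OF u(1) u0(1)]] by linarith
    qed simp
    also have "\<dots> \<le> (real n + 1) * (C * \<eta>)" using C(1) \<open>0 < \<eta>\<close> by (intro mult_right_mono) auto
    also have "\<dots> = \<gamma> / 2"
    proof -
      have scale: "q * (C * (\<gamma> / (2 * q * C))) = \<gamma> / 2" if "0 < q" for q
        using that C(1) by (simp add: field_simps)
      show ?thesis unfolding \<eta>_def by (rule scale) simp
    qed
    also have "\<dots> < \<gamma>" using \<gamma> by simp
    finally have "c < (LINT t|I01. T n t * (w t * u t) * y t)" by (simp add: \<gamma>_def)
    also have "\<dots> \<le> nrm X (\<lambda>t. T n t * (w t * u t))" by (rule dual_ball_bound[OF y Tu(1)[OF u(2)]])
    also have "\<dots> \<le> nrm X (\<lambda>t. w t * u t)" by (rule Tu(2)[OF u(2)])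
    finally show "c < nrm X (\<lambda>t. w t * u t)" .
  qed
qed

text \<open>By \<open>coefficient_bound\<close> the first \<open>m\<close> terms form a bounded
  function of size at most \<open>m B\<close> times the norm, and its product with \<open>w\<close>
  is harmless because \<open>w\<close> lies in X. A failure of boundedness can therefore be placed
  beyond any given index.\<close>

lemma bounded_on_tails_imp_bounded:
  assumes K0: "0 \<le> K0"
    and tails: "\<And>a n. (\<And>k. k < m \<Longrightarrow> a k = 0) \<Longrightarrow>
      nrm X (\<lambda>t. w t * rad_poly a n t) \<le> K0 * nrm X (rad_poly a n)"
  obtains K where "0 < K" "\<And>a n. nrm X (\<lambda>t. w t * rad_poly a n t) \<le> K * nrm X (rad_poly a n)"
proof -
  obtain B where B: "0 < B" "\<And>a n. sqrt (\<Sum>k<n. (a k)\<^sup>2) \<le> B * nrm X (rad_poly a n)"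
    using coefficient_bound by blast
  let ?one = "nrm X (\<lambda>t. 1)"
  have one: "0 \<le> ?one" and wn: "0 \<le> nrm X w" by (rule norm_nonneg, rule one_mem w_mem)+
  define K where "K = real m * B * nrm X w + K0 * (1 + real m * B * ?one) + 1"
  show ?thesis
  proof (rule that[of K])
    show "0 < K" unfolding K_def using B(1) one wn K0 by (intro add_nonneg_pos add_nonneg_nonneg mult_nonneg_nonneg) auto
    fix a n
    let ?r = "nrm X (rad_poly a n)"
    have r: "0 \<le> ?r" by (rule norm_nonneg[OF rad_poly_mem])
    define h where "h k = (if k < m then a k else 0)" for k
    define b where "b k = (if k < m then 0 else a k)" for k
    have ab: "rad_poly a n t = rad_poly h n t + rad_poly b n t" for t
      unfolding rad_poly_plus[symmetric] by (rule rad_poly_cong) (simp add: h_def b_def)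
    have ak: "\<bar>a k\<bar> \<le> B * ?r" if "k < n" for k
    proof -
      have "(a k)\<^sup>2 \<le> (\<Sum>k<n. (a k)\<^sup>2)" by (rule member_le_sum) (use that in auto)
      then have "\<bar>a k\<bar> \<le> sqrt (\<Sum>k<n. (a k)\<^sup>2)" by (metis real_sqrt_abs real_sqrt_le_iff)
      then show ?thesis using B(2)[where a = a and n = n] by linarith
    qed
    have hb: "\<bar>rad_poly h n t\<bar> \<le> real m * (B * ?r)" for t
    proof -
      have "\<bar>rad_poly h n t\<bar> \<le> (\<Sum>k<n. \<bar>h k\<bar>)" by (rule rad_poly_abs_le)
      also have "\<dots> = (\<Sum>k\<in>{..<n} \<inter> {..<m}. \<bar>a k\<bar>)" by (rule sum.mono_neutral_cong_right) (auto simp: h_def)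
      also have "\<dots> \<le> real (card ({..<n} \<inter> {..<m})) * (B * ?r)" by (rule sum_bounded_above) (use ak in auto)
      also have "\<dots> \<le> real m * (B * ?r)"
      proof (intro mult_right_mono)
        have "card ({..<n} \<inter> {..<m}) \<le> card {..<m}" by (rule card_mono) auto
        then show "real (card ({..<n} \<inter> {..<m})) \<le> real m" by simp
      qed (use B(1) r in simp)
      finally show ?thesis .
    qed
    have wh: "nrm X (\<lambda>t. w t * rad_poly h n t) \<le> real m * (B * ?r) * nrm X w"
      using bounded_multiple_mem(2)[OF w_mem rad_poly_I01 hb] by (simp add: mult.commute)
    have hn: "nrm X (rad_poly h n) \<le> real m * (B * ?r) * ?one" by (rule bounded_mem(2)[OF rad_poly_I01 hb])
    have bn: "nrm X (rad_poly b n) \<le> ?r + nrm X (rad_poly h n)"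
    proof -
      have "rad_poly b n = (\<lambda>t. rad_poly a n t - rad_poly h n t)" by (simp add: ab fun_eq_iff)
      then show ?thesis using norm_diff[OF rad_poly_mem rad_poly_mem] by simp
    qed
    have "nrm X (\<lambda>t. w t * rad_poly a n t) \<le> nrm X (\<lambda>t. w t * rad_poly h n t) + nrm X (\<lambda>t. w t * rad_poly b n t)"
      unfolding ab distrib_left by (rule norm_add[OF multiple_rad_poly_mem multiple_rad_poly_mem])
    also have "\<dots> \<le> real m * (B * ?r) * nrm X w + K0 * nrm X (rad_poly b n)"
      by (intro add_mono wh tails) (simp add: b_def)
    also have "\<dots> \<le> real m * (B * ?r) * nrm X w + K0 * (?r + real m * (B * ?r) * ?one)"
      using bn hn K0 by (intro add_left_mono mult_left_mono) auto
    also have "\<dots> \<le> K * ?r" using r by (simp add: K_def algebra_simps)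
    finally show "nrm X (\<lambda>t. w t * rad_poly a n t) \<le> K * ?r" .
  qed
qed

end

section \<open>Uniform boundedness of the multiplier and the upper l2 estimate\<close>

context unbounded_multiplier
begin

text \<open>If the ratio were unbounded, it would be unbounded on every tail, and nested balls produce a
  Rademacher sum in \<open>X\<close> whose product with \<open>w\<close> has infinite norm.\<close>

lemma multiplier_bounded_on_polynomials:
  obtains K where "0 < K" "\<And>a n. nrm X (\<lambda>t. w t * rad_poly a n t) \<le> K * nrm X (rad_poly a n)"
proof (rule ccontr)
  assume neg: "\<not> thesis"
  note bounded = that
  have bad: "\<exists>a n. (\<forall>k<m. a k = 0) \<and> K0 * nrm X (rad_poly a n) < nrm X (\<lambda>t. w t * rad_poly a n t)"
    if K0: "0 \<le> K0" for m K0
  proof (rule ccontr)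
    assume no: "\<not> ?thesis"
    have "nrm X (\<lambda>t. w t * rad_poly a n t) \<le> K0 * nrm X (rad_poly a n)" if "\<And>k. k < m \<Longrightarrow> a k = 0" for a n
      using no that by (auto simp: not_less)
    from bounded_on_tails_imp_bounded[OF K0 this] obtain K where
      "0 < K" "\<And>a n. nrm X (\<lambda>t. w t * rad_poly a n t) \<le> K * nrm X (rad_poly a n)" by blast
    then have thesis by (rule bounded)
    with neg show False ..
  qed
  \<comment> \<open>A state is a polynomial with coefficients \<open>s\<close> below
    \<open>m\<close> and a ball of radius \<open>e\<close> around it on which multiplication by
    \<open>w\<close> gives norm above \<open>j - 1\<close>. With the \<open>- 1\<close> the initial
    state is trivial.\<close>
  define inv where "inv j \<sigma> \<longleftrightarrow> (case \<sigma> of (s, m, e) \<Rightarrow>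
      (\<forall>k\<ge>m. s k = 0) \<and> j \<le> m \<and> 0 < e \<and> e \<le> (1 / 2) ^ j \<and>
      (\<forall>u\<in>carrier X. (\<lambda>t. w t * u t) \<in> carrier X \<longrightarrow> nrm X (\<lambda>t. u t - rad_poly s m t) \<le> e \<longrightarrow>
        real j - 1 < nrm X (\<lambda>t. w t * u t)))" for j :: nat and \<sigma> :: "(nat \<Rightarrow> real) \<times> nat \<times> real"
  \<comment> \<open>New coefficients appear only from index \<open>m\<close> on, and half of the
    radius is left for the later steps.\<close>
  define trans where "trans \<sigma> \<sigma>' \<longleftrightarrow> (case \<sigma> of (s, m, e) \<Rightarrow> case \<sigma>' of (s', m', e') \<Rightarrow>
      m \<le> m' \<and> (\<forall>k<m. s' k = s k) \<and> nrm X (\<lambda>t. rad_poly s' m' t - rad_poly s m t) \<le> e / 2 \<and> e' \<le> e / 2)"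
    for \<sigma> \<sigma>' :: "(nat \<Rightarrow> real) \<times> nat \<times> real"
  have "\<exists>f. \<forall>j. inv j (f j) \<and> trans (f j) (f (Suc j))"
  proof (rule dependent_nat_choice)
    have "real 0 - 1 < nrm X (\<lambda>t. w t * u t)" if "(\<lambda>t. w t * u t) \<in> carrier X" for u
      using norm_nonneg[OF that] by simp
    then have "inv 0 (\<lambda>k. 0, 0, 1)" by (simp add: inv_def)
    then show "\<exists>\<sigma>. inv 0 \<sigma>" by blast
  next
    fix \<sigma> and j :: nat
    assume I: "inv j \<sigma>"
    obtain s m e where \<sigma>: "\<sigma> = (s, m, e)" by (metis prod_cases3)
    have s: "\<And>k. m \<le> k \<Longrightarrow> s k = 0" "j \<le> m" "0 < e" "e \<le> (1 / 2) ^ j"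
      using I by (simp_all add: inv_def \<sigma>)
    define L where "L = nrm X (\<lambda>t. w t * rad_poly s m t)"
    have L: "0 \<le> L" unfolding L_def by (rule norm_nonneg[OF multiple_rad_poly_mem])
    \<comment> \<open>Rescaled to norm \<open>e / 2\<close>, the bad polynomial has a
      \<open>w\<close>-multiple of norm above \<open>j + L\<close>. Adding the old polynomial, whose
      multiple has norm \<open>L\<close>, still leaves more than \<open>j\<close>.\<close>
    have "0 \<le> 2 * (real j + L) / e" using s(3) L by simp
    from bad[OF this, of m] obtain a n where a: "\<And>k. k < m \<Longrightarrow> a k = 0"
      "2 * (real j + L) / e * nrm X (rad_poly a n) < nrm X (\<lambda>t. w t * rad_poly a n t)" by blast
    let ?r = "nrm X (rad_poly a n)"
    have "?r \<noteq> 0"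
    proof
      assume r0: "?r = 0"
      then have "AE t in I01. rad_poly a n t = 0" using norm_eq_0_iff[OF rad_poly_mem] by simp
      then have "AE t in I01. w t * rad_poly a n t = 0" by eventually_elim simp
      then have "nrm X (\<lambda>t. w t * rad_poly a n t) = 0" using norm_eq_0_iff[OF multiple_rad_poly_mem] by simp
      then show False using a(2) r0 by simp
    qed
    then have r: "0 < ?r" using norm_nonneg[OF rad_poly_mem, of a n] by linarith
    define c where "c = e / (2 * ?r)"
    have c: "0 < c" using r s(3) by (simp add: c_def)
    define b where "b k = (if k < n then c * a k else 0)" for k
    \<comment> \<open>\<open>Suc\<close> forces \<open>m\<close> to grow strictly, so that every
      index is eventually frozen.\<close>
    define m' where "m' = Suc (max m n)"
    define s' where "s' k = s k + b k" for k
    have b_poly: "rad_poly b m' t = c * rad_poly a n t" for t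
    proof -
      have "rad_poly b m' t = rad_poly b n t" by (rule rad_poly_support) (auto simp: m'_def b_def)
      also have "\<dots> = rad_poly (\<lambda>k. c * a k) n t" by (rule rad_poly_cong) (simp add: b_def)
      finally show ?thesis by (simp add: rad_poly_scale)
    qed
    have s_poly: "rad_poly s m' t = rad_poly s m t" for t
      by (rule rad_poly_support) (use s(1) in \<open>auto simp: m'_def\<close>)
    have s'_poly: "rad_poly s' m' t = rad_poly s m t + c * rad_poly a n t" for t
      unfolding s'_def rad_poly_plus s_poly b_poly ..
    have step: "nrm X (\<lambda>t. rad_poly s' m' t - rad_poly s m t) \<le> e / 2"
      using norm_scale[OF rad_poly_mem, of c a n] c r s(3) by (simp add: s'_poly c_def)
    have big: "real (Suc j) - 1 < nrm X (\<lambda>t. w t * rad_poly s' m' t)"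
    proof -
      have "real j + L = c * (2 * (real j + L) / e * ?r)" using r s(3) by (simp add: c_def)
      also have "\<dots> < c * nrm X (\<lambda>t. w t * rad_poly a n t)" by (rule mult_strict_left_mono[OF a(2) c])
      also have "\<dots> = nrm X (\<lambda>t. c * (w t * rad_poly a n t))"
        using norm_scale[OF multiple_rad_poly_mem, of c a n] c by simp
      also have "(\<lambda>t. c * (w t * rad_poly a n t)) = (\<lambda>t. w t * rad_poly s' m' t - w t * rad_poly s m t)"
        by (simp add: s'_poly algebra_simps)
      also have "nrm X \<dots> \<le> nrm X (\<lambda>t. w t * rad_poly s' m' t) + L"
        unfolding L_def by (rule norm_diff[OF multiple_rad_poly_mem multiple_rad_poly_mem])
      finally show ?thesis by simp
    qed
    obtain \<eta> where \<eta>: "0 < \<eta>"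
      "\<And>u. u \<in> carrier X \<Longrightarrow> (\<lambda>t. w t * u t) \<in> carrier X \<Longrightarrow> nrm X (\<lambda>t. u t - rad_poly s' m' t) \<le> \<eta> \<Longrightarrow>
        real (Suc j) - 1 < nrm X (\<lambda>t. w t * u t)"
      using multiple_norm_open[OF rad_poly_mem multiple_rad_poly_mem big] by blast
    define e' where "e' = min (e / 2) \<eta>"
    have "inv (Suc j) (s', m', e')"
      unfolding inv_def prod.case
    proof (intro conjI allI ballI impI)
      show "s' k = 0" if "m' \<le> k" for k using that s(1)[of k] by (simp add: s'_def b_def m'_def)
      show "Suc j \<le> m'" using s(2) by (simp add: m'_def)
      show "0 < e'" using s(3) \<eta>(1) by (simp add: e'_def)
      have "e / 2 \<le> (1 / 2) ^ Suc j" using s(4) by simp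
      then show "e' \<le> (1 / 2) ^ Suc j" unfolding e'_def by linarith
      show "real (Suc j) - 1 < nrm X (\<lambda>t. w t * u t)"
        if "u \<in> carrier X" "(\<lambda>t. w t * u t) \<in> carrier X" "nrm X (\<lambda>t. u t - rad_poly s' m' t) \<le> e'" for u
        by (rule \<eta>(2)[OF that(1,2)]) (use that(3) in \<open>simp add: e'_def\<close>)
    qed
    moreover have "trans \<sigma> (s', m', e')"
      using step a(1) by (auto simp: trans_def \<sigma> m'_def e'_def s'_def b_def)
    ultimately show "\<exists>\<sigma>'. inv (Suc j) \<sigma>' \<and> trans \<sigma> \<sigma>'" by blast
  qed
  then obtain f where f: "\<And>j. inv j (f j)" "\<And>j. trans (f j) (f (Suc j))" by blast
  define s where "s j = fst (f j)" for j
  define m where "m j = fst (snd (f j))" for j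
  define e where "e j = snd (snd (f j))" for j
  have fj: "f j = (s j, m j, e j)" for j by (simp add: s_def m_def e_def)
  have m: "j \<le> m j" "m j \<le> m (Suc j)" and e: "0 < e j" "e j \<le> (1 / 2) ^ j" "e (Suc j) \<le> e j / 2"
    and s: "\<forall>k\<ge>m j. s j k = 0" "\<forall>k<m j. s (Suc j) k = s j k"
    and step: "nrm X (\<lambda>t. rad_poly (s (Suc j)) (m (Suc j)) t - rad_poly (s j) (m j) t) \<le> e j / 2" for j
    using f(1)[of j] f(2)[of j] by (simp_all add: inv_def trans_def fj)
  have ball: "real j - 1 < nrm X (\<lambda>t. w t * u t)"
    if "u \<in> carrier X" "(\<lambda>t. w t * u t) \<in> carrier X" "nrm X (\<lambda>t. u t - rad_poly (s j) (m j) t) \<le> e j" for u j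
    using f(1)[of j] that by (simp add: inv_def fj)
  have m_mono: "m i \<le> m j" if "i \<le> j" for i j using lift_Suc_mono_le[of m, OF m(2) that] .
  have stable: "s (i + d) k = s i k" if "k < m i" for i d k
  proof (induction d)
    case (Suc d)
    have "k < m (i + d)" using that m_mono[of i "i + d"] by simp
    then show ?case using s(2)[of "i + d"] Suc by simp
  qed simp
  \<comment> \<open>Since \<open>k < m (Suc k)\<close>, the coefficient of index \<open>k\<close> no
    longer changes after step \<open>Suc k\<close>.\<close>
  define a where "a k = s (Suc k) k" for k
  have sa: "s j k = a k" if k: "k < m j" for j k
  proof (cases "j \<le> Suc k")
    case True
    then show ?thesis using stable[OF k, of "Suc k - j"] by (simp add: a_def)
  next
    case False
    have "k < m (Suc k)" using m(1)[of "Suc k"] by simp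
    then show ?thesis using stable[of k "Suc k" "j - Suc k"] False by (simp add: a_def)
  qed
  define u where "u j = rad_poly a (m j)" for j
  have us: "rad_poly (s j) (m j) t = u j t" for j t
    unfolding u_def by (rule rad_poly_cong) (rule sa)
  have u_mem: "u j \<in> carrier X" for j unfolding u_def by (rule rad_poly_mem)
  have u_step: "nrm X (\<lambda>t. u (Suc j) t - u j t) \<le> e j / 2" for j using step[of j] by (simp only: us)
  obtain x where x: "x \<in> carrier X" "(\<lambda>n. nrm X (\<lambda>t. u n t - x t)) \<longlonglongrightarrow> 0"
  proof (rule geometric_complete[OF u_mem])
    fix j
    have "e j / 2 \<le> (1 / 2) ^ j" using e(1)[of j] e(2)[of j] by linarith
    then show "nrm X (\<lambda>t. u (Suc j) t - u j t) \<le> (1 / 2) ^ j" using u_step[of j] by linarith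
  qed
  \<comment> \<open>Telescoping: each step moves by at most \<open>e j / 2\<close>, and
    \<open>e j / 2 \<le> e j - e (Suc j)\<close>. The limit \<open>x\<close> therefore stays in
    every ball.\<close>
  have far: "nrm X (\<lambda>t. u (j + d) t - u j t) \<le> e j - e (j + d)" for j d
  proof (induction d)
    case 0
    then show ?case using norm_eq_0_iff[OF carrier_zero] by simp
  next
    case (Suc d)
    have "nrm X (\<lambda>t. u (j + Suc d) t - u j t) \<le>
        nrm X (\<lambda>t. u (j + Suc d) t - u (j + d) t) + nrm X (\<lambda>t. u (j + d) t - u j t)"
      by (rule norm_triangle[OF u_mem u_mem u_mem])
    then show ?case using Suc u_step[of "j + d"] e(3)[of "j + d"] by simp
  qed
  have near: "nrm X (\<lambda>t. x t - u j t) \<le> e j" for j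
  proof -
    have "nrm X (\<lambda>t. x t - u j t) - e j \<le> nrm X (\<lambda>t. u n t - x t)" if "j \<le> n" for n
    proof -
      have "nrm X (\<lambda>t. x t - u j t) \<le> nrm X (\<lambda>t. x t - u n t) + nrm X (\<lambda>t. u n t - u j t)"
        by (rule norm_triangle[OF x(1) u_mem u_mem])
      moreover have "nrm X (\<lambda>t. u n t - u j t) \<le> e j"
        using far[of j "n - j"] that e(1)[of n] by simp
      ultimately show ?thesis using norm_diff_commute[OF x(1) u_mem, of n] by linarith
    qed
    then have "nrm X (\<lambda>t. x t - u j t) - e j \<le> 0" by (intro LIMSEQ_le_const[OF x(2)]) blast
    then show ?thesis by simp
  qed
  \<comment> \<open>Bounded norms keep the coefficients square summable, so \<open>x\<close> is the
    Rademacher sum of \<open>a\<close> almost everywhere and the multiplier property applies to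
    it.\<close>
  obtain B where B: "0 < B" "\<And>a n. sqrt (\<Sum>k<n. (a k)\<^sup>2) \<le> B * nrm X (rad_poly a n)"
    using coefficient_bound by blast
  have "(\<Sum>k<n. (a k)\<^sup>2) \<le> (B * (nrm X (u 0) + e 0))\<^sup>2" for n
  proof -
    have "nrm X (u n) \<le> nrm X (u 0) + nrm X (\<lambda>t. u n t - u 0 t)" by (rule norm_le_add_diff[OF u_mem u_mem])
    also have "\<dots> \<le> nrm X (u 0) + e 0" using far[of 0 n] e(1)[of n] by simp
    finally have un: "nrm X (u n) \<le> nrm X (u 0) + e 0" .
    have "(\<Sum>k<n. (a k)\<^sup>2) \<le> (\<Sum>k<m n. (a k)\<^sup>2)" by (rule sum_mono2) (use m(1)[of n] in auto)
    then have "sqrt (\<Sum>k<n. (a k)\<^sup>2) \<le> sqrt (\<Sum>k<m n. (a k)\<^sup>2)" by simp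
    also have "\<dots> \<le> B * nrm X (u n)" unfolding u_def by (rule B(2))
    also have "\<dots> \<le> B * (nrm X (u 0) + e 0)" using un B(1) by simp
    finally show ?thesis by (rule sqrt_le_D)
  qed
  then have "(\<Sum>k\<le>n. (a k)\<^sup>2) \<le> (B * (nrm X (u 0) + e 0))\<^sup>2" for n
    unfolding lessThan_Suc_atMost[symmetric] .
  then have "summable (\<lambda>k. (a k)\<^sup>2)"
    by (intro bounded_imp_summable[where B = "(B * (nrm X (u 0) + e 0))\<^sup>2"]) simp_all
  then have conv: "rademacher_convergent a" by (intro ell2_rademacher_convergent) (simp add: ell2_def)
  have m_lim: "filterlim m at_top sequentially"
    by (rule filterlim_at_top_mono[OF filterlim_ident]) (simp add: m(1))
  have "AE t in I01. (\<lambda>j. u j t) \<longlonglongrightarrow> rademacher_sum a t"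
    using rademacher_convergent_tendsto[OF conv]
  proof eventually_elim
    case (elim t)
    then show ?case unfolding u_def by (rule filterlim_compose[OF _ m_lim])
  qed
  from norm_limit_AE_eq[OF u_mem x this] have eq: "AE t in I01. rademacher_sum a t = x t" .
  have rm: "rademacher_sum a \<in> borel_measurable I01" by (rule borel_measurable_I01) measurable
  have "rademacher_sum a \<in> carrier X" by (rule carrier_AE_eq(1)[OF x(1) rm eq])
  then have wr: "(\<lambda>t. w t * rademacher_sum a t) \<in> carrier X" using multiplier conv by (simp add: multiplicator_def)
  have [measurable]: "x \<in> borel_measurable I01" by (rule carrier_measurable[OF x(1)])
  have wx: "(\<lambda>t. w t * x t) \<in> carrier X"
  proof (rule carrier_AE_eq(1)[OF wr])
    show "AE t in I01. w t * x t = w t * rademacher_sum a t" using eq by eventually_elim simp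
  qed measurable
  have "real j - 1 < nrm X (\<lambda>t. w t * x t)" for j
    by (rule ball[OF x(1) wx]) (simp only: us near)
  moreover obtain j :: nat where "nrm X (\<lambda>t. w t * x t) + 1 \<le> real j" using real_arch_simple by blast
  ultimately show False by (smt (verit))
qed

lemma rad_poly_norm_le_normalized:
  assumes K: "0 < K" "\<And>a n. nrm X (\<lambda>t. w t * rad_poly a n t) \<le> K * nrm X (rad_poly a n)"
    and \<delta>: "\<delta> = distr_fun w (6 * K)" and a: "(\<Sum>k<n. (a k)\<^sup>2) \<le> 1"
  shows "nrm X (rad_poly a n) \<le> 6 * sqrt (8 / \<delta>) * nrm X (\<lambda>t. 1)"
proof -
  define D where "D = {t \<in> {0..1}. \<bar>w t\<bar> > 6 * K}"
  have D: "D \<in> sets I01" unfolding D_def by (rule distr_fun_measurable[OF w_measurable])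
  have \<delta>D: "\<delta> = measure I01 D" by (simp add: \<delta> D_def distr_fun_def)
  have \<delta>0: "0 < \<delta>" unfolding \<delta> by (rule w_unbounded)
  have \<delta>1: "\<delta> \<le> 1" unfolding \<delta> by (rule distr_fun_le_1)
  \<comment> \<open>For \<open>\<tau> \<ge> r\<close> Chebyshev gives a tail
    \<open>p \<le> \<delta> / 8\<close>, so the Hoffmann-Jorgensen bound \<open>4 p^2\<close> is at
    most \<open>\<delta> / 2 * p\<close>, which is what \<open>h\<close> retains. Also
    \<open>r \<ge> 1\<close> makes all coefficients at most \<open>\<tau>\<close>.\<close>
  define r where "r = sqrt (8 / \<delta>)"
  have r2: "r\<^sup>2 = 8 / \<delta>" using \<delta>0 by (simp add: r_def)
  have r: "1 \<le> r" using \<delta>0 \<delta>1 by (simp add: r_def)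
  obtain m where m: "\<And>\<tau>. \<delta> / 2 * distr_fun (rad_poly a n) \<tau> \<le> measure I01 {t \<in> D. \<bar>rad_poly a n (2 ^ m * t)\<bar> > \<tau>}"
    using rad_poly_mixing[OF D, of a n] \<delta>0 unfolding \<delta>D by blast
  define a' where "a' = (\<lambda>k. if k < m then 0 else a (k - m))"
  have a': "rad_poly a' (m + n) t = rad_poly a n (2 ^ m * t)" for t unfolding a'_def by (rule rad_poly_delay)
  define h where "h t = indicator D t * rad_poly a' (m + n) t" for t
  have [measurable]: "D \<in> sets I01" by (rule D)
  have hm[measurable]: "h \<in> borel_measurable I01" unfolding h_def by measurable
  have wa': "(\<lambda>t. 1 / (6 * K) * (w t * rad_poly a' (m + n) t)) \<in> carrier X"
    by (rule carrier_scale[OF multiple_rad_poly_mem])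
  have h_le: "AE t in I01. \<bar>h t\<bar> \<le> \<bar>1 / (6 * K) * (w t * rad_poly a' (m + n) t)\<bar>"
  proof (rule AE_I2)
    fix t
    show "\<bar>h t\<bar> \<le> \<bar>1 / (6 * K) * (w t * rad_poly a' (m + n) t)\<bar>"
    proof (cases "t \<in> D")
      case True
      then have "6 * K * \<bar>rad_poly a' (m + n) t\<bar> \<le> \<bar>w t\<bar> * \<bar>rad_poly a' (m + n) t\<bar>"
        by (intro mult_right_mono) (auto simp: D_def)
      then show ?thesis using True K(1) by (simp add: h_def abs_mult field_simps)
    qed (simp add: h_def)
  qed
  have h_mem: "h \<in> carrier X" by (rule carrier_AE_le(1)[OF wa' hm h_le])
  have "nrm X h \<le> nrm X (\<lambda>t. 1 / (6 * K) * (w t * rad_poly a' (m + n) t))"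
    by (rule carrier_AE_le(2)[OF wa' hm h_le])
  also have "\<dots> = 1 / (6 * K) * nrm X (\<lambda>t. w t * rad_poly a' (m + n) t)"
    using norm_scale[OF multiple_rad_poly_mem, of "1 / (6 * K)"] K(1) by simp
  also have "\<dots> \<le> 1 / (6 * K) * (K * nrm X (rad_poly a' (m + n)))"
    using K by (intro mult_left_mono) auto
  also have "\<dots> = nrm X (rad_poly a' (m + n)) / 6" using K(1) by simp
  also have "nrm X (rad_poly a' (m + n)) \<le> nrm X (rad_poly a n)"
  proof (rule carrier_distr_fun_le(2)[OF rad_poly_mem rad_poly_I01])
    fix \<tau>
    have "rad_poly a' (m + n) = (\<lambda>t. rad_poly a n (2 ^ m * t))" by (simp add: a' fun_eq_iff)
    then show "distr_fun (rad_poly a' (m + n)) \<tau> \<le> distr_fun (rad_poly a n) \<tau>"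
      by (simp add: distr_fun_rad_poly_dilate distr_fun_rad_poly)
  qed
  finally have hn: "nrm X h \<le> nrm X (rad_poly a n) / 6" by simp
  have h_distr: "\<delta> / 2 * distr_fun (rad_poly a n) \<tau> \<le> distr_fun h \<tau>" for \<tau>
  proof -
    have "measure I01 {t \<in> D. \<bar>rad_poly a n (2 ^ m * t)\<bar> > \<tau>} \<le> distr_fun h \<tau>" unfolding distr_fun_def
      by (rule I01.finite_measure_mono[OF _ distr_fun_measurable[OF hm]]) (auto simp: h_def a' D_def)
    then show ?thesis using m[of \<tau>] by linarith
  qed
  have tail: "distr_fun (rad_poly a n) (3 * \<tau>) \<le> distr_fun h \<tau>" if \<tau>: "r \<le> \<tau>" for \<tau>
  proof -
    let ?p = "distr_fun (rad_poly a n) \<tau>"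
    have \<tau>0: "0 < \<tau>" "1 \<le> \<tau>" using \<tau> r by auto
    have coef: "\<forall>x\<in>set (map a [0..<n]). \<bar>x\<bar> \<le> \<tau>"
    proof
      fix x assume "x \<in> set (map a [0..<n])"
      then obtain k where k: "k < n" "x = a k" by auto
      have "(a k)\<^sup>2 \<le> (\<Sum>k<n. (a k)\<^sup>2)" by (rule member_le_sum) (use k in auto)
      then have "(a k)\<^sup>2 \<le> 1\<^sup>2" using a by simp
      then have "\<bar>a k\<bar> \<le> 1" by (simp only: abs_le_square_iff[symmetric] abs_one)
      then show "\<bar>x\<bar> \<le> \<tau>" using k(2) \<tau>0(2) by simp
    qed
    have "distr_fun (rad_poly a n) (3 * \<tau>) \<le> 4 * ?p\<^sup>2"
      unfolding distr_fun_rad_poly using coef \<tau>0 by (intro Hoffmann_Jorgensen_sign) auto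
    also have "\<dots> \<le> \<delta> / 2 * ?p"
    proof -
      have "?p \<le> (\<Sum>k<n. (a k)\<^sup>2) / \<tau>\<^sup>2"
        unfolding distr_fun_rad_poly using sign_tail_Chebyshev[OF \<tau>0(1), of "map a [0..<n]"]
        unfolding sum_list_squares_map .
      also have "\<dots> \<le> 1 / r\<^sup>2"
        using a \<tau> r by (intro frac_le) (auto simp: power_mono)
      also have "\<dots> = \<delta> / 8" using \<delta>0 by (simp add: r2)
      finally have "4 * (?p * ?p) \<le> 4 * (\<delta> / 8 * ?p)" by (intro mult_left_mono mult_right_mono distr_fun_nonneg) auto
      then show ?thesis by (simp add: power2_eq_square)
    qed
    also have "\<dots> \<le> distr_fun h \<tau>" by (rule h_distr)
    finally show ?thesis .
  qed
  have base: "(\<lambda>t. r * 1) \<in> carrier X" by (rule carrier_scale[OF one_mem])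
  \<comment> \<open>Below \<open>3 r\<close> the constant part of \<open>z\<close> makes its
    distribution function equal to 1; from \<open>3 r\<close> on, \<open>tail\<close> applies at
    \<open>\<tau> / 3\<close>.\<close>
  define z where "z t = 3 * (r * 1 + \<bar>h t\<bar>)" for t
  have z_mem: "z \<in> carrier X" unfolding z_def
    by (intro carrier_scale carrier_add base carrier_abs(1) h_mem)
  have zm: "z \<in> borel_measurable I01" by (rule carrier_measurable[OF z_mem])
  have zn: "nrm X z \<le> 3 * (r * nrm X (\<lambda>t. 1) + nrm X h)"
  proof -
    have "nrm X z = 3 * nrm X (\<lambda>t. r * 1 + \<bar>h t\<bar>)"
      using norm_scale[OF carrier_add[OF base carrier_abs(1)[OF h_mem]], of 3] unfolding z_def by simp
    also have "nrm X (\<lambda>t. r * 1 + \<bar>h t\<bar>) \<le> nrm X (\<lambda>t. r * 1) + nrm X (\<lambda>t. \<bar>h t\<bar>)"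
      by (rule norm_add[OF base carrier_abs(1)[OF h_mem]])
    also have "nrm X (\<lambda>t. r * 1) = r * nrm X (\<lambda>t. 1)" using norm_scale[OF one_mem, of r] r by simp
    finally show ?thesis using carrier_abs(2)[OF h_mem] by simp
  qed
  have "nrm X (rad_poly a n) \<le> nrm X z"
  proof (rule carrier_distr_fun_le(2)[OF z_mem rad_poly_I01])
    fix \<tau> :: real
    show "distr_fun (rad_poly a n) \<tau> \<le> distr_fun z \<tau>"
    proof (cases "\<tau> < 3 * r")
      case True
      then have "{t \<in> {0..1}. \<bar>z t\<bar> > \<tau>} = {0..1}" using r by (auto simp: z_def)
      then have "distr_fun z \<tau> = 1" by (simp add: distr_fun_def)
      then show ?thesis using distr_fun_le_1 by simp
    next
      case False
      then have "distr_fun (rad_poly a n) (3 * (\<tau> / 3)) \<le> distr_fun h (\<tau> / 3)" by (intro tail) simp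
      also have "\<dots> \<le> distr_fun z \<tau>" unfolding distr_fun_def
        by (rule I01.finite_measure_mono[OF _ distr_fun_measurable[OF zm]]) (use r in \<open>auto simp: z_def\<close>)
      finally show ?thesis by simp
    qed
  qed
  \<comment> \<open>The term \<open>3 * nrm X h\<close> is at most half of the norm on the left and
    is absorbed there.\<close>
  then have "nrm X (rad_poly a n) \<le> 6 * r * nrm X (\<lambda>t. 1)"
    using zn hn unfolding distrib_left mult.assoc by linarith
  then show ?thesis by (simp add: r_def)
qed

lemma rad_poly_norm_le_ell2:
  obtains C where "0 < C" "\<And>a n. nrm X (rad_poly a n) \<le> C * sqrt (\<Sum>k<n. (a k)\<^sup>2)"
proof -
  obtain K where K: "0 < K" "\<And>a n. nrm X (\<lambda>t. w t * rad_poly a n t) \<le> K * nrm X (rad_poly a n)"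
    using multiplier_bounded_on_polynomials by blast
  define C where "C = 6 * sqrt (8 / distr_fun w (6 * K)) * nrm X (\<lambda>t. 1) + 1"
  have C0: "0 \<le> 6 * sqrt (8 / distr_fun w (6 * K)) * nrm X (\<lambda>t. 1)"
    using norm_nonneg[OF one_mem] w_unbounded[of "6 * K"] by simp
  show ?thesis
  proof (rule that[of C])
    show "0 < C" using C0 unfolding C_def by linarith
    fix a :: "nat \<Rightarrow> real" and n
    define v where "v = sqrt (\<Sum>k<n. (a k)\<^sup>2)"
    have v2: "v\<^sup>2 = (\<Sum>k<n. (a k)\<^sup>2)" unfolding v_def by (rule real_sqrt_pow2) (simp add: sum_nonneg)
    have v0: "0 \<le> v" by (simp add: v_def sum_nonneg)
    show "nrm X (rad_poly a n) \<le> C * sqrt (\<Sum>k<n. (a k)\<^sup>2)"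
    proof (cases "v = 0")
      case True
      then have "(\<Sum>k<n. (a k)\<^sup>2) = 0" using v2 by simp
      then have "\<forall>k<n. a k = 0" by (subst (asm) sum_nonneg_eq_0_iff) auto
      then have "rad_poly a n = (\<lambda>t. 0)" by (simp add: rad_poly_def fun_eq_iff)
      then have "nrm X (rad_poly a n) = 0" using norm_eq_0_iff[OF carrier_zero] by simp
      then show ?thesis using True by (simp add: v_def)
    next
      case False
      then have v: "0 < v" using v0 by simp
      have "(\<Sum>k<n. (1 / v * a k)\<^sup>2) = (1 / v)\<^sup>2 * (\<Sum>k<n. (a k)\<^sup>2)"
        by (simp only: power_mult_distrib sum_distrib_left)
      also have "\<dots> = 1" using v by (simp add: v2[symmetric] power_divide)
      finally have "nrm X (rad_poly (\<lambda>k. 1 / v * a k) n) \<le> C"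
        using rad_poly_norm_le_normalized[OF K refl, where n = n and a = "\<lambda>k. 1 / v * a k"] by (simp add: C_def)
      moreover have "rad_poly (\<lambda>k. 1 / v * a k) n = (\<lambda>t. 1 / v * rad_poly a n t)"
        by (simp only: rad_poly_scale fun_eq_iff) simp
      ultimately have "1 / v * nrm X (rad_poly a n) \<le> C"
        using norm_scale[OF rad_poly_mem, of "1 / v" a n] v by simp
      then show ?thesis using v by (simp add: v_def[symmetric] field_simps)
    qed
  qed
qed

end

section \<open>Rademacher sums in the weighted space\<close>

context unbounded_multiplier
begin

lemma multiple_rad_poly_norm_le_ell2:
  obtains C where "0 < C" "\<And>a n. nrm X (\<lambda>t. w t * rad_poly a n t) \<le> C * sqrt (\<Sum>k<n. (a k)\<^sup>2)"
proof -
  obtain K where K: "0 < K" "\<And>a n. nrm X (\<lambda>t. w t * rad_poly a n t) \<le> K * nrm X (rad_poly a n)"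
    using multiplier_bounded_on_polynomials by blast
  obtain C where C: "0 < C" "\<And>a n. nrm X (rad_poly a n) \<le> C * sqrt (\<Sum>k<n. (a k)\<^sup>2)"
    using rad_poly_norm_le_ell2 by blast
  show ?thesis
  proof (rule that[of "K * C"])
    fix a n
    have "K * nrm X (rad_poly a n) \<le> K * (C * sqrt (\<Sum>k<n. (a k)\<^sup>2))"
      using C(2)[where a = a and n = n] K(1) by (intro mult_left_mono) auto
    then show "nrm X (\<lambda>t. w t * rad_poly a n t) \<le> K * C * sqrt (\<Sum>k<n. (a k)\<^sup>2)"
      using K(2)[of a n] by (simp add: mult.assoc)
  qed (use K C in simp)
qed

lemma multiple_rademacher_sum:
  assumes a: "a \<in> ell2"
  shows "(\<lambda>t. w t * rademacher_sum a t) \<in> carrier X"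
    and "(\<lambda>n. nrm X (\<lambda>t. w t * rad_poly a n t)) \<longlonglongrightarrow> nrm X (\<lambda>t. w t * rademacher_sum a t)"
proof -
  obtain C where C: "0 < C" "\<And>a n. nrm X (\<lambda>t. w t * rad_poly a n t) \<le> C * sqrt (\<Sum>k<n. (a k)\<^sup>2)"
    using multiple_rad_poly_norm_le_ell2 by blast
  let ?u = "\<lambda>n t. w t * rad_poly a n t"
  have u: "?u n \<in> carrier X" for n by (rule multiple_rad_poly_mem)
  obtain x where x: "x \<in> carrier X" "(\<lambda>n. nrm X (\<lambda>t. ?u n t - x t)) \<longlonglongrightarrow> 0"
  proof (rule norm_complete[OF u])
    fix e :: real assume e: "0 < e"
    define d where "d = e / (3 * C)"
    have d: "0 < d" using e C(1) by (simp add: d_def)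
    then have "0 < d\<^sup>2" by simp
    from ell2_tail_small[OF a this] obtain m where m: "\<And>n. (\<Sum>k<n. (a (m + k))\<^sup>2) \<le> d\<^sup>2" by blast
    have close: "nrm X (\<lambda>t. ?u n t - ?u m t) \<le> e / 3" if n: "m \<le> n" for n
    proof -
      \<comment> \<open>Delaying the coefficients by \<open>m\<close> writes the difference of two
        partial sums as one polynomial, to which the uniform estimate applies.\<close>
      define b where "b = (\<lambda>k. if k < m then 0 else a (m + (k - m)))"
      have "(\<lambda>t. ?u n t - ?u m t) = (\<lambda>t. w t * rad_poly b (m + (n - m)) t)"
        using n rad_poly_add[of a m "n - m"] rad_poly_delay[of m "\<lambda>k. a (m + k)" "n - m"]
        by (simp add: b_def fun_eq_iff algebra_simps)
      moreover have "(\<Sum>k<m + j. (b k)\<^sup>2) = (\<Sum>k<j. (a (m + k))\<^sup>2)" for j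
        by (induction j) (simp_all add: b_def)
      ultimately have "nrm X (\<lambda>t. ?u n t - ?u m t) \<le> C * sqrt (\<Sum>k<n - m. (a (m + k))\<^sup>2)"
        using C(2)[of b "m + (n - m)"] by simp
      also have "\<dots> \<le> C * sqrt (d\<^sup>2)"
        using m[of "n - m"] C(1) by (intro mult_left_mono real_sqrt_le_mono) auto
      also have "\<dots> = e / 3" using e C(1) by (simp add: d_def)
      finally show ?thesis .
    qed
    have "nrm X (\<lambda>t. ?u p t - ?u q t) < e" if "m \<le> p" "m \<le> q" for p q
      using norm_triangle[OF u u u, of p q m] close[OF that(1)] close[OF that(2)]
        norm_diff_commute[OF u u, of m q] e by linarith
    then show "\<exists>N. \<forall>m\<ge>N. \<forall>n\<ge>N. nrm X (\<lambda>t. ?u m t - ?u n t) < e" by blast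
  qed
  have "AE t in I01. (\<lambda>n. ?u n t) \<longlonglongrightarrow> w t * rademacher_sum a t"
    using rademacher_convergent_tendsto[OF ell2_rademacher_convergent[OF a]]
    by eventually_elim (rule tendsto_mult_left)
  from norm_limit_AE_eq[OF u x this]
  have eq: "AE t in I01. w t * rademacher_sum a t = x t" .
  have [measurable]: "rademacher_sum a \<in> borel_measurable I01" by (rule borel_measurable_I01) measurable
  have m: "(\<lambda>t. w t * rademacher_sum a t) \<in> borel_measurable I01" by measurable
  show "(\<lambda>t. w t * rademacher_sum a t) \<in> carrier X" by (rule carrier_AE_eq(1)[OF x(1) m eq])
  show "(\<lambda>n. nrm X (?u n)) \<longlonglongrightarrow> nrm X (\<lambda>t. w t * rademacher_sum a t)"
    unfolding carrier_AE_eq(2)[OF x(1) m eq] by (rule norm_tendsto[OF u x])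
qed

text \<open>For the lower estimate, the inclusion in \<open>L_one\<close> says that integration
  against \<open>1 / w\<close> is finite on X, hence bounded. Applied to \<open>w R\<close> it
  returns the \<open>L_1\<close> norm of \<open>R\<close>, where Khinchine's inequality
  applies.\<close>

lemma rademacher_span_weighted:
  assumes emb: "carrier (weighted X w) \<subseteq> L_one"
  shows "rademacher_span_ell2 (weighted X w)"
proof -
  obtain C where C: "0 < C" "\<And>a n. nrm X (\<lambda>t. w t * rad_poly a n t) \<le> C * sqrt (\<Sum>k<n. (a k)\<^sup>2)"
    using multiple_rad_poly_norm_le_ell2 by blast
  have inv_m: "(\<lambda>t. 1 / w t) \<in> borel_measurable I01" by measurable
  have inv: "integrable I01 (\<lambda>t. x t * (1 / w t))" if x: "x \<in> carrier X" for x
  proof -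
    have [measurable]: "x \<in> borel_measurable I01" by (rule carrier_measurable[OF x])
    have "(\<lambda>t. x t * (1 / w t) * w t) \<in> carrier X"
    proof (rule carrier_AE_eq(1)[OF x])
      show "AE t in I01. x t * (1 / w t) * w t = x t" using w_pos by eventually_elim simp
    qed measurable
    then have "(\<lambda>t. x t * (1 / w t)) \<in> carrier (weighted X w)" by (simp add: weighted_def)
    then show ?thesis using emb by (auto simp: L_one_def)
  qed
  obtain D where D: "0 < D" "\<And>x. x \<in> carrier X \<Longrightarrow> (LINT t|I01. \<bar>x t * (1 / w t)\<bar>) \<le> D * nrm X x"
    using integral_functional_bounded[OF inv_m inv] by blast
  have low: "2 / (9 * D) * sqrt (\<Sum>k<n. (a k)\<^sup>2) \<le> nrm X (\<lambda>t. w t * rad_poly a n t)" for a n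
  proof -
    have "(LINT t|I01. \<bar>rad_poly a n t\<bar>) = (LINT t|I01. \<bar>w t * rad_poly a n t * (1 / w t)\<bar>)"
    proof (rule integral_cong_AE)
      show "AE t in I01. \<bar>rad_poly a n t\<bar> = \<bar>w t * rad_poly a n t * (1 / w t)\<bar>"
        using w_pos by eventually_elim simp
    qed measurable
    then have "2 / 9 * sqrt (\<Sum>k<n. (a k)\<^sup>2) \<le> D * nrm X (\<lambda>t. w t * rad_poly a n t)"
      using Khinchine_rad_poly(2)[where a = a and n = n] D(2)[OF multiple_rad_poly_mem, of a n] by linarith
    then show ?thesis using D(1) by (simp add: field_simps)
  qed
  have "rademacher_convergent a \<and> rademacher_sum a \<in> carrier (weighted X w) \<and>
      2 / (9 * D) * ell2_norm a \<le> nrm (weighted X w) (rademacher_sum a) \<and>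
      nrm (weighted X w) (rademacher_sum a) \<le> C * ell2_norm a" if a: "a \<in> ell2" for a
  proof -
    have nrm_eq: "nrm (weighted X w) (rademacher_sum a) = nrm X (\<lambda>t. w t * rademacher_sum a t)"
      by (simp add: weighted_def mult.commute)
    have rm: "rademacher_sum a \<in> borel_measurable I01" by (rule borel_measurable_I01) measurable
    have mem: "rademacher_sum a \<in> carrier (weighted X w)"
      using multiple_rademacher_sum(1)[OF a] rm by (simp add: weighted_def mult.commute)
    note lim = multiple_rademacher_sum(2)[OF a]
    have "(\<lambda>n. \<Sum>k<n. (a k)\<^sup>2) \<longlonglongrightarrow> (\<Sum>k. (a k)\<^sup>2)" using a by (simp add: ell2_def summable_LIMSEQ)
    then have l2: "(\<lambda>n. c * sqrt (\<Sum>k<n. (a k)\<^sup>2)) \<longlonglongrightarrow> c * ell2_norm a" for c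
      unfolding ell2_norm_def by (intro tendsto_intros)
    have "2 / (9 * D) * ell2_norm a \<le> nrm X (\<lambda>t. w t * rademacher_sum a t)"
      by (rule LIMSEQ_le[OF l2 lim]) (use low in blast)
    moreover have "nrm X (\<lambda>t. w t * rademacher_sum a t) \<le> C * ell2_norm a"
      by (rule LIMSEQ_le[OF lim l2]) (use C(2) in blast)
    ultimately show ?thesis using mem ell2_rademacher_convergent[OF a] by (simp add: nrm_eq)
  qed
  moreover have "0 < 2 / (9 * D)" using D(1) by simp
  ultimately show ?thesis unfolding rademacher_span_ell2_def using C(1) by blast
qed

end

section \<open>Exponential integrability from Gaussian tails\<close>

lemma exp_square_integrable:
  fixes f :: "real \<Rightarrow> real"
  assumes f[measurable]: "f \<in> borel_measurable I01" and \<mu>: "0 < \<mu>"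
    and tail: "\<And>\<tau>. 0 \<le> \<tau> \<Longrightarrow> distr_fun f \<tau> \<le> C * exp (- ((2 * \<mu> + 1) * \<tau>\<^sup>2))"
  shows "(\<integral>\<^sup>+ t. ennreal (exp (\<mu> * (f t)\<^sup>2)) \<partial>I01) < \<infinity>"
proof -
  define c where "c n = exp (\<mu> * (real n + 1)\<^sup>2)" for n :: nat
  let ?S = "\<lambda>n::nat. {t \<in> {0..1}. \<bar>f t\<bar> > real n}"
  have S: "?S n \<in> sets I01" for n by (rule distr_fun_measurable[OF f])
  have C0: "0 \<le> C" using tail[of 0] distr_fun_nonneg[of f 0] by simp
  have "(\<integral>\<^sup>+ t. ennreal (exp (\<mu> * (f t)\<^sup>2)) \<partial>I01) \<le>
      (\<integral>\<^sup>+ t. 1 + (\<Sum>n. ennreal (c n) * indicator (?S n) t) \<partial>I01)"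
  proof (rule nn_integral_mono)
    fix t assume t: "t \<in> space I01"
    show "ennreal (exp (\<mu> * (f t)\<^sup>2)) \<le> 1 + (\<Sum>n. ennreal (c n) * indicator (?S n) t)"
    proof (cases "f t = 0")
      case False
      define n where "n = nat (\<lceil>\<bar>f t\<bar>\<rceil> - 1)"
      have pos: "1 \<le> \<lceil>\<bar>f t\<bar>\<rceil>" using False by (simp add: one_le_ceiling)
      have n: "real n < \<bar>f t\<bar>" "\<bar>f t\<bar> \<le> real n + 1" using pos unfolding n_def by linarith+
      have "(f t)\<^sup>2 \<le> (real n + 1)\<^sup>2" using n(2) by (simp add: abs_le_square_iff[symmetric])
      then have "exp (\<mu> * (f t)\<^sup>2) \<le> c n" using \<mu> by (simp add: c_def)
      then have "ennreal (exp (\<mu> * (f t)\<^sup>2)) \<le> ennreal (c n) * indicator (?S n) t"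
        using n(1) t by (simp add: ennreal_leI)
      also have "\<dots> \<le> (\<Sum>n. ennreal (c n) * indicator (?S n) t)"
      proof -
        have "(\<Sum>n\<in>{n}. ennreal (c n) * indicator (?S n) t) \<le> (\<Sum>n. ennreal (c n) * indicator (?S n) t)"
          by (rule sum_le_suminf) simp_all
        then show ?thesis
          by (simp only: sum.insert finite.emptyI empty_iff not_False_eq_True sum.empty add_0_right)
      qed
      also have "\<dots> \<le> 1 + (\<Sum>n. ennreal (c n) * indicator (?S n) t)" by simp
      finally show ?thesis .
    qed simp
  qed
  also have "\<dots> = 1 + (\<integral>\<^sup>+ t. (\<Sum>n. ennreal (c n) * indicator (?S n) t) \<partial>I01)"
    by (subst nn_integral_add) (use S in \<open>auto simp: emeasure_restrict_space\<close>)
  also have "(\<integral>\<^sup>+ t. (\<Sum>n. ennreal (c n) * indicator (?S n) t) \<partial>I01) = (\<Sum>n. ennreal (c n * distr_fun f (real n)))"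
    using S by (subst nn_integral_suminf)
      (auto simp: nn_integral_cmult I01.emeasure_eq_measure distr_fun_def ennreal_mult c_def)
  also have "\<dots> \<le> (\<Sum>n. ennreal (C * exp (2 * \<mu>) * exp (- 1) ^ n))"
  proof (intro suminf_le ennreal_leI)
    fix n :: nat
    have "c n * distr_fun f (real n) \<le> c n * (C * exp (- ((2 * \<mu> + 1) * (real n)\<^sup>2)))"
      by (intro mult_left_mono tail) (auto simp: c_def)
    also have "\<dots> = C * exp (\<mu> * (real n + 1)\<^sup>2 - (2 * \<mu> + 1) * (real n)\<^sup>2)"
      by (simp only: c_def diff_conv_add_uminus exp_add mult_ac)
    \<comment> \<open>The rate \<open>2 * \<mu> + 1\<close> pays for the growth of
      \<open>c n\<close>: the exponent equals \<open>2 \<mu> - n^2 - \<mu> (n - 1)^2\<close>, and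
      \<open>n \<le> n^2\<close>.\<close>
    also have "\<dots> \<le> C * exp (2 * \<mu> - real n)"
    proof -
      have "0 \<le> \<mu> * (real n - 1)\<^sup>2" using \<mu> by simp
      moreover have "real n \<le> (real n)\<^sup>2" by (cases n) (auto simp: power2_eq_square)
      ultimately have "\<mu> * (real n + 1)\<^sup>2 - (2 * \<mu> + 1) * (real n)\<^sup>2 \<le> 2 * \<mu> - real n"
        by (simp add: power2_eq_square algebra_simps)
      then show ?thesis using C0 by (simp add: mult_left_mono)
    qed
    also have "\<dots> = C * exp (2 * \<mu>) * exp (- 1) ^ n"
    proof -
      have "exp (- 1) ^ n = exp (- real n)" using exp_of_nat_mult[of n "- 1 :: real"] by simp
      then show ?thesis by (simp only: diff_conv_add_uminus exp_add mult.assoc)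
    qed
    finally show "c n * distr_fun f (real n) \<le> C * exp (2 * \<mu>) * exp (- 1) ^ n" .
  qed auto
  also have "\<dots> < \<infinity>"
  proof -
    have "summable (\<lambda>n. C * exp (2 * \<mu>) * exp (- 1 :: real) ^ n)"
      by (intro summable_mult summable_geometric) simp
    then show ?thesis
      by (subst suminf_ennreal_eq[OF _ summable_sums]) (use C0 in auto)
  qed
  finally show ?thesis by (simp add: ennreal_add_less_top add_left_mono less_top[symmetric])
qed

section \<open>Gaussian tails and equimeasurable transport\<close>

text \<open>Tails of every rate make \<open>N (|f| / \<rho>)\<close> integrable for every
  \<open>\<rho> > 0\<close>, not just for one. Dominated convergence then brings the integral of
  \<open>N (|f - g n| / \<rho>)\<close> below 1 for some truncation \<open>g n\<close>, which bounds
  the Luxemburg norm by \<open>\<rho>\<close>.\<close>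

lemma gaussian_tail_in_closure:
  fixes N :: "real \<Rightarrow> real"
  assumes N: "orlicz_function N" and equiv: "orlicz_equivalent N (\<lambda>t. exp (t\<^sup>2) - 1)"
    and f[measurable]: "f \<in> borel_measurable I01"
    and tail: "\<And>l. 0 < l \<Longrightarrow> \<exists>C. \<forall>\<tau>\<ge>0. distr_fun f \<tau> \<le> C * exp (- (l * \<tau>\<^sup>2))"
  shows "f \<in> closure_L_infty (orlicz_space N)"
proof -
  have N0: "N 0 = 0" and N_mono: "mono_on {0..} N" and N_cont: "continuous_on {0..} N"
    using N by (simp_all add: orlicz_function_def)
  have N_nonneg: "0 \<le> N x" if "0 \<le> x" for x
    using mono_onD[OF N_mono, of 0 x] that N0 by simp
  obtain D t0 where D: "0 < D" "0 \<le> t0" "\<And>t. t0 \<le> t \<Longrightarrow> N t \<le> exp ((D * t)\<^sup>2) - 1"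
    using equiv unfolding orlicz_equivalent_def by blast
  have N_le: "N x \<le> N t0 + exp (D\<^sup>2 * x\<^sup>2)" if "0 \<le> x" for x
  proof (cases "t0 \<le> x")
    case True
    then have "N x \<le> exp (D\<^sup>2 * x\<^sup>2) - 1" using D(3) by (simp add: power_mult_distrib)
    then show ?thesis using N_nonneg[OF D(2)] by linarith
  next
    case False
    then have "N x \<le> N t0" using mono_onD[OF N_mono, of x t0] that by simp
    then show ?thesis by (simp add: add_increasing2)
  qed
  have N_meas: "(\<lambda>t. N \<bar>g t\<bar>) \<in> borel_measurable I01" if [measurable]: "g \<in> borel_measurable I01" for g :: "real \<Rightarrow> real"
  proof -
    have "continuous_on UNIV (\<lambda>x. N (max 0 x))"
      by (rule continuous_on_compose2[OF N_cont]) (auto intro!: continuous_intros)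
    then have [measurable]: "(\<lambda>x. N (max 0 x)) \<in> borel_measurable borel" by (rule borel_measurable_continuous_onI)
    have "(\<lambda>t. N (max 0 \<bar>g t\<bar>)) \<in> borel_measurable I01" by measurable
    then show ?thesis by simp
  qed
  have fin: "(\<integral>\<^sup>+ t. ennreal (N (\<bar>f t\<bar> / \<rho>)) \<partial>I01) < \<infinity>" if \<rho>: "0 < \<rho>" for \<rho>
  proof -
    define \<mu> where "\<mu> = D\<^sup>2 / \<rho>\<^sup>2"
    have \<mu>: "0 < \<mu>" using D(1) \<rho> by (simp add: \<mu>_def)
    then have "0 < 2 * \<mu> + 1" by simp
    from tail[OF this] obtain C where
      C: "\<And>\<tau>. 0 \<le> \<tau> \<Longrightarrow> distr_fun f \<tau> \<le> C * exp (- ((2 * \<mu> + 1) * \<tau>\<^sup>2))" by blast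
    have "(\<integral>\<^sup>+ t. ennreal (N (\<bar>f t\<bar> / \<rho>)) \<partial>I01) \<le>
        (\<integral>\<^sup>+ t. ennreal (N t0) + ennreal (exp (\<mu> * (f t)\<^sup>2)) \<partial>I01)"
    proof (rule nn_integral_mono)
      fix t
      have "N (\<bar>f t\<bar> / \<rho>) \<le> N t0 + exp (\<mu> * (f t)\<^sup>2)"
        using N_le[of "\<bar>f t\<bar> / \<rho>"] \<rho> by (simp add: \<mu>_def power_divide)
      then show "ennreal (N (\<bar>f t\<bar> / \<rho>)) \<le> ennreal (N t0) + ennreal (exp (\<mu> * (f t)\<^sup>2))"
        using N_nonneg[OF D(2)] by (simp add: ennreal_plus[symmetric] ennreal_leI del: ennreal_plus)
    qed
    also have "\<dots> = ennreal (N t0) + (\<integral>\<^sup>+ t. ennreal (exp (\<mu> * (f t)\<^sup>2)) \<partial>I01)"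
      by (subst nn_integral_add) (auto simp: emeasure_restrict_space)
    also have "\<dots> < \<infinity>"
      using exp_square_integrable[OF f \<mu> C] by (simp add: ennreal_add_less_top)
    finally show ?thesis .
  qed
  have f_mem: "f \<in> carrier (orlicz_space N)"
    using fin[of 1] f by (auto simp: orlicz_space_def intro!: exI[of _ 1])
  have "\<exists>g\<in>L_infty \<inter> carrier (orlicz_space N). nrm (orlicz_space N) (\<lambda>t. f t - g t) < e" if e: "0 < e" for e
  proof -
    define \<rho> where "\<rho> = e / 2"
    have \<rho>: "0 < \<rho>" using e by (simp add: \<rho>_def)
    define g where "g n t = (if \<bar>f t\<bar> \<le> real n then f t else 0)" for n t
    have [measurable]: "g n \<in> borel_measurable I01" for n unfolding g_def by measurable
    have h_meas[measurable]: "(\<lambda>t. N (\<bar>f t\<bar> / \<rho>)) \<in> borel_measurable I01"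
      using N_meas[of "\<lambda>t. f t / \<rho>"] \<rho> by simp
    have d_meas[measurable]: "(\<lambda>t. N (\<bar>f t - g n t\<bar> / \<rho>)) \<in> borel_measurable I01" for n
      using N_meas[of "\<lambda>t. (f t - g n t) / \<rho>"] \<rho> by simp
    have "(\<lambda>n. \<integral>\<^sup>+ t. ennreal (N (\<bar>f t - g n t\<bar> / \<rho>)) \<partial>I01) \<longlonglongrightarrow> (\<integral>\<^sup>+ t. 0 \<partial>I01)"
    proof (rule nn_integral_dominated_convergence)
      show "AE t in I01. ennreal (N (\<bar>f t - g n t\<bar> / \<rho>)) \<le> ennreal (N (\<bar>f t\<bar> / \<rho>))" for n
        using \<rho> by (intro AE_I2) (simp add: g_def N0 N_nonneg)
      show "(\<integral>\<^sup>+ t. ennreal (N (\<bar>f t\<bar> / \<rho>)) \<partial>I01) < \<infinity>" by (rule fin[OF \<rho>])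
      show "AE t in I01. (\<lambda>n. ennreal (N (\<bar>f t - g n t\<bar> / \<rho>))) \<longlonglongrightarrow> 0"
      proof (rule AE_I2)
        fix t
        obtain M where M: "\<bar>f t\<bar> \<le> real M" using real_arch_simple by blast
        have "ennreal (N (\<bar>f t - g n t\<bar> / \<rho>)) = 0" if "M \<le> n" for n using M that by (simp add: g_def N0)
        then show "(\<lambda>n. ennreal (N (\<bar>f t - g n t\<bar> / \<rho>))) \<longlonglongrightarrow> 0"
          by (intro tendsto_eventually) (auto simp: eventually_sequentially)
      qed
    qed measurable
    from order_tendstoD(2)[OF this, of 1] obtain n where
      "(\<integral>\<^sup>+ t. ennreal (N (\<bar>f t - g n t\<bar> / \<rho>)) \<partial>I01) < 1"
      by (auto simp: eventually_sequentially)
    then have n: "(\<integral>\<^sup>+ t. ennreal (N (\<bar>f t - g n t\<bar> / \<rho>)) \<partial>I01) \<le> 1" by (rule less_imp_le)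
    have gb: "\<bar>g n t\<bar> \<le> real n" for t by (simp add: g_def)
    have g_inf: "g n \<in> L_infty" using gb by (auto simp: L_infty_def)
    have "(\<integral>\<^sup>+ t. ennreal (N (\<bar>g n t\<bar> / 1)) \<partial>I01) \<le> (\<integral>\<^sup>+ t. ennreal (N (\<bar>f t\<bar> / 1)) \<partial>I01)"
      by (intro nn_integral_mono ennreal_leI mono_onD[OF N_mono]) (auto simp: g_def)
    also have "\<dots> < \<infinity>" by (rule fin) simp
    finally have g_mem: "g n \<in> carrier (orlicz_space N)"
      unfolding orlicz_space_def by (auto intro!: exI[of _ 1])
    have "nrm (orlicz_space N) (\<lambda>t. f t - g n t) \<le> \<rho>"
      unfolding orlicz_space_def fun_space.simps
      by (intro cInf_lower bdd_belowI[of _ 0]) (use n \<rho> in auto)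
    then have "nrm (orlicz_space N) (\<lambda>t. f t - g n t) < e" using e by (simp add: \<rho>_def)
    then show ?thesis using g_inf g_mem by blast
  qed
  then show ?thesis using f_mem by (simp add: closure_L_infty_def)
qed

definition dyadic_level :: "(real \<Rightarrow> real) \<Rightarrow> nat \<Rightarrow> real set" where
  "dyadic_level f n = {t \<in> {0..1}. 2 powi int_decode n < \<bar>f t\<bar> \<and> \<bar>f t\<bar> \<le> 2 * 2 powi int_decode n}"

lemma dyadic_level_sets: "f \<in> borel_measurable I01 \<Longrightarrow> dyadic_level f n \<in> sets I01"
proof -
  assume f: "f \<in> borel_measurable I01"
  have "dyadic_level f n = {t \<in> {0..1}. 2 powi int_decode n < \<bar>f t\<bar>} - {t \<in> {0..1}. 2 * 2 powi int_decode n < \<bar>f t\<bar>}"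
    by (auto simp: dyadic_level_def)
  then show ?thesis using distr_fun_measurable[OF f] by (auto intro!: sets.Diff)
qed

lemma measure_dyadic_level:
  assumes f: "f \<in> borel_measurable I01"
  shows "measure I01 (dyadic_level f n) = distr_fun f (2 powi int_decode n) - distr_fun f (2 * 2 powi int_decode n)"
proof -
  have "dyadic_level f n = {t \<in> {0..1}. 2 powi int_decode n < \<bar>f t\<bar>} - {t \<in> {0..1}. 2 * 2 powi int_decode n < \<bar>f t\<bar>}"
    by (auto simp: dyadic_level_def)
  moreover have "{t \<in> {0..1}. 2 * 2 powi int_decode n < \<bar>f t\<bar>} \<subseteq> {t \<in> {0..1}. 2 powi int_decode n < \<bar>f t\<bar>}"
  proof safe
    fix t assume "2 * 2 powi int_decode n < \<bar>f t\<bar>"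
    moreover have "(0::real) < 2 powi int_decode n" by simp
    ultimately show "2 powi int_decode n < \<bar>f t\<bar>" by linarith
  qed
  ultimately show ?thesis unfolding distr_fun_def
    by (simp only:) (rule I01.finite_measure_Diff[OF distr_fun_measurable[OF f] distr_fun_measurable[OF f]])
qed

lemma dyadic_level_exists:
  assumes "t \<in> {0..1}" "f t \<noteq> 0"
  obtains n where "t \<in> dyadic_level f n"
proof -
  define i where "i = \<lceil>log 2 \<bar>f t\<bar>\<rceil> - 1"
  have pos: "0 < \<bar>f t\<bar>" using assms by simp
  have powi: "(2::real) powi j = 2 powr real_of_int j" for j by (simp add: powr_real_of_int')
  have "real_of_int i < log 2 \<bar>f t\<bar>" "log 2 \<bar>f t\<bar> \<le> real_of_int i + 1" unfolding i_def by linarith+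
  then have "2 powi i < \<bar>f t\<bar>" "\<bar>f t\<bar> \<le> 2 * 2 powi i"
    using pos by (simp_all add: powi less_log_iff log_le_iff powr_add)
  then have "t \<in> dyadic_level f (int_encode i)" using assms(1) by (simp add: dyadic_level_def)
  then show ?thesis by (rule that)
qed

lemma dyadic_level_disjoint: "disjoint_family (dyadic_level f)"
  unfolding disjoint_family_on_def
proof (intro ballI impI)
  fix m n :: nat assume mn: "m \<noteq> n"
  have less: "dyadic_level f m \<inter> dyadic_level f n = {}" if "int_decode m < int_decode n" for m n
  proof -
    have "int_decode m + 1 \<le> int_decode n" using that by simp
    then have "(2::real) powi (int_decode m + 1) \<le> 2 powi int_decode n" by (intro power_int_increasing) auto
    then have "2 * 2 powi int_decode m \<le> (2::real) powi int_decode n" by (simp add: power_int_add)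
    then show ?thesis by (auto simp: dyadic_level_def)
  qed
  have "int_decode m \<noteq> int_decode n" using mn by (metis int_decode_inverse)
  then consider "int_decode m < int_decode n" | "int_decode n < int_decode m" by linarith
  then show "dyadic_level f m \<inter> dyadic_level f n = {}"
    by cases (use less[of m n] less[of n m] in blast)+
qed

text \<open>The distribution of \<open>R\<close> on each dyadic level set of \<open>v\<close> is transported to the level set of \<open>w\<close> of
  the same height, which has the same measure.\<close>

lemma equimeasurable_transport:
  fixes R v w :: "real \<Rightarrow> real"
  assumes R: "R \<in> borel_measurable I01" and v: "v \<in> borel_measurable I01" and w: "w \<in> borel_measurable I01"
    and eq: "equimeasurable w v"
  obtains g where "g \<in> borel_measurable I01"
    "\<And>\<tau>. 0 \<le> \<tau> \<Longrightarrow> distr_fun g \<tau> \<le> distr_fun R \<tau>"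
    "\<And>\<tau>. 0 \<le> \<tau> \<Longrightarrow> distr_fun (\<lambda>t. v t * R t) \<tau> \<le> distr_fun (\<lambda>t. 2 * (g t * w t)) \<tau>"
proof -
  let ?A = "dyadic_level w" and ?B = "dyadic_level v"
  let ?c = "\<lambda>n. 2 powi int_decode n :: real"
  have c: "0 < ?c n" for n by simp
  have A: "?A n \<in> sets I01" and B: "?B n \<in> sets I01" for n by (rule dyadic_level_sets, fact)+
  have "distr_fun w \<tau> = distr_fun v \<tau>" if "0 < \<tau>" for \<tau> using eq that by (simp add: equimeasurable_def)
  then have le: "measure I01 (?B n) \<le> measure I01 (?A n)" for n
    by (simp add: measure_dyadic_level v w)
  have "\<exists>g. g \<in> borel_measurable I01 \<and> (\<forall>t. 0 \<le> g t) \<and>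
      (\<forall>\<tau>\<ge>0. measure I01 {t \<in> ?A n. g t > \<tau>} = measure I01 {t \<in> ?B n. \<bar>R t\<bar> > \<tau>})" for n
    by (rule transport_distribution[OF A B le R, of n]) blast
  then obtain G where G: "\<forall>n. G n \<in> borel_measurable I01 \<and> (\<forall>t. 0 \<le> G n t) \<and>
      (\<forall>\<tau>\<ge>0. measure I01 {t \<in> ?A n. G n t > \<tau>} = measure I01 {t \<in> ?B n. \<bar>R t\<bar> > \<tau>})"
    by (rule choice[OF allI, THEN exE])
  have G_meas[measurable]: "G n \<in> borel_measurable I01" and G0: "0 \<le> G n t"
    and GR: "0 \<le> \<tau> \<Longrightarrow> measure I01 {t \<in> ?A n. G n t > \<tau>} = measure I01 {t \<in> ?B n. \<bar>R t\<bar> > \<tau>}"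
    for n t \<tau>
    using G by simp_all
  define g where "g t = (\<Sum>n. indicator (?A n) t * G n t)" for t
  have [measurable]: "?A n \<in> sets I01" for n by (rule A)
  have gm[measurable]: "g \<in> borel_measurable I01" unfolding g_def by measurable
  have gA: "g t = G n t" if t: "t \<in> ?A n" for n t
  proof -
    have "t \<notin> ?A k" if "k \<noteq> n" for k
      using dyadic_level_disjoint[of w] t that unfolding disjoint_family_on_def by blast
    then have "(\<Sum>k. indicator (?A k) t * G k t) = (\<Sum>k\<in>{n}. indicator (?A k) t * G k t)"
      by (intro suminf_finite) auto
    then show ?thesis using t by (simp add: g_def)
  qed
  have g_zero: "g t = 0" if "\<And>n. t \<notin> ?A n" for t using that by (simp add: g_def)
  have AG: "{t \<in> ?A n. G n t > \<tau>} \<in> sets I01" for n \<tau>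
  proof -
    have "{t \<in> ?A n. G n t > \<tau>} = ?A n \<inter> {t \<in> space I01. G n t > \<tau>}"
      using sets.sets_into_space[OF A[of n]] by auto
    moreover have "{t \<in> space I01. G n t > \<tau>} \<in> sets I01" by measurable
    ultimately show ?thesis using A by simp
  qed
  have BR: "{t \<in> ?B n. \<bar>R t\<bar> > \<tau>} \<in> sets I01" for n \<tau>
  proof -
    have "{t \<in> ?B n. \<bar>R t\<bar> > \<tau>} = ?B n \<inter> {t \<in> {0..1}. \<bar>R t\<bar> > \<tau>}" by (auto simp: dyadic_level_def)
    then show ?thesis using B distr_fun_measurable[OF R] by simp
  qed
  have disj: "disjoint_family (\<lambda>n. {t \<in> dyadic_level f n. P n t})" for f :: "real \<Rightarrow> real" and P
    using dyadic_level_disjoint[of f] unfolding disjoint_family_on_def by blast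
  have transport: "measure I01 (\<Union>n. {t \<in> ?A n. G n t > \<tau> n}) = measure I01 (\<Union>n. {t \<in> ?B n. \<bar>R t\<bar> > \<tau> n})"
    if \<tau>: "\<And>n. 0 \<le> \<tau> n" for \<tau>
  proof -
    have "(\<lambda>n. measure I01 {t \<in> ?A n. G n t > \<tau> n}) sums measure I01 (\<Union>n. {t \<in> ?A n. G n t > \<tau> n})"
      by (intro I01.finite_measure_UNION disj) (use AG in blast)
    moreover have "(\<lambda>n. measure I01 {t \<in> ?B n. \<bar>R t\<bar> > \<tau> n}) sums measure I01 (\<Union>n. {t \<in> ?B n. \<bar>R t\<bar> > \<tau> n})"
      by (intro I01.finite_measure_UNION disj) (use BR in blast)
    ultimately show ?thesis using GR[OF \<tau>] by (simp add: sums_unique2)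
  qed
  show ?thesis
  proof (rule that[OF gm])
    fix \<tau> :: real assume \<tau>: "0 \<le> \<tau>"
    have "distr_fun g \<tau> \<le> measure I01 (\<Union>n. {t \<in> ?A n. G n t > \<tau>})" unfolding distr_fun_def
    proof (rule I01.finite_measure_mono)
      show "{t \<in> {0..1}. \<tau> < \<bar>g t\<bar>} \<subseteq> (\<Union>n. {t \<in> ?A n. G n t > \<tau>})"
      proof safe
        fix t assume t: "\<tau> < \<bar>g t\<bar>"
        then obtain n where n: "t \<in> ?A n" using g_zero[of t] \<tau> by fastforce
        then show "t \<in> (\<Union>n. {t \<in> ?A n. G n t > \<tau>})" using t G0[of n t] by (auto simp: gA)
      qed
    qed (use AG in blast)
    also have "\<dots> = measure I01 (\<Union>n. {t \<in> ?B n. \<bar>R t\<bar> > \<tau>})" by (rule transport) (rule \<tau>)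
    also have "\<dots> \<le> distr_fun R \<tau>" unfolding distr_fun_def
      by (rule I01.finite_measure_mono[OF _ distr_fun_measurable[OF R]]) (auto simp: dyadic_level_def)
    finally show "distr_fun g \<tau> \<le> distr_fun R \<tau>" .
    define \<sigma> where "\<sigma> n = \<tau> / (2 * ?c n)" for n
    have \<sigma>: "0 \<le> \<sigma> n" for n using \<tau> by (simp add: \<sigma>_def)
    have "distr_fun (\<lambda>t. v t * R t) \<tau> \<le> measure I01 (\<Union>n. {t \<in> ?B n. \<bar>R t\<bar> > \<sigma> n})"
      unfolding distr_fun_def
    proof (rule I01.finite_measure_mono)
      show "{t \<in> {0..1}. \<tau> < \<bar>v t * R t\<bar>} \<subseteq> (\<Union>n. {t \<in> ?B n. \<bar>R t\<bar> > \<sigma> n})"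
      proof safe
        fix t :: real assume t: "t \<in> {0..1}" "\<tau> < \<bar>v t * R t\<bar>"
        have "v t \<noteq> 0" using t(2) \<tau> by auto
        with t(1) obtain n where n: "t \<in> ?B n" using dyadic_level_exists by blast
        have "\<bar>v t\<bar> * \<bar>R t\<bar> \<le> 2 * ?c n * \<bar>R t\<bar>" using n by (intro mult_right_mono) (auto simp: dyadic_level_def)
        then have "\<tau> < 2 * ?c n * \<bar>R t\<bar>" using t(2) by (simp add: abs_mult)
        then have "\<sigma> n < \<bar>R t\<bar>" using c[of n] by (simp add: \<sigma>_def field_simps)
        then show "t \<in> (\<Union>n. {t \<in> ?B n. \<bar>R t\<bar> > \<sigma> n})" using n by blast
      qed
    qed (use BR in blast)
    also have "\<dots> = measure I01 (\<Union>n. {t \<in> ?A n. G n t > \<sigma> n})" by (rule transport[symmetric]) (rule \<sigma>)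
    also have "\<dots> \<le> distr_fun (\<lambda>t. 2 * (g t * w t)) \<tau>" unfolding distr_fun_def
    proof (rule I01.finite_measure_mono)
      show "{t \<in> {0..1}. \<tau> < \<bar>2 * (g t * w t)\<bar>} \<in> sets I01"
        by (rule distr_fun_measurable) (use w in measurable)
      show "(\<Union>n. {t \<in> ?A n. G n t > \<sigma> n}) \<subseteq> {t \<in> {0..1}. \<tau> < \<bar>2 * (g t * w t)\<bar>}"
      proof safe
        fix n t assume t: "t \<in> ?A n" "\<sigma> n < G n t"
        show "t \<in> {0..1}" using t(1) by (simp add: dyadic_level_def)
        have "\<tau> < 2 * ?c n * G n t" using t(2) c[of n] by (simp add: \<sigma>_def field_simps)
        also have "\<dots> \<le> 2 * \<bar>w t\<bar> * G n t"
          using t(1) G0[of n t] by (intro mult_right_mono) (auto simp: dyadic_level_def)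
        also have "\<dots> = \<bar>2 * (g t * w t)\<bar>" using G0[of n t] by (simp add: gA[OF t(1)] abs_mult)
        finally show "\<tau> < \<bar>2 * (g t * w t)\<bar>" .
      qed
    qed
    finally show "distr_fun (\<lambda>t. v t * R t) \<tau> \<le> distr_fun (\<lambda>t. 2 * (g t * w t)) \<tau>" .
  qed
qed

context symmetric_function_space
begin

lemma bounded_in_multiplicator:
  assumes f[measurable]: "f \<in> borel_measurable I01" and K: "distr_fun f K = 0"
  shows "f \<in> multiplicator X"
  unfolding multiplicator_def
proof (intro CollectI conjI allI impI f)
  fix a assume "rademacher_convergent a \<and> rademacher_sum a \<in> carrier X"
  then have r: "rademacher_sum a \<in> carrier X" by simp
  have [measurable]: "rademacher_sum a \<in> borel_measurable I01" by (rule carrier_measurable[OF r])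
  have "{t \<in> {0..1}. \<bar>f t\<bar> > K} \<in> null_sets I01"
    using K distr_fun_measurable[OF f] by (simp add: null_sets_def I01.emeasure_eq_measure distr_fun_def)
  then have "AE t in I01. t \<notin> {t \<in> {0..1}. \<bar>f t\<bar> > K}" by (rule AE_not_in)
  then have "AE t in I01. \<bar>f t * rademacher_sum a t\<bar> \<le> \<bar>K * rademacher_sum a t\<bar>"
    using AE_space
  proof eventually_elim
    case (elim t)
    then have "\<bar>f t\<bar> \<le> \<bar>K\<bar>" by auto
    then show ?case by (simp add: abs_mult mult_right_mono)
  qed
  then show "(\<lambda>t. f t * rademacher_sum a t) \<in> carrier X"
    by (intro carrier_AE_le(1)[OF carrier_scale[OF r]]) measurable
qed

lemma closure_subset_imp_sym_kernel:
  assumes N: "orlicz_function N" "orlicz_equivalent N (\<lambda>t. exp (t\<^sup>2) - 1)"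
    and w: "w \<in> multiplicator X"
    and sub: "closure_L_infty (orlicz_space N) \<subseteq> carrier (weighted X w)"
  shows "w \<in> sym_kernel X"
  unfolding sym_kernel_def
proof (intro CollectI conjI ballI impI w)
  fix v assume v[measurable]: "v \<in> borel_measurable I01" and eq: "equimeasurable w v"
  show "v \<in> multiplicator X" unfolding multiplicator_def
  proof (intro CollectI conjI allI impI v)
    fix a assume a: "rademacher_convergent a \<and> rademacher_sum a \<in> carrier X"
    then have a2: "a \<in> ell2" by (intro rademacher_convergent_ell2) simp
    let ?R = "rademacher_sum a"
    have R[measurable]: "?R \<in> borel_measurable I01" by (rule borel_measurable_I01) measurable
    have wm: "w \<in> borel_measurable I01" using w by (simp add: multiplicator_def)
    obtain g where g: "g \<in> borel_measurable I01"
      "\<And>\<tau>. 0 \<le> \<tau> \<Longrightarrow> distr_fun g \<tau> \<le> distr_fun ?R \<tau>"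
      "\<And>\<tau>. 0 \<le> \<tau> \<Longrightarrow> distr_fun (\<lambda>t. v t * ?R t) \<tau> \<le> distr_fun (\<lambda>t. 2 * (g t * w t)) \<tau>"
      using equimeasurable_transport[OF R v wm eq] by blast
    have "g \<in> closure_L_infty (orlicz_space N)"
    proof (rule gaussian_tail_in_closure[OF N g(1)])
      fix l :: real assume "0 < l"
      from rademacher_sum_gaussian_tail[OF a2 this] obtain C
        where C: "\<And>\<tau>. 0 \<le> \<tau> \<Longrightarrow> distr_fun ?R \<tau> \<le> C * exp (- (l * \<tau>\<^sup>2))" by blast
      have "distr_fun g \<tau> \<le> C * exp (- (l * \<tau>\<^sup>2))" if "0 \<le> \<tau>" for \<tau>
        using g(2)[OF that] C[OF that] by (rule order_trans)
      then show "\<exists>C. \<forall>\<tau>\<ge>0. distr_fun g \<tau> \<le> C * exp (- (l * \<tau>\<^sup>2))" by blast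
    qed
    then have "(\<lambda>t. g t * w t) \<in> carrier X" using sub by (auto simp: weighted_def)
    then have "(\<lambda>t. 2 * (g t * w t)) \<in> carrier X" by (rule carrier_scale)
    then show "(\<lambda>t. v t * ?R t) \<in> carrier X"
    proof (rule carrier_distr_fun_le(1))
      show "distr_fun (\<lambda>t. v t * ?R t) \<tau> \<le> distr_fun (\<lambda>t. 2 * (g t * w t)) \<tau>" if "0 \<le> \<tau>" for \<tau>
        by (rule g(3)[OF that])
    qed measurable
  qed
qed

lemma unbounded_of_not_sym_kernel:
  assumes w: "w \<in> multiplicator X" "w \<notin> sym_kernel X"
  shows "0 < distr_fun w K"
proof (rule ccontr)
  assume "\<not> 0 < distr_fun w K"
  then have zero: "distr_fun w K = 0" using distr_fun_nonneg[of w K] by linarith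
  have wm: "w \<in> borel_measurable I01" using w by (simp add: multiplicator_def)
  have "distr_fun w (max K 1) \<le> distr_fun w K" unfolding distr_fun_def
    by (rule I01.finite_measure_mono[OF _ distr_fun_measurable[OF wm]]) auto
  then have zero1: "distr_fun w (max K 1) = 0" using zero distr_fun_nonneg[of w "max K 1"] by linarith
  have "v \<in> multiplicator X" if "v \<in> borel_measurable I01" "equimeasurable w v" for v
  proof (rule bounded_in_multiplicator[OF that(1)])
    show "distr_fun v (max K 1) = 0" using that(2) zero1 by (simp add: equimeasurable_def)
  qed
  then show False using w by (simp add: sym_kernel_def)
qed

end

theorem corollary3p2:
  fixes X :: fun_space and N2 :: "real \<Rightarrow> real"
  assumes "symmetric_space X"
    and "isometric_in_bidual X"
    and "orlicz_function N2"
    and "orlicz_equivalent N2 (\<lambda>t. exp (t\<^sup>2) - 1)"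
    and "sym_kernel X \<noteq> multiplicator X"
  shows "\<forall>w \<in> multiplicator X - sym_kernel X.
           (AE t in I01. w t > 0) \<and>
           L_infty \<subseteq> carrier (weighted X w) \<and> carrier (weighted X w) \<subseteq> L_one \<longrightarrow>
           rademacher_span_ell2 (weighted X w) \<and>
           \<not> closure_L_infty (orlicz_space N2) \<subseteq> carrier (weighted X w)"
proof (intro ballI impI, elim conjE)
  fix w assume w: "w \<in> multiplicator X - sym_kernel X" and pos: "AE t in I01. w t > 0"
    and inf: "L_infty \<subseteq> carrier (weighted X w)" and one: "carrier (weighted X w) \<subseteq> L_one"
  interpret isometric_symmetric_space X by standard fact+
  have "(\<lambda>t. 1) \<in> L_infty" by (auto simp: L_infty_def intro!: exI[of _ 1])
  then have "(\<lambda>t. 1) \<in> carrier (weighted X w)" using inf by blast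
  then have w_mem: "w \<in> carrier X" by (simp add: weighted_def)
  interpret unbounded_multiplier X w
    by standard (use w pos w_mem unbounded_of_not_sym_kernel in auto)
  show "rademacher_span_ell2 (weighted X w) \<and> \<not> closure_L_infty (orlicz_space N2) \<subseteq> carrier (weighted X w)"
    using rademacher_span_weighted[OF one] closure_subset_imp_sym_kernel[OF assms(3,4)] w by blast
qed

end
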